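(* Let $n\ge1$, $\Lambda\ge 1$, and let $u\in C(\overline{B_1})$, where $B_1\subset\mathbb{R}^n$ is the open unit ball, satisfy $M_\Lambda^-(D^2u)\le 0$ in $B_1$ in the viscosity sense. Then for all $t\ge 2$, $$\bigl|\{x\in B_1:\ \underline{\Theta}_u(x) > 2^{10n}\|u\|_{L^\infty(B_1)}\,t\}\bigr| \le |B_1|\,t^{-\epsilon},\qquad \epsilon = 2^{-3}(2n\Lambda)^{1-n}.$$
   Context: For a symmetric $n\times n$ matrix $N$, the Pucci operator is $M_\Lambda^-(N) := (\text{sum of positive eigenvalues of }N) + \Lambda\,(\text{sum of negative eigenvalues of }N)$. For a bounded domain $\Omega$ and $u,\varphi\in C(\overline{\Omega})$, $\varphi$ is tangent from below to $u$ in $\Omega$ at $x_0\in\Omega$ if $\varphi\le u$ in $\overline\Omega$ and $\varphi(x_0)=u(x_0)$. $M_\Lambda^-(D^2u)\le 0$ in the viscosity sense in $\Omega$ means: $M_\Lambda^-(D^2\varphi(x_0))\le 0$ whenever $\varphi\in C^2(\overline\Omega)$ is tangent from below to $u$ in $\Omega$ at some $x_0\in\Omega$. A paraboloid has opening $a$ if its Hessian is $aI$. For $x\in\Omega$, $\underline{\Theta}_u(x)$ is the smallest $a\ge 0$ such that some paraboloid of opening $-a$ is tangent from below to $u$ in $\Omega$ at $x$, and $\underline{\Theta}_u(x)=\infty$ if no such paraboloid exists; here $\Omega=B_1$. $|\cdot|$ denotes Lebesgue measure. *)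

theory Defs
  imports "HOL-Analysis.Analysis" "HOL-Computational_Algebra.Polynomial"
begin

definition charpoly :: "real^'n^'n \<Rightarrow> real poly" where
  "charpoly N = det (\<chi> i j. (if i = j then [:0, 1:] else 0) - [: N $ i $ j :])"

definition pos_eig_sum :: "real^'n^'n \<Rightarrow> real" where
  "pos_eig_sum N = (\<Sum>a\<in>{a. a > 0 \<and> poly (charpoly N) a = 0}. a * real (order a (charpoly N)))"

definition neg_eig_sum :: "real^'n^'n \<Rightarrow> real" where
  "neg_eig_sum N = (\<Sum>a\<in>{a. a < 0 \<and> poly (charpoly N) a = 0}. a * real (order a (charpoly N)))"

definition pucci_minus :: "real \<Rightarrow> real^'n^'n \<Rightarrow> real" where
  "pucci_minus Lam N = pos_eig_sum N + Lam * neg_eig_sum N"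

definition C2_on :: "(real^'n) set \<Rightarrow> (real^'n \<Rightarrow> real) \<Rightarrow> (real^'n \<Rightarrow> real^'n)
    \<Rightarrow> (real^'n \<Rightarrow> real^'n^'n) \<Rightarrow> bool" where
  "C2_on S phi Dphi H \<longleftrightarrow>
     (\<forall>x\<in>S. (phi has_derivative (\<lambda>h. Dphi x \<bullet> h)) (at x within S)) \<and>
     (\<forall>x\<in>S. (Dphi has_derivative (\<lambda>h. H x *v h)) (at x within S)) \<and>
     continuous_on S H"

definition tangent_below :: "(real^'n) set \<Rightarrow> (real^'n \<Rightarrow> real) \<Rightarrow> (real^'n \<Rightarrow> real) \<Rightarrow> real^'n \<Rightarrow> bool" where
  "tangent_below \<Omega> phi u x0 \<longleftrightarrow> (\<forall>x\<in>closure \<Omega>. phi x \<le> u x) \<and> phi x0 = u x0"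

definition visc_pucci_super :: "real \<Rightarrow> (real^'n) set \<Rightarrow> (real^'n \<Rightarrow> real) \<Rightarrow> bool" where
  "visc_pucci_super Lam \<Omega> u \<longleftrightarrow>
     (\<forall>phi Dphi H x0. C2_on (closure \<Omega>) phi Dphi H \<and> x0 \<in> \<Omega> \<and> tangent_below \<Omega> phi u x0
        \<longrightarrow> pucci_minus Lam (H x0) \<le> 0)"

text \<open>Paraboloids of opening -a: Hessian -a I.\<close>
definition paraboloid :: "real \<Rightarrow> real^'n \<Rightarrow> real \<Rightarrow> real^'n \<Rightarrow> real" where
  "paraboloid a b c x = - (a / 2) * (x \<bullet> x) + b \<bullet> x + c"

definition Theta_low :: "(real^'n) set \<Rightarrow> (real^'n \<Rightarrow> real) \<Rightarrow> real^'n \<Rightarrow> ereal" where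
  "Theta_low \<Omega> u x = Inf {ereal a | a. a \<ge> 0 \<and>
      (\<exists>b c. tangent_below \<Omega> (paraboloid a b c) u x)}"

end

(*
  Mooney's localization-free argument. Let A(a) be the set of points of the unit ball where u is touched
  from below by a paraboloid of opening -a. For x outside A(a), a support at x of the convex envelope of
  u + a|y|^2/2 determines the vertex of a paraboloid of opening -2a, and by monotonicity of slopes x is a
  2-Lipschitz function of that vertex. Slid up until it touches u, the paraboloid lands in A(2a) - A(a).
  Hence, up to a boundary layer, the complement of A(a) has measure at most 2^n times that of the set of
  vertices reached from A(2a) - A(a). The map from contact points to vertices is locally Lipschitz by a
  quadratic barrier, hence differentiable almost everywhere. Where it is, its derivative gives a second
  order expansion of u, the equation applies, and since one eigenvalue of the Hessian is nonpositive, the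
  Jacobian is at most (n Lam)^(n-1). So a fixed fraction of the complement of A(a) is absorbed each time
  the opening doubles, and iterating gives the power decay.
*)

theory Submission
  imports Defs
begin

section \<open>Rademacher's theorem\<close>

text \<open>The slope map lives only on a contact set, which may have empty interior, while the
  equation needs a quadratic below \<open>u\<close> at all nearby points of the ball. So its
  derivative is taken within the set, at points where the distance to the set has derivative zero,
  and monotonicity of the supports carries the expansion to the points in between. Since
  \<open>u\<close> is only continuous, the Lipschitz bound on slopes has to come first: without it a
  null set of contact points could carry a large set of vertices. The constants: with
  \<open>b = 2 a\<close> the Jacobian bound \<open>b ^ n (n Lam) ^ (n - 1)\<close> meets the factor
  \<open>(1 / a) ^ n\<close> of the inverse map, so each doubling absorbs the fraction
  \<open>c = 1 / (2 ^ n (n Lam) ^ (n - 1))\<close>, which is \<open>(2 n Lam) ^ (1 - n) / 2\<close>.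
  The final exponent is \<open>c / 4\<close>, which leaves room for the boundary layer. That layer
  has width \<open>3 sqrt (K / a)\<close> with \<open>K\<close> the sup norm; for
  \<open>a = 2 ^ (10 n) K s\<close> it occupies at most the fraction
  \<open>(3/32) s powr (- 1/2)\<close> of the ball, and this fixes
  \<open>2 ^ (10 n)\<close>.\<close>

text \<open>After adding a steep linear function, \<open>phi\<close> is bi-Lipschitz; the pullback of Lebesgue measure is then
  absolutely continuous, and its density at Lebesgue points is the derivative.\<close>

lemma lipschitz_real_diff_quotient_converges:
  fixes phi :: "real \<Rightarrow> real"
  assumes "L-lipschitz_on UNIV phi"
  shows "negligible {t. \<not> convergent (\<lambda>k. real (Suc k) * (phi (t + 1 / real (Suc k)) - phi t))}"
proof -
  have L0: "L \<ge> 0"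
    using assms lipschitz_on_nonneg by blast
  have lip: "\<bar>phi s - phi t\<bar> \<le> L * \<bar>s - t\<bar>" for s t
    using lipschitz_onD[OF assms, of s t] by (simp add: dist_real_def)
  \<comment> \<open>The slope \<open>L + 1\<close> exceeds the steepest possible descent of
    \<open>phi\<close> by one, so \<open>F\<close> expands distances and its inverse
    \<open>G\<close> is 1-Lipschitz, hence Borel.\<close>
  define F where "F t = phi t + (L + 1) * t" for t
  have Fexp: "F s - F t \<ge> s - t" if "t \<le> s" for s t
    using lip[of s t] that by (auto simp: F_def algebra_simps abs_if split: if_splits)
  have Flip: "\<bar>F s - F t\<bar> \<le> (2 * L + 1) * \<bar>s - t\<bar>" for s t
  proof -
    have "F s - F t = (phi s - phi t) + (L + 1) * (s - t)"
      by (simp add: F_def algebra_simps)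
    then have "\<bar>F s - F t\<bar> \<le> \<bar>phi s - phi t\<bar> + (L + 1) * \<bar>s - t\<bar>"
      using L0 abs_triangle_ineq[of "phi s - phi t" "(L + 1) * (s - t)"] by (simp add: abs_mult)
    then show ?thesis
      using lip[of s t] by (simp add: algebra_simps)
  qed
  have contF: "continuous_on S F" for S
  proof -
    have "(2 * L + 1)-lipschitz_on S F"
      using Flip L0 by (intro lipschitz_onI) (auto simp: dist_real_def)
    then show ?thesis
      by (rule lipschitz_on_continuous_on)
  qed
  have strict: "s < t \<Longrightarrow> F s < F t" for s t
    using Fexp[of s t] by auto
  then have injF: "inj F"
    by (metis injI linorder_neqE_linordered_idom order_less_irrefl)
  have surjF: "\<exists>t. F t = y" for y
  proof -
    define r where "r = \<bar>y - F 0\<bar>"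
    have "F (- r) \<le> y" "y \<le> F r"
      using Fexp[of 0 r] Fexp[of "-r" 0] by (auto simp: r_def)
    then show ?thesis
      using IVT'[of F "-r" y r] contF[of "{- r..r}"] by (auto simp: r_def)
  qed
  define G where "G = inv F"
  have FG: "F (G y) = y" for y
    using surjF unfolding G_def by (metis f_inv_into_f rangeI)
  have GF: "G (F y) = y" for y
    unfolding G_def using injF by simp
  have Glip: "1-lipschitz_on UNIV G"
  proof (intro lipschitz_onI)
    fix x y show "dist (G x) (G y) \<le> 1 * dist x y"
      using Fexp[of "G x" "G y"] Fexp[of "G y" "G x"]
      by (cases "G x \<le> G y") (auto simp: dist_real_def FG)
  qed auto
  have Gmeas[measurable]: "G \<in> borel_measurable borel"
    using Glip lipschitz_on_continuous_on by (intro borel_measurable_continuous_onI) blast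
  define m where "m = distr lborel borel G"
  have sets_m: "sets m = sets lborel"
    by (simp add: m_def)
  have im: "G -` A = F ` A" for A
    by (auto simp: GF) (metis FG image_iff)
  have em: "emeasure m A = emeasure lborel (F ` A)" if "A \<in> sets borel" for A
    using that by (simp add: m_def emeasure_distr flip: im)
  have ac: "absolutely_continuous lborel m"
    unfolding absolutely_continuous_def
  proof
    fix A assume A: "A \<in> null_sets (lborel::real measure)"
    then have Ab: "A \<in> sets borel" by auto
    have "negligible A"
      using A by (simp add: negligible_iff_null_sets null_sets_completionI)
    then have "negligible (F ` A)"
      using Flip by (intro negligible_locally_Lipschitz_image) (auto intro!: exI[of _ UNIV] exI[of _ "2*L+1"])
    moreover have "F ` A \<in> sets borel"
      using measurable_sets[OF Gmeas Ab] by (simp add: im)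
    ultimately have "emeasure lborel (F ` A) = 0"
      by (auto simp: negligible_iff_null_sets null_sets_completion_iff)
    then show "A \<in> null_sets m"
      using em[OF Ab] Ab by (auto simp: null_sets_def m_def)
  qed
  then obtain g where g[measurable]: "g \<in> borel_measurable borel" and gd: "density lborel g = m"
    using sigma_finite_measure.Radon_Nikodym[OF sigma_finite_lborel ac sets_m] by auto
  have gint: "(\<integral>\<^sup>+x. g x * indicator {a..b} x \<partial>lborel) = ennreal (F b - F a)" if ab: "a \<le> b" for a b
  proof -
    have "(\<integral>\<^sup>+x. g x * indicator {a..b} x \<partial>lborel) = emeasure m {a..b}"
      unfolding gd[symmetric] by (subst emeasure_density) auto
    also have "\<dots> = emeasure lborel (F ` {a..b})"
      by (rule em) auto
    also have "F ` {a..b} = {F a..F b}"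
    proof
      show "F ` {a..b} \<subseteq> {F a..F b}"
        using strict by (auto simp: le_less)
      show "{F a..F b} \<subseteq> F ` {a..b}"
      proof
        fix y assume "y \<in> {F a..F b}"
        then obtain x where "a \<le> x" "x \<le> b" "F x = y"
          using IVT'[of F a y b] ab contF[of "{a..b}"] by auto
        then show "y \<in> F ` {a..b}" by auto
      qed
    qed
    also have "emeasure lborel {F a..F b} = ennreal (F b - F a)"
      using that strict by (auto simp: le_less)
    finally show ?thesis .
  qed
  define h where "h x = enn2real (g x)" for x
  have h0: "h x \<ge> 0" for x by (simp add: h_def)
  have hm[measurable]: "h \<in> borel_measurable borel"
    unfolding h_def by measurable
  have hint: "(h has_integral (F b - F a)) {a..b}" if "a \<le> b" for a b
  proof -
    have "AE x in lborel. g x * indicator {a..b} x \<noteq> \<infinity>"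
      using gint[OF that] by (intro nn_integral_PInf_AE) auto
    then have "AE x in lborel. ennreal (h x * indicator {a..b} x) = g x * indicator {a..b} x"
      by eventually_elim (auto simp: h_def indicator_def ennreal_enn2real_if)
    then have "(\<integral>\<^sup>+x. ennreal (h x * indicator {a..b} x) \<partial>lborel) = ennreal (F b - F a)"
      using gint[OF that] nn_integral_cong_AE by metis
    then have "((\<lambda>x. h x * indicator {a..b} x) has_integral (F b - F a)) UNIV"
      using that Fexp[OF that] h0 by (intro nn_integral_has_integral) auto
    moreover have "(\<lambda>x. h x * indicator {a..b} x) = (\<lambda>x. if x \<in> {a..b} then h x else 0)"
      by (auto simp: indicator_def)
    ultimately show ?thesis
      by (simp only: has_integral_restrict_UNIV)
  qed
  have "h integrable_on cbox a b" for a b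
    using hint[of a b] by (cases "a \<le> b") auto
  \<comment> \<open>The averages run over cubes with lower corner \<open>x\<close>; in dimension one
    these are forward difference quotients of \<open>F\<close>.\<close>
  from integrable_ccontinuous_explicit[OF this] obtain N where N: "negligible N"
    and Nd: "\<And>x e. \<lbrakk>x \<notin> N; 0 < e\<rbrakk> \<Longrightarrow> \<exists>d>0. \<forall>k. 0 < k \<and> k < d \<longrightarrow>
        norm (integral (cbox x (x + k *\<^sub>R One)) h /\<^sub>R k ^ DIM(real) - h x) < e"
    by blast
  have "convergent (\<lambda>k. real (Suc k) * (phi (t + 1 / real (Suc k)) - phi t))" if t: "t \<notin> N" for t
  proof -
    have "(\<lambda>k. real (Suc k) * (phi (t + 1 / real (Suc k)) - phi t)) \<longlonglongrightarrow> h t - (L + 1)"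
      unfolding LIMSEQ_def
    proof (intro allI impI)
      fix e :: real assume "e > 0"
      then obtain d where d: "d > 0" and D: "\<And>k. 0 < k \<Longrightarrow> k < d \<Longrightarrow>
          norm (integral (cbox t (t + k *\<^sub>R One)) h /\<^sub>R k ^ DIM(real) - h t) < e"
        using Nd[OF t] by blast
      obtain n0 where n0: "inverse (real (Suc n0)) < d"
        using reals_Archimedean[OF d] by blast
      show "\<exists>no. \<forall>n\<ge>no. dist (real (Suc n) * (phi (t + 1 / real (Suc n)) - phi t)) (h t - (L + 1)) < e"
      proof (intro exI allI impI)
        fix n assume "n \<ge> n0"
        define k where "k = 1 / real (Suc n)"
        have k: "k > 0" "k < d"
        proof -
          have "1 / real (Suc n) \<le> inverse (real (Suc n0))"
            using \<open>n \<ge> n0\<close> by (simp add: field_simps)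
          then show "k < d" using n0 by (simp add: k_def)
        qed (simp add: k_def)
        have "integral {t..t + k} h = F (t + k) - F t"
          using hint[of t "t + k"] k by (auto intro: integral_unique)
        then have "\<bar>(F (t + k) - F t) / k - h t\<bar> < e"
          using D[OF k] by (simp add: divide_inverse_commute)
        moreover have "(F (t + k) - F t) / k = (phi (t + k) - phi t) / k + (L + 1)"
          using k by (simp add: F_def field_simps)
        moreover have "real (Suc n) * (phi (t + k) - phi t) = (phi (t + k) - phi t) / k"
          by (simp add: k_def)
        ultimately show "dist (real (Suc n) * (phi (t + 1 / real (Suc n)) - phi t)) (h t - (L + 1)) < e"
          by (simp add: dist_real_def k_def algebra_simps)
      qed
    qed
    then show ?thesis
      by (rule convergentI)
  qed
  then show ?thesis
    by (intro negligible_subset[OF N]) auto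
qed

text \<open>Only the step sizes \<open>1 / Suc k\<close> occur, so for continuous \<open>f\<close>
  convergence in \<open>k\<close> is a Borel condition on \<open>x\<close>;
  \<open>tendsto_directional_diff_quotient\<close> recovers the limit over all positive
  steps.\<close>

definition diff_quotient :: "('a::real_normed_vector \<Rightarrow> real) \<Rightarrow> 'a \<Rightarrow> nat \<Rightarrow> 'a \<Rightarrow> real" where
  "diff_quotient f v k x = real (Suc k) * (f (x + v /\<^sub>R real (Suc k)) - f x)"

text \<open>The bound is uniform in \<open>k\<close> and \<open>x\<close>; this lets countably many
  directions control all of them in \<open>rademacher_real\<close>.\<close>

lemma diff_quotient_diff_le:
  assumes "L-lipschitz_on UNIV f"
  shows "\<bar>diff_quotient f v k x - diff_quotient f w k x\<bar> \<le> L * norm (v - w)"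
proof -
  have "\<bar>f (x + v /\<^sub>R real (Suc k)) - f (x + w /\<^sub>R real (Suc k))\<bar> \<le> L * norm ((v - w) /\<^sub>R real (Suc k))"
    using lipschitz_onD[OF assms, of "x + v /\<^sub>R real (Suc k)" "x + w /\<^sub>R real (Suc k)"]
    by (simp add: dist_real_def dist_norm scaleR_diff_right)
  then have "real (Suc k) * \<bar>f (x + v /\<^sub>R real (Suc k)) - f (x + w /\<^sub>R real (Suc k))\<bar>
      \<le> real (Suc k) * (L * norm ((v - w) /\<^sub>R real (Suc k)))"
    by (intro mult_left_mono) auto
  moreover have "diff_quotient f v k x - diff_quotient f w k x
      = real (Suc k) * (f (x + v /\<^sub>R real (Suc k)) - f (x + w /\<^sub>R real (Suc k)))"
    by (simp add: diff_quotient_def algebra_simps)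
  moreover have "real (Suc k) * (L * norm ((v - w) /\<^sub>R real (Suc k))) = L * norm (v - w)"
    by simp
  ultimately show ?thesis
    by (simp only: abs_mult abs_of_nat)
qed

lemma diff_quotient_zero [simp]: "diff_quotient f 0 k x = 0"
  by (simp add: diff_quotient_def)

lemma abs_diff_quotient_le:
  assumes "L-lipschitz_on UNIV f"
  shows "\<bar>diff_quotient f v k x\<bar> \<le> L * norm v"
  using diff_quotient_diff_le[OF assms, of v k x 0] by simp

lemma borel_measurable_diff_quotient:
  fixes f :: "'a::euclidean_space \<Rightarrow> real"
  assumes "L-lipschitz_on UNIV f"
  shows "diff_quotient f v k \<in> borel_measurable borel"
proof -
  have "continuous_on UNIV f"
    using assms by (rule lipschitz_on_continuous_on)
  then have [measurable]: "f \<in> borel_measurable borel"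
    by (rule borel_measurable_continuous_onI)
  show ?thesis
    unfolding diff_quotient_def by measurable
qed

text \<open>On each line parallel to \<open>v\<close> the claim is one-dimensional. Averaging over
  the translations by \<open>t v\<close> with \<open>t\<close> in [0,1] and applying Fubini turns
  null sets on lines into a null set, without rotating \<open>v\<close> onto a coordinate
  axis.\<close>

lemma negligible_not_convergent_diff_quotient:
  fixes f :: "'a::euclidean_space \<Rightarrow> real"
  assumes lip: "L-lipschitz_on UNIV f"
  shows "negligible {x. \<not> convergent (\<lambda>k. diff_quotient f v k x)}" (is "negligible ?N")
proof -
  note [measurable] = borel_measurable_diff_quotient[OF lip]
  have "{x. \<not> convergent (\<lambda>k. diff_quotient f v k x)} = {x. \<not> Cauchy (\<lambda>k. diff_quotient f v k x)}"
    by (simp add: Cauchy_convergent_iff)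
  also have "\<dots> \<in> sets borel"
    using sets_Collect_Cauchy[of "\<lambda>k. diff_quotient f v k" borel] by simp
  finally have N[measurable]: "?N \<in> sets borel" .
  have line: "(\<integral>\<^sup>+t. indicator ?N (x + t *\<^sub>R v) * indicator {0..1::real} t \<partial>lborel) = 0" for x
  proof -
    define phi where "phi t = f (x + t *\<^sub>R v)" for t
    have "(L * norm v)-lipschitz_on UNIV phi"
    proof (rule lipschitz_onI)
      fix s t show "dist (phi s) (phi t) \<le> L * norm v * dist s t"
        using lipschitz_onD[OF lip, of "x + s *\<^sub>R v" "x + t *\<^sub>R v"]
        by (simp add: phi_def dist_norm flip: scaleR_diff_left) (simp add: dist_real_def mult_ac)
    qed (simp add: lipschitz_on_nonneg[OF lip])
    from lipschitz_real_diff_quotient_converges[OF this]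
    have "negligible {t. \<not> convergent (\<lambda>k. diff_quotient f v k (x + t *\<^sub>R v))}"
      by (simp add: diff_quotient_def phi_def algebra_simps divide_inverse)
    then have "{t. x + t *\<^sub>R v \<in> ?N} \<in> null_sets lebesgue"
      by (simp add: negligible_iff_null_sets)
    moreover have "{t. x + t *\<^sub>R v \<in> ?N} \<in> sets borel"
      by measurable
    ultimately have "{t. x + t *\<^sub>R v \<in> ?N} \<in> null_sets lborel"
      using null_sets_completion_iff by (metis sets_lborel)
    then have "AE t in lborel. t \<notin> {t. x + t *\<^sub>R v \<in> ?N}"
      by (rule AE_not_in)
    then have "AE t in lborel. indicator ?N (x + t *\<^sub>R v) * indicator {0..1::real} t = (0::ennreal)"
      by eventually_elim (auto simp: indicator_def)
    then show ?thesis
      by (subst nn_integral_0_iff_AE) auto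
  qed
  have shift: "(\<integral>\<^sup>+x. indicator ?N (x + t *\<^sub>R v) \<partial>lborel) = emeasure lborel ?N" for t :: real
  proof -
    have "emeasure lborel ?N = (\<integral>\<^sup>+x. indicator ?N x \<partial>distr lborel borel ((+) (t *\<^sub>R v)))"
      by (simp add: lborel_distr_plus)
    also have "\<dots> = (\<integral>\<^sup>+x. indicator ?N (t *\<^sub>R v + x) \<partial>lborel)"
      by (subst nn_integral_distr) auto
    finally show ?thesis by (simp add: add.commute)
  qed
  have "emeasure lborel ?N = (\<integral>\<^sup>+t. emeasure lborel ?N * indicator {0..1::real} t \<partial>lborel)"
    by (simp add: nn_integral_cmult_indicator)
  also have "\<dots> = (\<integral>\<^sup>+t. (\<integral>\<^sup>+x. indicator ?N (x + t *\<^sub>R v) * indicator {0..1::real} t \<partial>lborel) \<partial>lborel)"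
    by (simp add: nn_integral_multc shift)
  also have "\<dots> = (\<integral>\<^sup>+x. (\<integral>\<^sup>+t. indicator ?N (x + t *\<^sub>R v) * indicator {0..1::real} t \<partial>lborel) \<partial>lborel)"
    by (rule lborel_pair.Fubini') measurable
  also have "\<dots> = 0"
    by (simp only: line) simp
  finally show ?thesis
    using N by (simp add: negligible_iff_null_sets null_sets_completionI null_sets_def)
qed

lemma integrable_bounded_indicator_cbox:
  fixes g :: "'a::euclidean_space \<Rightarrow> real"
  assumes "g \<in> borel_measurable borel" "\<And>x. \<bar>g x\<bar> \<le> B" "A \<in> sets borel" "A \<subseteq> cbox a b"
  shows "integrable lborel (\<lambda>x. indicator A x * g x)"
proof (rule Bochner_Integration.integrable_bound)
  show "integrable lborel (\<lambda>x. B * indicator (cbox a b) x :: real)"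
    by (intro integrable_mult_right integrable_real_indicator) (auto simp: emeasure_lborel_cbox_eq)
  have "B \<ge> 0" using assms(2)[of 0] by linarith
  then show "AE x in lborel. norm (indicator A x * g x) \<le> norm (B * indicator (cbox a b) x)"
    using assms by (intro AE_I2) (auto simp: indicator_def)
qed (use assms in measurable)

text \<open>Both sides have the same integral over every box, by translation invariance.\<close>

lemma ae_lim_diff_quotient_add:
  fixes f :: "'a::euclidean_space \<Rightarrow> real"
  assumes lip: "L-lipschitz_on UNIV f"
  shows "\<exists>N. negligible N \<and> (\<forall>x. x \<notin> N \<longrightarrow>
     lim (\<lambda>k. diff_quotient f (v + w) k x) = lim (\<lambda>k. diff_quotient f v k x) + lim (\<lambda>k. diff_quotient f w k x))"
proof -
  note [measurable] = borel_measurable_diff_quotient[OF lip]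
  \<comment> \<open>The value 0 off the convergence set keeps \<open>g v\<close> Borel and bounded
    by \<open>L * norm v\<close> everywhere.\<close>
  define g where "g v x = (if convergent (\<lambda>k. diff_quotient f v k x) then lim (\<lambda>k. diff_quotient f v k x) else 0)" for v x
  have L0: "L \<ge> 0" using lip lipschitz_on_nonneg by blast
  have gmeas[measurable]: "g v \<in> borel_measurable borel" for v
    unfolding g_def[abs_def] Cauchy_convergent_iff[symmetric] by measurable
  have conv: "AE x in lborel. (\<lambda>k. diff_quotient f v k x) \<longlonglongrightarrow> g v x" for v
  proof -
    have "AE x in lebesgue. x \<notin> {x. \<not> convergent (\<lambda>k. diff_quotient f v k x)}"
      using negligible_not_convergent_diff_quotient[OF lip, of v]
      by (intro AE_not_in) (simp add: negligible_iff_null_sets)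
    then have "AE x in lborel. x \<notin> {x. \<not> convergent (\<lambda>k. diff_quotient f v k x)}"
      by (simp add: AE_completion_iff)
    then show ?thesis
      by eventually_elim (auto simp: g_def convergent_LIMSEQ_iff)
  qed
  have gbound: "\<bar>g v x\<bar> \<le> L * norm v" for v x
  proof (cases "convergent (\<lambda>k. diff_quotient f v k x)")
    case True
    then have "(\<lambda>k. diff_quotient f v k x) \<longlonglongrightarrow> g v x"
      by (simp add: g_def convergent_LIMSEQ_iff)
    then have "(\<lambda>k. \<bar>diff_quotient f v k x\<bar>) \<longlonglongrightarrow> \<bar>g v x\<bar>"
      by (rule tendsto_rabs)
    then show ?thesis
      by (rule LIMSEQ_le_const2) (use abs_diff_quotient_le[OF lip] in auto)
  qed (use L0 in \<open>simp add: g_def\<close>)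
  define H where "H x = g (v + w) x - g v x - g w x" for x
  have [measurable]: "H \<in> borel_measurable borel"
    unfolding H_def by measurable
  have Hbound: "\<bar>H x\<bar> \<le> L * norm (v + w) + L * norm v + L * norm w" for x
    using gbound[of "v+w" x] gbound[of v x] gbound[of w x] unfolding H_def by linarith
  have Hint0: "(LINT x|lborel. indicator (cbox a b) x * H x) = 0" for a b
  proof -
    define Q where "Q = cbox a b"
    have [measurable]: "Q \<in> sets borel" by (simp add: Q_def)
    have intq: "integrable lborel (\<lambda>x. indicator Q x * diff_quotient f z k x)" for z k
      using abs_diff_quotient_le[OF lip]
      by (intro integrable_bounded_indicator_cbox[of _ "L * norm z" _ a b]) (auto simp: Q_def)
    have intg: "integrable lborel (\<lambda>x. indicator Q x * g z x)" for z
      using gbound by (intro integrable_bounded_indicator_cbox[of _ "L * norm z" _ a b]) (auto simp: Q_def)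
    have intQ0: "integrable lborel (\<lambda>x. C * indicator (cbox a' b') x :: real)" for C a' b'
      by (intro integrable_mult_right integrable_real_indicator) (auto simp: emeasure_lborel_cbox_eq)
    let ?I = "\<lambda>\<phi>. LINT x|lborel. indicator Q x * \<phi> x"
    have lim1: "(\<lambda>k. ?I (diff_quotient f z k)) \<longlonglongrightarrow> ?I (g z)" for z
    proof (rule integral_dominated_convergence[where w = "\<lambda>x. L * norm z * indicator (cbox a b) x"])
      show "AE x in lborel. (\<lambda>k. indicator Q x * diff_quotient f z k x) \<longlonglongrightarrow> indicator Q x * g z x"
        using conv[of z] by eventually_elim (intro tendsto_intros)
      show "AE x in lborel. norm (indicator Q x * diff_quotient f z k x) \<le> L * norm z * indicator (cbox a b) x" for k
        using abs_diff_quotient_le[OF lip] L0 by (intro AE_I2) (auto simp: Q_def indicator_def)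
    qed (simp_all only: intQ0, measurable)
    define h where "h k = v /\<^sub>R real (Suc k)" for k
    \<comment> \<open>The base point moves with \<open>k\<close>, so pointwise convergence does not
      apply directly. Translating the integral moves the shift to the indicator of the box, which
      converges off the frontier, a null set.\<close>
    have lim2: "(\<lambda>k. ?I (\<lambda>x. diff_quotient f w k (x + h k))) \<longlonglongrightarrow> ?I (g w)"
    proof -
      have shift: "?I (\<lambda>x. diff_quotient f w k (x + h k))
          = (LINT x|lborel. indicator Q (x - h k) * diff_quotient f w k x)" for k
      proof -
        have "(LINT x|lborel. indicator Q (x - h k) * diff_quotient f w k x)
          = (LINT x|distr lborel borel ((+) (h k)). indicator Q (x - h k) * diff_quotient f w k x)"
          by (simp add: lborel_distr_plus)
        also have "\<dots> = (LINT x|lborel. indicator Q (h k + x - h k) * diff_quotient f w k (h k + x))"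
          by (subst integral_distr) auto
        finally show ?thesis by (simp add: add.commute)
      qed
      define c where "c = norm v"
      have "(\<lambda>k. LINT x|lborel. indicator Q (x - h k) * diff_quotient f w k x) \<longlonglongrightarrow> ?I (g w)"
      proof (rule integral_dominated_convergence[where w = "\<lambda>x. L * norm w * indicator (cbox (a - c *\<^sub>R One) (b + c *\<^sub>R One)) x"])
        have "negligible (frontier Q)"
          unfolding Q_def by (intro negligible_convex_frontier convex_box)
        then have "frontier Q \<in> null_sets lborel"
          by (simp add: negligible_iff_null_sets null_sets_completion_iff)
        then have "AE x in lborel. x \<notin> frontier Q"
          by (rule AE_not_in)
        then show "AE x in lborel. (\<lambda>k. indicator Q (x - h k) * diff_quotient f w k x) \<longlonglongrightarrow> indicator Q x * g w x"
          using conv[of w]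
        proof eventually_elim
          case (elim x)
          have lx: "(\<lambda>k. x - h k) \<longlonglongrightarrow> x"
          proof -
            have "(\<lambda>k. x - inverse (real (Suc k)) *\<^sub>R v) \<longlonglongrightarrow> x - 0 *\<^sub>R v"
              by (intro tendsto_intros LIMSEQ_inverse_real_of_nat)
            then show ?thesis by (simp add: h_def)
          qed
          have "isCont (indicator Q :: 'a \<Rightarrow> real) x"
            using elim(1) by (simp add: isCont_indicator)
          then have "(\<lambda>k. indicator Q (x - h k) :: real) \<longlonglongrightarrow> indicator Q x"
            using lx by (rule isCont_tendsto_compose)
          then show ?case
            using elim(2) by (intro tendsto_intros)
        qed
        show "AE x in lborel. norm (indicator Q (x - h k) * diff_quotient f w k x)
            \<le> L * norm w * indicator (cbox (a - c *\<^sub>R One) (b + c *\<^sub>R One)) x" for k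
        proof (intro AE_I2)
          fix x
          have "x \<in> cbox (a - c *\<^sub>R One) (b + c *\<^sub>R One)" if "x - h k \<in> Q"
          proof -
            have "\<bar>h k \<bullet> i\<bar> \<le> c" if "i \<in> Basis" for i
            proof -
              have "\<bar>h k \<bullet> i\<bar> \<le> norm (h k)"
                by (rule Basis_le_norm[OF that])
              also have "\<dots> = norm v / real (Suc k)" by (simp add: h_def divide_inverse mult.commute)
              also have "\<dots> \<le> norm v / 1" by (intro divide_left_mono) auto
              finally show ?thesis by (simp add: c_def)
            qed
            then show ?thesis
              using that by (fastforce simp: Q_def mem_box inner_diff_left inner_add_left abs_le_iff)
          qed
          then show "norm (indicator Q (x - h k) * diff_quotient f w k x)
            \<le> L * norm w * indicator (cbox (a - c *\<^sub>R One) (b + c *\<^sub>R One)) x"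
            using abs_diff_quotient_le[OF lip] L0 by (auto simp: indicator_def)
        qed
      qed (simp_all only: intQ0, measurable)
      then show ?thesis by (simp only: shift)
    qed
    \<comment> \<open>The step \<open>v + w\<close> is taken as \<open>v\<close> first and then
      \<open>w\<close> from the displaced base point, which is where the shifted quotients of
      \<open>lim2\<close> come from.\<close>
    have split: "diff_quotient f (v + w) k x = diff_quotient f w k (x + h k) + diff_quotient f v k x" for k x
      by (simp add: diff_quotient_def h_def algebra_simps)
    have intq2: "integrable lborel (\<lambda>x. indicator Q x * diff_quotient f w k (x + h k))" for k
      using abs_diff_quotient_le[OF lip]
      by (intro integrable_bounded_indicator_cbox[of _ "L * norm w" _ a b]) (auto simp: Q_def)
    have "?I (diff_quotient f (v + w) k)
       = ?I (\<lambda>x. diff_quotient f w k (x + h k)) + ?I (diff_quotient f v k)" for k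
      using Bochner_Integration.integral_add[OF intq2[of k] intq[of v k]]
      by (simp add: split distrib_left)
    then have "(\<lambda>k. ?I (diff_quotient f (v + w) k))
       \<longlonglongrightarrow> ?I (g w) + ?I (g v)"
      using tendsto_add[OF lim2 lim1[of v]] by simp
    then have eq: "?I (g (v + w)) = ?I (g w) + ?I (g v)"
      using lim1[of "v + w"] LIMSEQ_unique by blast
    have "?I H = (LINT x|lborel. indicator Q x * g (v + w) x - indicator Q x * g v x - indicator Q x * g w x)"
      by (intro Bochner_Integration.integral_cong) (auto simp: H_def algebra_simps)
    also have "\<dots> = 0"
      using eq intg by simp
    finally show ?thesis by (simp add: Q_def)
  qed
  have Hhas: "(H has_integral 0) (cbox a b)" for a b
  proof -
    have "integrable lborel (\<lambda>x. indicator (cbox a b) x * H x)"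
      by (rule integrable_bounded_indicator_cbox[OF _ Hbound]) auto
    from has_integral_integral_lborel[OF this] Hint0[of a b]
    have "((\<lambda>x. indicator (cbox a b) x * H x) has_integral 0) UNIV" by simp
    moreover have "(\<lambda>x. indicator (cbox a b) x * H x) = (\<lambda>x. if x \<in> cbox a b then H x else 0)"
      by (auto simp: indicator_def)
    ultimately show ?thesis
      by (simp only: has_integral_restrict_UNIV)
  qed
  then have "H integrable_on cbox a b" for a b by blast
  from integrable_ccontinuous_explicit[OF this] obtain N where N: "negligible N"
    and Nd: "\<And>x e. \<lbrakk>x \<notin> N; 0 < e\<rbrakk> \<Longrightarrow> \<exists>d>0. \<forall>k. 0 < k \<and> k < d \<longrightarrow>
        norm (integral (cbox x (x + k *\<^sub>R One)) H /\<^sub>R k ^ DIM('a) - H x) < e"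
    by blast
  have H0: "H x = 0" if x: "x \<notin> N" for x
  proof (rule ccontr)
    assume "H x \<noteq> 0"
    then obtain d where "d > 0" and d: "\<And>k. 0 < k \<Longrightarrow> k < d \<Longrightarrow> norm (integral (cbox x (x + k *\<^sub>R One)) H /\<^sub>R k ^ DIM('a) - H x) < \<bar>H x\<bar>"
      using Nd[OF x, of "\<bar>H x\<bar>"] by auto
    have "integral (cbox x (x + (d/2) *\<^sub>R One)) H = 0"
      using Hhas by (rule integral_unique)
    then show False using d[of "d/2"] \<open>d > 0\<close> by simp
  qed
  define N' where "N' = N \<union> {x. \<not> convergent (\<lambda>k. diff_quotient f v k x)} \<union> {x. \<not> convergent (\<lambda>k. diff_quotient f w k x)}
     \<union> {x. \<not> convergent (\<lambda>k. diff_quotient f (v + w) k x)}"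
  have "negligible N'"
    unfolding N'_def by (intro negligible_Un N negligible_not_convergent_diff_quotient[OF lip])
  moreover have "lim (\<lambda>k. diff_quotient f (v + w) k x) = lim (\<lambda>k. diff_quotient f v k x) + lim (\<lambda>k. diff_quotient f w k x)"
    if "x \<notin> N'" for x
    using H0[of x] that by (auto simp: N'_def H_def g_def)
  ultimately show ?thesis by blast
qed

text \<open>A step \<open>h\<close> is compared with \<open>s = 1 / Suc k\<close>, where
  \<open>Suc k\<close> is the integer part of \<open>1 / h\<close>. Then
  \<open>s - h \<le> s * h\<close>, so the Lipschitz error is of second order in the step
  size.\<close>

lemma tendsto_directional_diff_quotient:
  fixes f :: "'a::euclidean_space \<Rightarrow> real"
  assumes lip: "L-lipschitz_on UNIV f" and d: "(\<lambda>k. diff_quotient f v k x) \<longlonglongrightarrow> d" and e: "e > 0"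
  shows "\<exists>\<delta>>0. \<forall>h. 0 < h \<and> h < \<delta> \<longrightarrow> \<bar>f (x + h *\<^sub>R v) - f x - h * d\<bar> \<le> e * h"
proof -
  have L0: "L \<ge> 0" using lip lipschitz_on_nonneg by blast
  obtain k0 where k0: "\<And>k. k \<ge> k0 \<Longrightarrow> \<bar>diff_quotient f v k x - d\<bar> < e / 2"
    using d e unfolding LIMSEQ_def dist_real_def by (meson half_gt_zero)
  obtain k1 where k1: "real k1 > 4 * (L * norm v) / e"
    using reals_Archimedean2 by blast
  define m where "m = max k0 k1 + 1"
  have m: "m \<ge> k0" "m \<ge> k1" "m > 0" by (auto simp: m_def)
  show ?thesis
  proof (intro exI[of _ "1 / real (Suc m)"] conjI allI impI)
    fix h :: real assume h: "0 < h \<and> h < 1 / real (Suc m)"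
    define n where "n = nat \<lfloor>1 / h\<rfloor>"
    have nh: "real n \<le> 1 / h" "1 / h < real n + 1"
      using h by (auto simp: n_def le_floor_iff)
    have "real (Suc m) < 1 / h" using h by (simp add: field_simps)
    then have "n \<ge> Suc m" using nh by linarith
    then obtain k where k: "n = Suc k" "k \<ge> m" by (cases n) auto
    define s where "s = 1 / real (Suc k)"
    have s0: "s > 0" by (simp add: s_def)
    have hs: "h \<le> s" using nh h k by (simp add: s_def field_simps)
    have "1 \<le> h * (real (Suc k) + 1)"
      using nh h k by (simp add: field_simps)
    then have "s * 1 \<le> s * (h * (real (Suc k) + 1))"
      using s0 by (intro mult_left_mono) auto
    also have "\<dots> = h + s * h"
      by (simp add: s_def field_simps)
    finally have sh: "s - h \<le> s * h" by simp
    have "\<bar>f (x + h *\<^sub>R v) - f (x + s *\<^sub>R v)\<bar> \<le> L * ((s - h) * norm v)"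
      using lipschitz_onD[OF lip, of "x + h *\<^sub>R v" "x + s *\<^sub>R v"] hs
      by (simp add: dist_norm flip: scaleR_diff_left)
    moreover have "f (x + s *\<^sub>R v) - f x = s * diff_quotient f v k x"
      by (simp add: diff_quotient_def s_def divide_inverse)
    moreover have "\<bar>s * diff_quotient f v k x - h * d\<bar> \<le> (s - h) * (L * norm v) + h * (e / 2)"
    proof -
      have "s * diff_quotient f v k x - h * d = (s - h) * diff_quotient f v k x + h * (diff_quotient f v k x - d)"
        by (simp add: algebra_simps)
      also have "\<bar>\<dots>\<bar> \<le> \<bar>(s - h) * diff_quotient f v k x\<bar> + \<bar>h * (diff_quotient f v k x - d)\<bar>"
        by (rule abs_triangle_ineq)
      also have "\<dots> \<le> (s - h) * (L * norm v) + h * (e / 2)"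
        using abs_diff_quotient_le[OF lip, of v k x] k0[of k] k m hs h
        by (intro add_mono) (auto simp: abs_mult intro!: mult_left_mono)
      finally show ?thesis .
    qed
    ultimately have "\<bar>f (x + h *\<^sub>R v) - f x - h * d\<bar> \<le> 2 * ((s - h) * (L * norm v)) + h * (e / 2)"
      by (simp add: algebra_simps)
    also have "\<dots> \<le> 2 * ((s * h) * (L * norm v)) + h * (e / 2)"
      using sh L0 h by (intro add_mono mult_left_mono mult_right_mono) auto
    also have "\<dots> = h * (2 * s * (L * norm v) + e / 2)"
      by (simp add: algebra_simps)
    also have "\<dots> \<le> h * (e / 2 + e / 2)"
    proof -
      have "4 * (L * norm v) < e * real k1"
        using k1 e by (simp add: field_simps)
      also have "\<dots> \<le> e * real (Suc k)"
        using k m e by (intro mult_left_mono) auto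
      finally have "2 * s * (L * norm v) \<le> e / 2"
        by (simp add: s_def field_simps)
      then show ?thesis using h by (intro mult_left_mono) auto
    qed
    finally show "\<bar>f (x + h *\<^sub>R v) - f x - h * d\<bar> \<le> e * h" by (simp add: mult.commute)
  qed simp
qed

text \<open>Off one null set the directional derivatives exist and are additive for a countable
  dense set of directions. Uniform Lipschitz dependence on the direction extends this to every
  direction, and compactness of the unit sphere makes the linear expansion uniform.\<close>

lemma rademacher_real:
  fixes f :: "'a::euclidean_space \<Rightarrow> real"
  assumes lip: "L-lipschitz_on UNIV f"
  shows "negligible {x. \<not> f differentiable (at x)}"
proof -
  have L0: "L \<ge> 0" using lip lipschitz_on_nonneg by blast
  obtain V :: "'a set" where V: "countable V" and dense: "\<And>X. open X \<Longrightarrow> X \<noteq> {} \<Longrightarrow> \<exists>d\<in>V. d \<in> X"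
    using countable_dense_setE by blast
  have "\<forall>v w. \<exists>N. negligible N \<and> (\<forall>x. x \<notin> N \<longrightarrow>
     lim (\<lambda>k. diff_quotient f (v + w) k x) = lim (\<lambda>k. diff_quotient f v k x) + lim (\<lambda>k. diff_quotient f w k x))"
    using ae_lim_diff_quotient_add[OF lip] by blast
  then obtain NA where NA: "\<And>v w. negligible (NA v w)"
    and add: "\<And>v w x. x \<notin> NA v w \<Longrightarrow>
     lim (\<lambda>k. diff_quotient f (v + w) k x) = lim (\<lambda>k. diff_quotient f v k x) + lim (\<lambda>k. diff_quotient f w k x)"
    by metis
  define N where "N = (\<Union>v\<in>V. {x. \<not> convergent (\<lambda>k. diff_quotient f v k x)}) \<union> (\<Union>(v, w)\<in>V \<times> V. NA v w)"
  have "negligible N"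
    unfolding N_def using V NA negligible_not_convergent_diff_quotient[OF lip]
    by (intro negligible_Un negligible_countable_Union countable_image countable_SIGMA) auto
  moreover
  have "f differentiable (at x)" if x: "x \<notin> N" for x
  proof -
    define D where "D v k = diff_quotient f v k x" for v k
    have Dlip: "\<bar>D v k - D w k\<bar> \<le> L * norm (v - w)" for v w k
      unfolding D_def by (rule diff_quotient_diff_le[OF lip])
    have near: "\<exists>w\<in>V. norm (v - w) < e" if "e > 0" for v e
      using dense[of "ball v e"] that by (auto simp: dist_norm)
    have conv: "convergent (D v)" for v
      unfolding Cauchy_convergent_iff[symmetric]
    proof (rule metric_CauchyI)
      fix e :: real assume e: "e > 0"
      obtain w where w: "w \<in> V" "norm (v - w) < e / (4 * (L + 1))"
        using near[of "e / (4 * (L + 1))" v] e L0 by auto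
      have "L * norm (v - w) \<le> (L + 1) * (e / (4 * (L + 1)))"
        using w L0 by (intro mult_mono) auto
      also have "\<dots> = e / 4" using L0 by (simp add: divide_simps)
      finally have Lw: "L * norm (v - w) \<le> e / 4" .
      have "Cauchy (D w)"
        using x w by (auto simp: N_def D_def[abs_def] Cauchy_convergent_iff)
      then obtain M where M: "\<And>m n. m \<ge> M \<Longrightarrow> n \<ge> M \<Longrightarrow> dist (D w m) (D w n) < e / 4"
        using e by (meson metric_CauchyD zero_less_divide_iff zero_less_numeral)
      show "\<exists>M. \<forall>m\<ge>M. \<forall>n\<ge>M. dist (D v m) (D v n) < e"
      proof (intro exI allI impI)
        fix m n assume "m \<ge> M" "n \<ge> M"
        then show "dist (D v m) (D v n) < e"
          using M[of m n] Dlip[of v m w] Dlip[of v n w] Lw e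
          unfolding dist_real_def by linarith
      qed
    qed
    define d where "d v = lim (D v)" for v
    have dlim: "D v \<longlonglongrightarrow> d v" for v
      using conv by (simp add: d_def convergent_LIMSEQ_iff)
    have dlip: "\<bar>d v - d w\<bar> \<le> L * norm (v - w)" for v w
      by (rule LIMSEQ_le_const2[OF tendsto_rabs[OF tendsto_diff[OF dlim[of v] dlim[of w]]]]) (use Dlip in auto)
    have d0: "d 0 = 0" by (simp add: d_def D_def[abs_def])
    have addV: "d (v + w) = d v + d w" if "v \<in> V" "w \<in> V" for v w
      using x that add[of x v w] by (auto simp: N_def d_def D_def[abs_def])
    have dadd: "d (v + w) = d v + d w" for v w
    proof -
      have "\<bar>d (v + w) - d v - d w\<bar> \<le> e" if e: "e > 0" for e
      proof -
        define \<eta> where "\<eta> = e / (4 * (L + 1))"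
        have \<eta>: "\<eta> > 0" using e L0 by (simp add: \<eta>_def)
        obtain v' where v': "v' \<in> V" "norm (v - v') < \<eta>" using near[OF \<eta>] by blast
        obtain w' where w': "w' \<in> V" "norm (w - w') < \<eta>" using near[OF \<eta>] by blast
        have "norm (v + w - (v' + w')) \<le> norm (v - v') + norm (w - w')"
          by (metis add_diff_add norm_triangle_ineq)
        then have "\<bar>d (v + w) - d (v' + w')\<bar> \<le> L * (2 * \<eta>)"
          using dlip[of "v + w" "v' + w'"] v' w' L0 mult_left_mono[of "norm (v + w - (v' + w'))" "2 * \<eta>" L] by linarith
        moreover have "\<bar>d v - d v'\<bar> \<le> L * \<eta>" "\<bar>d w - d w'\<bar> \<le> L * \<eta>"
          using dlip[of v v'] dlip[of w w'] v' w' L0 mult_left_mono[of "norm (v - v')" \<eta> L]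
           mult_left_mono[of "norm (w - w')" \<eta> L] by linarith+
        ultimately have "\<bar>d (v + w) - d v - d w\<bar> \<le> 4 * (L * \<eta>)"
          using addV[OF v'(1) w'(1)] by linarith
        also have "\<dots> \<le> e" using e L0 by (simp add: \<eta>_def field_simps)
        finally show ?thesis .
      qed
      then have "\<bar>d (v + w) - d v - d w\<bar> \<le> 0"
        by (rule field_le_epsilon) simp
      then show ?thesis by linarith
    qed
    have dexp: "\<exists>\<delta>>0. \<forall>h. 0 < h \<and> h < \<delta> \<longrightarrow> \<bar>f (x + h *\<^sub>R v) - f x - h * d v\<bar> \<le> e * h" if "e > 0" for e v
    proof -
      have "(\<lambda>k. diff_quotient f v k x) \<longlonglongrightarrow> d v"
        using dlim[of v] by (simp add: D_def[abs_def])
      from tendsto_directional_diff_quotient[OF lip this that] show ?thesis .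
    qed
    \<comment> \<open>Homogeneity compares two parametrisations of the same ray; here steps of
      arbitrary length are needed, not only \<open>1 / Suc k\<close>.\<close>
    have dpos: "d (c *\<^sub>R v) = c * d v" if c: "c > 0" for c v
    proof -
      have "\<bar>d (c *\<^sub>R v) - c * d v\<bar> \<le> (1 + c) * e" if e: "e > 0" for e
      proof -
        obtain \<delta>1 where 1: "\<delta>1 > 0" "\<And>h. 0 < h \<Longrightarrow> h < \<delta>1 \<Longrightarrow> \<bar>f (x + h *\<^sub>R (c *\<^sub>R v)) - f x - h * d (c *\<^sub>R v)\<bar> \<le> e * h"
          using dexp[OF e] by blast
        obtain \<delta>2 where 2: "\<delta>2 > 0" "\<And>h. 0 < h \<Longrightarrow> h < \<delta>2 \<Longrightarrow> \<bar>f (x + h *\<^sub>R v) - f x - h * d v\<bar> \<le> e * h"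
          using dexp[OF e] by blast
        define h where "h = min (\<delta>1 / 2) (\<delta>2 / (2 * c))"
        have h: "0 < h" "h < \<delta>1" "h * c < \<delta>2"
          using 1 2 c by (auto simp: h_def min_def field_simps)
        have "\<bar>h * d (c *\<^sub>R v) - (h * c) * d v\<bar> \<le> e * h + e * (h * c)"
          using 1(2)[OF h(1,2)] 2(2)[of "h * c"] h c by simp
        moreover have "h * d (c *\<^sub>R v) - (h * c) * d v = h * (d (c *\<^sub>R v) - c * d v)"
          by (simp add: algebra_simps)
        moreover have "\<bar>h * (d (c *\<^sub>R v) - c * d v)\<bar> = h * \<bar>d (c *\<^sub>R v) - c * d v\<bar>"
          using h by (simp add: abs_mult)
        ultimately have "h * \<bar>d (c *\<^sub>R v) - c * d v\<bar> \<le> h * ((1 + c) * e)"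
          by (simp add: algebra_simps)
        then show ?thesis using h by simp
      qed
      note * = this
      have "\<bar>d (c *\<^sub>R v) - c * d v\<bar> \<le> e" if "e > 0" for e
        using *[of "e / (1 + c)"] that c by simp
      then have "\<bar>d (c *\<^sub>R v) - c * d v\<bar> \<le> 0"
        by (rule field_le_epsilon) simp
      then show ?thesis by linarith
    qed
    have dneg: "d (- v) = - d v" for v
      using dadd[of v "- v"] d0 by simp
    have dscale: "d (c *\<^sub>R v) = c * d v" for c v
    proof -
      consider "c > 0" | "c = 0" | "c < 0" by linarith
      then show ?thesis
      proof cases
        case 3
        then show ?thesis using dpos[of "- c" v] dneg[of "c *\<^sub>R v"] by simp
      qed (use dpos d0 in auto)
    qed
    have "linear d"
      using dadd dscale by (intro linearI) auto
    then have bl: "bounded_linear d"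
      by (simp add: linear_conv_bounded_linear)
    have "(f has_derivative d) (at x)"
      unfolding has_derivative_at_alt
    proof (intro conjI bl allI impI)
      fix e :: real assume e: "e > 0"
      define \<eta> where "\<eta> = e / (3 * (L + 1))"
      have \<eta>: "\<eta> > 0" using e L0 by (simp add: \<eta>_def)
      have L\<eta>: "L * \<eta> \<le> e / 3" using e L0 by (simp add: \<eta>_def field_simps)
      \<comment> \<open>A finite net of directions gives one radius \<open>r\<close>. The error
        splits into three thirds of \<open>e\<close>: replacing the direction in \<open>f\<close>,
        the expansion along the net direction, and replacing the direction in
        \<open>d\<close>.\<close>
      obtain F where F: "finite F" "sphere (0::'a) 1 \<subseteq> (\<Union>u\<in>F. ball u \<eta>)"
        using compact_sphere[of "0::'a" 1] \<eta> unfolding compact_eq_totally_bounded by metis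
      have "\<forall>u. \<exists>\<delta>>0. \<forall>h. 0 < h \<and> h < \<delta> \<longrightarrow> \<bar>f (x + h *\<^sub>R u) - f x - h * d u\<bar> \<le> e / 3 * h"
        using dexp[of "e/3"] e by auto
      then obtain \<delta> where \<delta>: "\<And>u. \<delta> u > 0" "\<And>u h. 0 < h \<Longrightarrow> h < \<delta> u \<Longrightarrow> \<bar>f (x + h *\<^sub>R u) - f x - h * d u\<bar> \<le> e / 3 * h"
        by metis
      define r where "r = Min (insert 1 (\<delta> ` F))"
      have r: "r > 0" "\<And>u. u \<in> F \<Longrightarrow> r \<le> \<delta> u"
        using F(1) \<delta>(1) by (auto simp: r_def)
      show "\<exists>r>0. \<forall>y. norm (y - x) < r \<longrightarrow> norm (f y - f x - d (y - x)) \<le> e * norm (y - x)"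
      proof (intro exI[of _ r] conjI allI impI r(1))
        fix y assume y: "norm (y - x) < r"
        show "norm (f y - f x - d (y - x)) \<le> e * norm (y - x)"
        proof (cases "y = x")
          case True then show ?thesis using d0 by simp
        next
          case False
          define h where "h = norm (y - x)"
          define u' where "u' = (y - x) /\<^sub>R h"
          have h: "h > 0" "h < r" using False y by (auto simp: h_def)
          have yx: "y - x = h *\<^sub>R u'" using h by (simp add: u'_def)
          have "norm u' = 1" using h by (simp add: u'_def) (simp add: h_def)
          then obtain u where u: "u \<in> F" "norm (u - u') < \<eta>"
            using F(2) by (fastforce simp: dist_norm)
          have "\<bar>f (x + h *\<^sub>R u') - f (x + h *\<^sub>R u)\<bar> \<le> L * (h * norm (u - u'))"
            using lipschitz_onD[OF lip, of "x + h *\<^sub>R u'" "x + h *\<^sub>R u"] h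
            by (simp add: dist_norm norm_minus_commute flip: scaleR_diff_right)
          also have "\<dots> \<le> L * (h * \<eta>)"
            using u h L0 by (intro mult_left_mono) auto
          also have "\<dots> \<le> e / 3 * h"
            using L\<eta> h by (simp add: mult.left_commute mult.commute)
          finally have a: "\<bar>f (x + h *\<^sub>R u') - f (x + h *\<^sub>R u)\<bar> \<le> e / 3 * h" .
          have b: "\<bar>f (x + h *\<^sub>R u) - f x - h * d u\<bar> \<le> e / 3 * h"
            using \<delta>(2)[of h u] r(2)[OF u(1)] h by simp
          have "\<bar>d u - d u'\<bar> \<le> e / 3"
            using dlip[of u u'] u L\<eta> mult_left_mono[of "norm (u - u')" \<eta> L] L0 by linarith
          then have c: "\<bar>h * d u - h * d u'\<bar> \<le> e / 3 * h"
            using h by (simp add: abs_mult mult.commute flip: right_diff_distrib)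
          have "f y - f x - d (y - x) = f (x + h *\<^sub>R u') - f x - h * d u'"
            using yx by (simp add: dscale) (metis add.commute diff_add_cancel)
          then show ?thesis
            using a b c unfolding h_def[symmetric] real_norm_def by linarith
        qed
      qed
    qed
    then show ?thesis
      by (auto simp: differentiable_def)
  qed
  then have "{x. \<not> f differentiable (at x)} \<subseteq> N" by auto
  ultimately show ?thesis
    by (rule negligible_subset)
qed

text \<open>McShane's formula: an infimum of the cones \<open>f y + L * dist x y\<close> is
  \<open>L\<close>-Lipschitz, and it equals \<open>f\<close> on \<open>S\<close> because
  \<open>f\<close> itself obeys the cone bound there.\<close>

lemma lipschitz_real_extension:
  fixes f :: "'a::metric_space \<Rightarrow> real"
  assumes lip: "L-lipschitz_on S f"
  obtains g where "L-lipschitz_on UNIV g" "\<And>x. x \<in> S \<Longrightarrow> g x = f x"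
proof (cases "S = {}")
  case True
  have "L-lipschitz_on UNIV (\<lambda>x::'a. 0::real)"
    using lipschitz_on_nonneg[OF lip] by (intro lipschitz_onI) auto
  then show ?thesis using that True by blast
next
  case False
  have L0: "L \<ge> 0" using lip lipschitz_on_nonneg by blast
  define g where "g x = (INF y\<in>S. f y + L * dist x y)" for x
  obtain s where s: "s \<in> S" using False by blast
  have fl: "f y \<le> f z + L * dist y z" if "y \<in> S" "z \<in> S" for y z
    using lipschitz_onD[OF lip that] by (auto simp: dist_real_def)
  have low: "f s - L * dist x s \<le> f y + L * dist x y" if "y \<in> S" for x y
  proof -
    have "L * dist s y \<le> L * (dist x s + dist x y)"
      using L0 by (intro mult_left_mono) (metis dist_commute dist_triangle2)
    then show ?thesis using fl[OF s that] by (simp add: algebra_simps)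
  qed
  have bdd: "bdd_below ((\<lambda>y. f y + L * dist x y) ` S)" for x
    using low by (intro bdd_belowI2)
  have gle: "g x \<le> f y + L * dist x y" if "y \<in> S" for x y
    unfolding g_def by (rule cINF_lower[OF bdd that])
  have one: "g x \<le> g z + L * dist x z" for x z
  proof -
    have "g x - L * dist x z \<le> f y + L * dist z y" if "y \<in> S" for y
    proof -
      have "L * dist x y \<le> L * (dist x z + dist z y)"
        using L0 by (intro mult_left_mono dist_triangle)
      then show ?thesis using gle[OF that, of x] by (simp add: algebra_simps)
    qed
    then have "g x - L * dist x z \<le> g z"
      unfolding g_def[of z] using False by (intro cINF_greatest)
    then show ?thesis by simp
  qed
  show ?thesis
  proof
    show "L-lipschitz_on UNIV g"
    proof (rule lipschitz_onI)
      fix x z show "dist (g x) (g z) \<le> L * dist x z"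
        using one[of x z] one[of z x] by (simp add: dist_real_def dist_commute abs_le_iff)
    qed (rule L0)
    show "g x = f x" if "x \<in> S" for x
    proof (rule antisym)
      show "g x \<le> f x" using gle[OF that, of x] by simp
      show "f x \<le> g x"
        unfolding g_def using False fl[OF that] by (intro cINF_greatest)
    qed
  qed
qed

text \<open>Each component is extended to the whole space, where the scalar theorem applies, and
  restricted again. The relative form is the one that fits a slope map living on a contact
  set.\<close>

theorem rademacher_within:
  fixes f :: "'a::euclidean_space \<Rightarrow> 'b::euclidean_space"
  assumes lip: "L-lipschitz_on S f"
  shows "negligible {x \<in> S. \<not> f differentiable (at x within S)}"
proof -
  have comp: "L-lipschitz_on S (\<lambda>x. f x \<bullet> i)" if "i \<in> Basis" for i
  proof (rule lipschitz_onI)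
    fix x y assume "x \<in> S" "y \<in> S"
    then have "norm (f x - f y) \<le> L * dist x y"
      using lipschitz_onD[OF lip] by (simp add: dist_norm)
    then show "dist (f x \<bullet> i) (f y \<bullet> i) \<le> L * dist x y"
      using Basis_le_norm[OF that, of "f x - f y"] by (simp add: dist_real_def inner_diff_left)
  qed (rule lipschitz_on_nonneg[OF lip])
  have "\<exists>g. L-lipschitz_on UNIV g \<and> (\<forall>x\<in>S. g x = f x \<bullet> i)" if "i \<in> Basis" for i
    using lipschitz_real_extension[OF comp[OF that]] by metis
  then obtain g where g: "\<And>i. i \<in> Basis \<Longrightarrow> L-lipschitz_on UNIV (g i)"
    and gf: "\<And>i x. i \<in> Basis \<Longrightarrow> x \<in> S \<Longrightarrow> g i x = f x \<bullet> i"
    by metis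
  define N where "N = (\<Union>i\<in>(Basis::'b set). {x. \<not> g i differentiable (at x)})"
  have "negligible N"
    unfolding N_def using rademacher_real[OF g] by (intro negligible_Union) auto
  moreover have "f differentiable (at x within S)" if x: "x \<in> S" "x \<notin> N" for x
  proof -
    have "(\<lambda>y. f y \<bullet> i) differentiable (at x within S)" if i: "i \<in> Basis" for i
    proof -
      have "g i differentiable (at x within S)"
        using x i differentiable_at_withinI by (auto simp: N_def)
      then obtain D where "(g i has_derivative D) (at x within S)"
        by (auto simp: differentiable_def)
      then have "((\<lambda>y. f y \<bullet> i) has_derivative D) (at x within S)"
        by (rule has_derivative_transform_within[of _ _ _ _ 1]) (use gf i x in auto)
      then show ?thesis by (auto simp: differentiable_def)
    qed
    then show ?thesis
      by (subst differentiable_componentwise_within) blast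
  qed
  then have "{x \<in> S. \<not> f differentiable (at x within S)} \<subseteq> N" by auto
  ultimately show ?thesis
    by (rule negligible_subset)
qed

section \<open>Differentiable images for arbitrary finite index types\<close>

text \<open>The library proves the estimate only for well-ordered index types. The copy \<open>'a enumerated\<close>
  of a finite type carries an arbitrary such order.\<close>

typedef 'a enumerated = "UNIV :: 'a set"
  by simp

instance enumerated :: (finite) finite
proof
  have "(UNIV :: 'a enumerated set) = Abs_enumerated ` UNIV"
    by (auto simp: image_iff intro!: exI[of _ "Rep_enumerated _"] Rep_enumerated_inverse[symmetric])
  then show "finite (UNIV :: 'a enumerated set)"
    by (metis finite finite_imageI)
qed

definition enumeration_index :: "'a::finite enumerated \<Rightarrow> nat" where
  "enumeration_index = (SOME f. inj f)"

lemma inj_enumeration_index: "inj (enumeration_index :: 'a::finite enumerated \<Rightarrow> nat)"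
  unfolding enumeration_index_def
  using finite_imp_inj_to_nat_seg[OF finite[of "UNIV :: 'a enumerated set"]] by (metis someI_ex)

instantiation enumerated :: (finite) wellorder
begin

definition "x \<le> y \<longleftrightarrow> enumeration_index x \<le> enumeration_index y"
definition "x < y \<longleftrightarrow> enumeration_index x < enumeration_index y"

instance
proof
  fix x y z :: "'a enumerated"
  show "x \<le> y \<Longrightarrow> y \<le> x \<Longrightarrow> x = y"
    using inj_enumeration_index by (auto simp: less_eq_enumerated_def dest: injD)
  show "P x" if step: "\<And>x. (\<And>y. y < x \<Longrightarrow> P y) \<Longrightarrow> P x" for P
  proof (induction x rule: measure_induct_rule[of enumeration_index])
    case (less x)
    show ?case
      by (rule step) (rule less, simp add: less_enumerated_def)
  qed
qed (auto simp: less_eq_enumerated_def less_enumerated_def)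

end

section \<open>Relabelling coordinates: measures and determinants\<close>

definition to_enum :: "real^'n \<Rightarrow> real^('n enumerated)" where
  "to_enum x = (\<chi> i. x $ Rep_enumerated i)"

definition of_enum :: "real^('n enumerated) \<Rightarrow> real^'n" where
  "of_enum x = (\<chi> i. x $ Abs_enumerated i)"

lemma of_to_enum [simp]: "of_enum (to_enum x) = x"
  by (simp add: of_enum_def to_enum_def vec_eq_iff Abs_enumerated_inverse)

lemma to_of_enum [simp]: "to_enum (of_enum x) = x"
  by (simp add: of_enum_def to_enum_def vec_eq_iff Rep_enumerated_inverse)

lemma linear_to_enum: "linear to_enum"
  by (rule linearI) (auto simp: to_enum_def vec_eq_iff)

lemma linear_of_enum: "linear of_enum"
  by (rule linearI) (auto simp: of_enum_def vec_eq_iff)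

lemma bij_Rep_enumerated: "bij (Rep_enumerated :: 'a enumerated \<Rightarrow> 'a)"
  by (rule bijI) (auto simp: inj_def Rep_enumerated_inject surj_def intro: Abs_enumerated_inverse[symmetric])

lemma card_enumerated [simp]: "CARD('a enumerated) = CARD('a)"
  using bij_betw_same_card[OF bij_Rep_enumerated] .

lemma all_enumerated: "(\<forall>j. P j) \<longleftrightarrow> (\<forall>i. P (Abs_enumerated i))"
  by (metis Rep_enumerated_inverse)

text \<open>Relabelling only reorders the side lengths of a box, and the volumes of boxes
  characterise \<open>lborel\<close>.\<close>

lemma to_enum_image_borel:
  fixes A :: "(real^'n) set"
  assumes "A \<in> sets borel"
  shows "to_enum ` A \<in> sets borel" "emeasure lborel (to_enum ` A) = emeasure lborel A"
proof -
  have [measurable]: "(to_enum :: real^'n \<Rightarrow> _) \<in> borel_measurable borel"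
    "(of_enum :: _ \<Rightarrow> real^'n) \<in> borel_measurable borel"
    using linear_to_enum linear_of_enum
    by (auto intro!: borel_measurable_continuous_onI linear_continuous_on simp: linear_conv_bounded_linear)
  have im: "to_enum ` A = of_enum -` A \<inter> space borel"
    by (auto simp: image_iff) (metis to_of_enum)
  show "to_enum ` A \<in> sets borel"
    unfolding im using assms by measurable
  define D where "D = distr (lborel :: (real^('n enumerated)) measure) (borel :: (real^'n) measure) of_enum"
  have D_eq: "lborel = D"
  proof (rule lborel_eqI)
    fix l u :: "real^'n" assume lu: "\<And>b. b \<in> Basis \<Longrightarrow> l \<bullet> b \<le> u \<bullet> b"
    then have lu': "l $ i \<le> u $ i" for i
      using lu[of "axis i 1"] by (auto simp: cart_eq_inner_axis Basis_vec_def)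
    have prodB: "(\<Prod>b\<in>Basis. x \<bullet> b) = (\<Prod>i\<in>UNIV. x $ i)" for x :: "real^'m"
    proof -
      have "(Basis :: (real^'m) set) = (\<lambda>i. axis i 1) ` UNIV"
        by (auto simp: Basis_vec_def)
      then have "(\<Prod>b\<in>Basis. x \<bullet> b) = (\<Prod>b\<in>(\<lambda>i. axis i (1::real) :: real^'m) ` UNIV. x \<bullet> b)"
        by simp
      also have "\<dots> = (\<Prod>i\<in>UNIV. x \<bullet> axis i 1)"
        by (subst prod.reindex) (auto simp: inj_def axis_eq_axis)
      finally show ?thesis
        by (simp only: cart_eq_inner_axis)
    qed
    have "of_enum -` box l u \<inter> space (lborel :: (real^('n enumerated)) measure) = box (to_enum l) (to_enum u)"
      by (auto simp: mem_box_cart of_enum_def to_enum_def all_enumerated Abs_enumerated_inverse)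
    then have "emeasure D (box l u)
        = emeasure lborel (box (to_enum l) (to_enum u))"
      unfolding D_def by (subst emeasure_distr) auto
    also have "\<dots> = (\<Prod>b\<in>Basis. (to_enum u - to_enum l) \<bullet> b)"
      using lu' by (intro emeasure_lborel_box) (auto simp: Basis_vec_def inner_axis to_enum_def)
    also have "\<dots> = (\<Prod>i\<in>UNIV. (u - l) $ Rep_enumerated i)"
      by (simp add: prodB to_enum_def)
    also have "\<dots> = (\<Prod>i\<in>UNIV. (u - l) $ i)"
      by (rule arg_cong[where f = ennreal], rule prod.reindex_bij_betw[OF bij_Rep_enumerated])
    finally show "emeasure D (box l u) = (\<Prod>b\<in>Basis. (u - l) \<bullet> b)"
      by (simp add: prodB)
  qed (simp add: D_def)
  then have "emeasure lborel A = emeasure D A"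
    by simp
  also have "\<dots> = emeasure lborel (to_enum ` A)"
    unfolding D_def using assms by (subst emeasure_distr) (auto simp: im)
  finally show "emeasure lborel (to_enum ` A) = emeasure lborel A" by simp
qed

lemma to_enum_image_lebesgue:
  fixes S :: "(real^'n) set"
  assumes S: "S \<in> sets lebesgue"
  shows "to_enum ` S \<in> sets lebesgue" "emeasure lebesgue (to_enum ` S) = emeasure lebesgue S"
proof -
  obtain C N where C: "C \<in> sets borel" and N: "negligible N" and S_eq: "C \<union> N = S"
    using sets_lebesgue_almost_borel[OF S] by blast
  have "negligible (to_enum ` N)"
    using N linear_imp_differentiable_on[OF linear_to_enum]
    by (intro negligible_differentiable_image_negligible) auto
  moreover have "to_enum ` S = to_enum ` C \<union> to_enum ` N"
    by (auto simp flip: S_eq)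
  moreover note to_enum_image_borel[OF C]
  ultimately show "to_enum ` S \<in> sets lebesgue"
    by (auto simp: negligible_iff_null_sets)
  have "emeasure lebesgue (to_enum ` S) = emeasure lebesgue (to_enum ` C)"
    using \<open>negligible (to_enum ` N)\<close> \<open>to_enum ` S = _\<close> to_enum_image_borel[OF C]
    by (auto simp: negligible_iff_null_sets emeasure_Un_null_set)
  also have "\<dots> = emeasure lebesgue C"
    using to_enum_image_borel[OF C] C by simp
  also have "\<dots> = emeasure lebesgue S"
    using N C by (simp add: negligible_iff_null_sets emeasure_Un_null_set flip: S_eq)
  finally show "emeasure lebesgue (to_enum ` S) = emeasure lebesgue S" .
qed

text \<open>Conjugation by \<open>r\<close> maps the permutations of one index type bijectively onto
  those of the other and preserves signs, so the Leibniz sums agree.\<close>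

lemma det_reindex:
  fixes A :: "'a::comm_ring_1^'n^'n" and r :: "'m::finite \<Rightarrow> 'n::finite"
  assumes r: "bij r"
  shows "det (\<chi> i j. A $ r i $ r j) = det A"
proof -
  have injr: "inj r" and surjr: "range r = UNIV" using r by (auto simp: bij_def)
  have inv: "bij (inv r)" using r by (rule bij_imp_bij_inv)
  have "det A = (\<Sum>p\<in>{p. p permutes (UNIV::'m set)}. of_int (sign (map_permutation UNIV r p)) * (\<Prod>i\<in>UNIV. A $ i $ map_permutation UNIV r p i))"
    unfolding det_def
  proof (rule sum.reindex_bij_witness[where i = "map_permutation UNIV r" and j = "map_permutation UNIV (inv r)"])
    fix p :: "'n \<Rightarrow> 'n" assume p: "p \<in> {p. p permutes UNIV}"
    then have pp: "p permutes UNIV" by simp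
    show 1: "map_permutation UNIV r (map_permutation UNIV (inv r) p) = p"
      by (rule map_permutation_compose_inv[OF inv pp]) (simp add: surj_f_inv_f[OF surjr])
    show "map_permutation UNIV (inv r) p \<in> {p. p permutes UNIV}"
      using map_permutation_permutes[OF inv pp] by simp
    show "of_int (sign (map_permutation UNIV r (map_permutation UNIV (inv r) p))) *
         (\<Prod>i\<in>UNIV. A $ i $ map_permutation UNIV r (map_permutation UNIV (inv r) p) i) =
         of_int (sign p) * (\<Prod>i\<in>UNIV. A $ i $ p i)"
      unfolding 1 ..
  next
    fix p :: "'m \<Rightarrow> 'm" assume p: "p \<in> {p. p permutes UNIV}"
    then have pp: "p permutes UNIV" by simp
    show "map_permutation UNIV (inv r) (map_permutation UNIV r p) = p"
      by (rule map_permutation_compose_inv[OF r pp]) (simp add: inv_f_f[OF injr])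
    show "map_permutation UNIV r p \<in> {p. p permutes UNIV}"
      using map_permutation_permutes[OF r pp] by simp
  qed
  also have "\<dots> = (\<Sum>p\<in>{p. p permutes (UNIV::'m set)}. of_int (sign p) * (\<Prod>i\<in>UNIV. A $ r i $ r (p i)))"
  proof (rule sum.cong)
    fix p :: "'m \<Rightarrow> 'm" assume p: "p \<in> {p. p permutes UNIV}"
    have "(\<Prod>i\<in>UNIV. A $ i $ map_permutation UNIV r p i) = (\<Prod>i\<in>UNIV. A $ r i $ map_permutation UNIV r p (r i))"
      by (rule prod.reindex_bij_betw[OF r, symmetric])
    then show "of_int (sign (map_permutation UNIV r p)) * (\<Prod>i\<in>UNIV. A $ i $ map_permutation UNIV r p i)
        = of_int (sign p) * (\<Prod>i\<in>UNIV. A $ r i $ r (p i))"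
      using p sign_map_permutation[OF injr, of p] map_permutation_apply[OF injr, of _ p] by simp
  qed simp
  finally show ?thesis
    by (simp add: det_def)
qed

text \<open>Conjugating \<open>f\<close> with \<open>to_enum\<close> leaves measures and Jacobian
  determinants unchanged, so the estimate for a well-ordered index type transfers.\<close>

theorem measure_differentiable_image_le:
  fixes f :: "real^'n \<Rightarrow> real^'n"
  assumes S: "S \<in> lmeasurable"
    and deriv: "\<And>x. x \<in> S \<Longrightarrow> (f has_derivative f' x) (at x within S)"
    and bound: "\<And>x. x \<in> S \<Longrightarrow> \<bar>det (matrix (f' x))\<bar> \<le> B"
  shows "f ` S \<in> lmeasurable" "measure lebesgue (f ` S) \<le> B * measure lebesgue S"
proof -
  define g where "g = to_enum \<circ> f \<circ> of_enum"
  define g' where "g' y = to_enum \<circ> f' (of_enum y) \<circ> of_enum" for y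
  define T where "T = to_enum ` S"
  have ofT: "of_enum ` T = S" by (auto simp: T_def image_image)
  have Sl: "S \<in> sets lebesgue" using S by auto
  have T: "T \<in> lmeasurable"
    using to_enum_image_lebesgue[OF Sl] S by (auto simp: T_def fmeasurable_def)
  have mT: "measure lebesgue T = measure lebesgue S"
    using to_enum_image_lebesgue[OF Sl] by (simp add: measure_def T_def)
  have lin_deriv: "(h has_derivative h) F" if "linear h" for h :: "'c::euclidean_space \<Rightarrow> 'd::euclidean_space" and F
    using that by (simp add: linear_conv_bounded_linear bounded_linear_imp_has_derivative)
  have dg: "(g has_derivative g' y) (at y within T)" if "y \<in> T" for y
  proof -
    have "of_enum y \<in> S" using that ofT by blast
    then have 1: "((\<lambda>x. f (of_enum x)) has_derivative (\<lambda>x. f' (of_enum y) (of_enum x))) (at y within T)"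
      using has_derivative_in_compose[OF lin_deriv[OF linear_of_enum], of f "f' (of_enum y)" y T] deriv ofT by simp
    have "((\<lambda>x. to_enum (f (of_enum x))) has_derivative (\<lambda>x. to_enum (f' (of_enum y) (of_enum x)))) (at y within T)"
      using has_derivative_compose[OF 1 lin_deriv[OF linear_to_enum]] by simp
    then show ?thesis
      by (simp add: g_def g'_def comp_def)
  qed
  have "det (matrix (g' y)) = det (matrix (f' (of_enum y)))" for y
  proof -
    have ax: "of_enum (axis j 1) = (axis (Rep_enumerated j) 1 :: real^'n)" for j :: "'n enumerated"
      by (auto simp: of_enum_def axis_def vec_eq_iff Abs_enumerated_inverse Rep_enumerated_inverse)
    have "matrix (g' y) = (\<chi> i j. matrix (f' (of_enum y)) $ Rep_enumerated i $ Rep_enumerated j)"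
      by (simp add: matrix_def g'_def to_enum_def ax)
    then show ?thesis
      using det_reindex[OF bij_Rep_enumerated] by metis
  qed
  then have bg: "\<bar>det (matrix (g' y))\<bar> \<le> B" if "y \<in> T" for y
    using that ofT bound by auto
  have "(\<lambda>y. \<bar>det (matrix (g' y))\<bar>) integrable_on T"
  proof (rule measurable_bounded_by_integrable_imp_integrable)
    show "(\<lambda>y. \<bar>det (matrix (g' y))\<bar>) \<in> borel_measurable (lebesgue_on T)"
      using borel_measurable_det_Jacobian[of T g g'] dg T by auto
    show "(\<lambda>y. B) integrable_on T" using T by (simp add: integrable_on_const)
  qed (use bg T in auto)
  note * = measurable_bounded_differentiable_image[OF T dg this bg] measure_bounded_differentiable_image[OF T dg this bg]
  have fS: "f ` S = of_enum ` (g ` T)"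
    by (auto simp: g_def T_def image_image)
  have "g ` T \<in> sets lebesgue"
    using * by auto
  then have "of_enum ` (g ` T) \<in> sets lebesgue"
    by (rule differentiable_image_in_sets_lebesgue) (simp_all add: linear_imp_differentiable_on linear_of_enum)
  then have fSl: "f ` S \<in> sets lebesgue" by (simp add: fS)
  have "emeasure lebesgue (f ` S) = emeasure lebesgue (g ` T)"
    using to_enum_image_lebesgue(2)[OF fSl] by (simp add: g_def T_def image_image)
  then have "measure lebesgue (f ` S) = measure lebesgue (g ` T)" "f ` S \<in> lmeasurable"
    using * fSl by (simp_all add: measure_def fmeasurable_def del: emeasure_completion)
  then show "f ` S \<in> lmeasurable" "measure lebesgue (f ` S) \<le> B * measure lebesgue S"
    using *(2) by (simp_all only: mT)
qed

section \<open>Symmetric matrices and the Pucci operator\<close>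

lemma symmetric_inner_matrix:
  fixes A :: "real^'n^'n"
  assumes "transpose A = A"
  shows "v \<bullet> (A *v w) = (A *v v) \<bullet> w"
proof -
  have "v \<bullet> (A *v w) = (transpose A *v v) \<bullet> w"
    by (simp only: dot_lmul_matrix transpose_matrix_vector)
  then show ?thesis by (simp only: assms)
qed

text \<open>A maximiser of the Rayleigh quotient on the unit sphere of \<open>S\<close> is an
  eigenvector: the first variation in directions of \<open>S\<close> orthogonal to \<open>v\<close>
  vanishes, and invariance of \<open>S\<close> puts \<open>A v - c v\<close> among these
  directions.\<close>

lemma symmetric_eigenvector_in_subspace:
  fixes A :: "real^'n^'n"
  assumes sym: "\<And>v w. v \<bullet> (A *v w) = (A *v v) \<bullet> w"
    and S: "subspace S" "\<And>v. v \<in> S \<Longrightarrow> A *v v \<in> S" and nz: "w0 \<in> S" "w0 \<noteq> 0"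
  obtains v c where "v \<in> S" "norm v = 1" "A *v v = c *\<^sub>R v"
proof -
  define K where "K = S \<inter> sphere 0 1"
  have "compact K"
    unfolding K_def using closed_subspace[OF S(1)] by (simp add: closed_Int_compact)
  moreover have "(1 / norm w0) *\<^sub>R w0 \<in> K"
    using nz S(1) by (simp add: K_def subspace_scale)
  moreover have "continuous_on K (\<lambda>v. v \<bullet> (A *v v))"
    by (intro continuous_intros linear_continuous_on_compose matrix_vector_mul_linear)
  ultimately obtain v where v: "v \<in> K" and vmax: "\<And>w. w \<in> K \<Longrightarrow> w \<bullet> (A *v w) \<le> v \<bullet> (A *v v)"
    using continuous_attains_sup[of K "\<lambda>v. v \<bullet> (A *v v)"] by blast
  define c where "c = v \<bullet> (A *v v)"
  have vS: "v \<in> S" and v1: "norm v = 1" using v by (auto simp: K_def)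
  have le: "w \<bullet> (A *v w) \<le> c * (w \<bullet> w)" if "w \<in> S" for w
  proof (cases "w = 0")
    case False
    have "(1 / norm w) *\<^sub>R w \<in> K"
      using that False S(1) by (simp add: K_def subspace_scale)
    from vmax[OF this] have "(w \<bullet> (A *v w)) / (norm w)\<^sup>2 \<le> c"
      by (simp add: c_def matrix_vector_mult_scaleR power2_eq_square)
    then have "w \<bullet> (A *v w) \<le> c * (norm w)\<^sup>2"
      using False by (simp add: pos_divide_le_eq)
    then show ?thesis
      by (simp add: power2_norm_eq_inner)
  qed simp
  have orth: "w \<bullet> (A *v v) = 0" if w: "w \<in> S" "w \<bullet> v = 0" for w
  proof -
    define p where "p = w \<bullet> (A *v v)"
    define q where "q = c * (w \<bullet> w) - w \<bullet> (A *v w)"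
    have *: "2 * t * p \<le> t\<^sup>2 * q" for t
    proof -
      have "v + t *\<^sub>R w \<in> S"
        using S(1) vS w by (simp add: subspace_add subspace_scale)
      note le[OF this]
      moreover have "v \<bullet> (A *v w) = p"
        using sym[of v w] by (simp add: p_def inner_commute)
      then have "(v + t *\<^sub>R w) \<bullet> (A *v (v + t *\<^sub>R w)) = c + 2 * t * p + t\<^sup>2 * (w \<bullet> (A *v w))"
        by (simp add: matrix_vector_right_distrib matrix_vector_mult_scaleR inner_add_left inner_add_right
            c_def p_def[symmetric] power2_eq_square algebra_simps)
      moreover have "(v + t *\<^sub>R w) \<bullet> (v + t *\<^sub>R w) = 1 + t\<^sup>2 * (w \<bullet> w)"
        using w(2) v1 by (simp add: inner_add_left inner_add_right inner_commute[of v w] power2_eq_square norm_eq_1)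
      ultimately have "c + 2 * t * p + t\<^sup>2 * (w \<bullet> (A *v w)) \<le> c * (1 + t\<^sup>2 * (w \<bullet> w))"
        by simp
      then show ?thesis by (simp add: q_def algebra_simps)
    qed
    show ?thesis
    proof (rule ccontr)
      assume "w \<bullet> (A *v v) \<noteq> 0"
      then have p: "p \<noteq> 0" by (simp add: p_def)
      \<comment> \<open>Of the order of the optimal step: the linear term is
        \<open>2 p^2 / (|q| + 1)\<close>, the quadratic one at most half of that.\<close>
      define t where "t = p / (\<bar>q\<bar> + 1)"
      have "2 * t * p = 2 * p\<^sup>2 / (\<bar>q\<bar> + 1)"
        by (simp add: t_def power2_eq_square)
      moreover have "t\<^sup>2 * q \<le> p\<^sup>2 / (\<bar>q\<bar> + 1)"
      proof -
        have "t\<^sup>2 * q \<le> t\<^sup>2 * (\<bar>q\<bar> + 1)" by (intro mult_left_mono) auto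
        also have "\<dots> = p\<^sup>2 / (\<bar>q\<bar> + 1)" by (simp add: t_def power2_eq_square)
        finally show ?thesis .
      qed
      moreover have "p\<^sup>2 / (\<bar>q\<bar> + 1) > 0" using p by (simp add: add_nonneg_pos)
      ultimately show False using *[of t] by simp
    qed
  qed
  define z where "z = A *v v - c *\<^sub>R v"
  have "z \<in> S" using S vS by (simp add: z_def subspace_diff subspace_scale)
  moreover have zv: "z \<bullet> v = 0"
    using v1 by (simp add: z_def inner_diff_left c_def inner_commute[of v "A *v v"] norm_eq_1)
  ultimately have "z \<bullet> (A *v v) = 0" by (rule orth)
  then have "z \<bullet> z = 0"
    using zv inner_diff_right[of z "A *v v" "c *\<^sub>R v"] by (simp add: z_def[symmetric])
  then have "A *v v = c *\<^sub>R v" by (simp add: z_def)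
  then show ?thesis using that vS v1 by blast
qed

abbreviation diagonal_matrix :: "('n \<Rightarrow> 'a::zero) \<Rightarrow> 'a^'n^'n" where
  "diagonal_matrix d \<equiv> (\<chi> i j. if i = j then d i else 0)"

text \<open>An orthonormal set of eigenvectors of maximal size spans: its orthogonal complement is
  invariant by symmetry, so otherwise it would contain one more eigenvector.\<close>

lemma symmetric_matrix_diagonalization:
  fixes A :: "real^'n^'n"
  assumes "transpose A = A"
  obtains Q d where "orthogonal_matrix Q" "A ** Q = Q ** diagonal_matrix d"
proof -
  note sym = symmetric_inner_matrix[OF assms]
  define ok where "ok B \<longleftrightarrow> pairwise orthogonal B \<and> (\<forall>b\<in>B. norm b = 1 \<and> (\<exists>c. A *v b = c *\<^sub>R b))" for B :: "(real^'n) set"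
  have indep: "independent B" if "ok B" for B
    using that by (intro pairwise_orthogonal_independent) (auto simp: ok_def dest: bspec)
  have fin: "finite B \<and> card B \<le> CARD('n)" if "ok B" for B
    using independent_bound[OF indep[OF that]] by simp
  have "ok {}" by (simp add: ok_def)
  moreover have "\<forall>B. ok B \<longrightarrow> card B < Suc CARD('n)"
    using fin by (simp add: less_Suc_eq_le)
  ultimately obtain B where B: "ok B" and Bmax: "\<And>B'. ok B' \<Longrightarrow> card B' \<le> card B"
    using ex_has_greatest_nat[of ok "{}" card "Suc CARD('n)"] by metis
  have "span B = UNIV"
  proof (rule ccontr)
    assume "span B \<noteq> UNIV"
    then obtain a where a: "a \<noteq> 0" "\<And>x. x \<in> span B \<Longrightarrow> a \<bullet> x = 0"
      using span_not_UNIV_orthogonal by blast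
    define S where "S = {w. \<forall>b\<in>B. b \<bullet> w = 0}"
    have "subspace S"
      by (auto simp: subspace_def S_def inner_add_right)
    moreover have "A *v v \<in> S" if "v \<in> S" for v
      using that B by (fastforce simp: S_def sym ok_def)
    moreover have "a \<in> S"
      using a(2) by (auto simp: S_def span_base inner_commute)
    ultimately obtain v c where v: "v \<in> S" "norm v = 1" "A *v v = c *\<^sub>R v"
      using symmetric_eigenvector_in_subspace[OF sym _ _ _ a(1)] by blast
    have "v \<notin> B"
      using v by (auto simp: S_def norm_eq_1)
    moreover have "ok (insert v B)"
      using B v by (auto simp: ok_def pairwise_insert orthogonal_def S_def inner_commute)
    ultimately show False
      using Bmax[of "insert v B"] fin[OF B] by simp
  qed
  then have "card B = CARD('n)"
    using indep_card_eq_dim_span[OF indep[OF B]] by simp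
  then obtain b where b: "bij_betw b (UNIV :: 'n set) B"
    using finite_same_card_bij[of "UNIV :: 'n set" B] fin[OF B] by auto
  have bB: "b i \<in> B" for i using b by (auto simp: bij_betw_def)
  have binj: "b i = b j \<longleftrightarrow> i = j" for i j using b by (auto simp: bij_betw_def inj_on_def)
  have "\<exists>c. A *v b i = c *\<^sub>R b i" for i
    using B bB by (auto simp: ok_def)
  then obtain d where d: "\<And>i. A *v b i = d i *\<^sub>R b i" by metis
  have bb: "b i \<bullet> b j = (if i = j then 1 else 0)" for i j
    using B bB[of i] bB[of j] binj[of i j] by (auto simp: ok_def norm_eq_1 pairwise_def orthogonal_def)
  define Q where "Q = (\<chi> i j. b j $ i)"
  have "transpose Q ** Q = mat 1"
    using bb by (simp add: Q_def transpose_def matrix_matrix_mult_def mat_def inner_vec_def vec_eq_iff)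
  then have "orthogonal_matrix Q"
    by (simp add: orthogonal_matrix)
  moreover have "A ** Q = Q ** diagonal_matrix d"
  proof -
    have "(A ** Q) $ i $ j = (A *v b j) $ i" for i j
      by (simp add: Q_def matrix_matrix_mult_def matrix_vector_mult_def)
    moreover have "(Q ** diagonal_matrix d) $ i $ j = b j $ i * d j" for i j
      by (simp add: Q_def matrix_matrix_mult_def if_distrib cong: if_cong)
    ultimately show ?thesis
      by (simp add: vec_eq_iff d mult.commute)
  qed
  ultimately show ?thesis using that by blast
qed

text \<open>The form \<open>A ** Q = Q ** D\<close> avoids an inverse of \<open>Q\<close>, and an
  integral domain covers both real matrices and the polynomial matrix behind
  \<open>charpoly\<close>.\<close>

lemma det_eq_prod_if_diagonalized:
  fixes A Q :: "'a::idom^'n^'n"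
  assumes "A ** Q = Q ** diagonal_matrix d" "det Q \<noteq> 0"
  shows "det A = (\<Prod>i\<in>UNIV. d i)"
proof -
  have "det A * det Q = det Q * det (diagonal_matrix d)"
    unfolding det_mul[symmetric] assms(1) ..
  moreover have "det (diagonal_matrix d) = (\<Prod>i\<in>UNIV. d i)"
    by (subst det_diagonal) auto
  ultimately show ?thesis using assms(2) by (simp add: mult.commute)
qed

text \<open>Read as a matrix of constant polynomials, \<open>Q\<close> diagonalises
  \<open>X - A\<close> over the polynomial ring.\<close>

lemma charpoly_eq_prod:
  fixes A Q :: "real^'n^'n"
  assumes Q: "orthogonal_matrix Q" and AQ: "A ** Q = Q ** diagonal_matrix d"
  shows "charpoly A = (\<Prod>i\<in>UNIV. [:- d i, 1:])"
  unfolding charpoly_def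
proof (rule det_eq_prod_if_diagonalized[where Q = "\<chi> i j. [:Q $ i $ j:]"])
  have pCons_sum: "[:sum f S:] = (\<Sum>k\<in>S. [:f k:])" for f :: "'n \<Rightarrow> real" and S
  proof (induction S rule: infinite_finite_induct)
    case (insert x F)
    have "[:f x + sum f F:] = [:f x:] + [:sum f F:]" by simp
    then show ?case using insert by simp
  qed auto
  have pCons_mult: "[:x:] * [:y:] = [:x * y:]" for x y :: real
    by simp
  have entry: "(\<Sum>k\<in>UNIV. A $ i $ k * Q $ k $ j) = Q $ i $ j * d j" for i j
  proof -
    have "(A ** Q) $ i $ j = (Q ** diagonal_matrix d) $ i $ j"
      using AQ by simp
    then show ?thesis
      by (simp add: matrix_matrix_mult_def if_distrib cong: if_cong)
  qed
  show "(\<chi> i j. (if i = j then [:0, 1:] else 0) - [:A $ i $ j:]) ** (\<chi> i j. [:Q $ i $ j:]) =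
        (\<chi> i j. [:Q $ i $ j:]) ** diagonal_matrix (\<lambda>i. [:- d i, 1:])"
  proof -
    have a: "(\<Sum>k\<in>UNIV. ((if i = k then [:0, 1:] else 0) - [:A $ i $ k:]) * [:Q $ k $ j:])
        = [:0, 1:] * [:Q $ i $ j:] - (\<Sum>k\<in>UNIV. [:A $ i $ k:] * [:Q $ k $ j:])" for i j
      by (simp only: left_diff_distrib sum_subtractf) (simp add: if_distrib if_distribR cong: if_cong)
    have b: "(\<Sum>k\<in>UNIV. [:A $ i $ k:] * [:Q $ k $ j:]) = [:Q $ i $ j * d j:]" for i j
      by (simp only: pCons_mult entry flip: pCons_sum)
    have 1: "(\<Sum>k\<in>UNIV. ((if i = k then [:0, 1:] else 0) - [:A $ i $ k:]) * [:Q $ k $ j:])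
       = [:- (Q $ i $ j * d j), Q $ i $ j:]" for i j
      unfolding a b by simp
    have 2: "(\<Sum>k\<in>UNIV. [:Q $ i $ k:] * (if k = j then [:- d k, 1:] else 0)) = [:- (Q $ i $ j * d j), Q $ i $ j:]" for i j
      by (simp add: if_distrib cong: if_cong)
    show ?thesis
      by (simp only: matrix_matrix_mult_def vec_eq_iff vec_lambda_beta 1 2) simp
  qed
  \<comment> \<open>Orthogonality survives the passage to constant polynomials, so the determinant
    squares to 1.\<close>
  have "transpose (\<chi> i j. [:Q $ i $ j:]) ** (\<chi> i j. [:Q $ i $ j:]) = mat 1"
  proof -
    have "transpose Q ** Q = mat 1" using Q by (simp add: orthogonal_matrix)
    then have "(\<Sum>k\<in>UNIV. Q $ k $ i * Q $ k $ j) = (if i = j then 1 else 0)" for i j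
      by (simp add: vec_eq_iff matrix_matrix_mult_def transpose_def mat_def)
    then have "(\<Sum>k\<in>UNIV. [:Q $ k $ i:] * [:Q $ k $ j:]) = (if i = j then 1 else 0)" for i j
      by (simp only: pCons_mult flip: pCons_sum) (simp add: one_pCons)
    then show ?thesis
      by (simp only: vec_eq_iff matrix_matrix_mult_def transpose_def mat_def vec_lambda_beta) simp
  qed
  then have "det (transpose (\<chi> i j. [:Q $ i $ j:])) * det (\<chi> i j. [:Q $ i $ j:]) = 1"
    by (metis det_mul det_I)
  then show "det (\<chi> i j. [:Q $ i $ j:]) \<noteq> 0" by auto
qed

section \<open>Eigenvalue sums with multiplicity\<close>

lemma order_prod_linear:
  fixes d :: "'i \<Rightarrow> real"
  assumes "finite I"
  shows "order a (\<Prod>i\<in>I. [:- d i, 1:]) = card {i \<in> I. d i = a}"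
  using assms
proof (induction I rule: finite_induct)
  case empty
  then show ?case by (simp add: order_0I)
next
  case (insert j I)
  have nz: "[:- d j, 1:] * (\<Prod>i\<in>I. [:- d i, 1:]) \<noteq> 0"
    using insert.hyps by (intro no_zero_divisors) (auto simp: prod_zero_iff)
  have one: "order a [:- d j, 1:] = (if d j = a then 1 else 0)"
    using order_power_n_n[of a 1] by (auto intro: order_0I)
  have "{i \<in> insert j I. d i = a} = (if d j = a then insert j {i \<in> I. d i = a} else {i \<in> I. d i = a})"
    by auto
  then show ?case
    using insert nz one by (simp add: order_mult del: mult_pCons_left)
qed

text \<open>The order of a root \<open>a\<close> counts the indices with \<open>d i = a\<close>, so
  the left side is the sum over indices grouped by value.\<close>

lemma sum_roots_prod_linear:
  fixes d :: "'i::finite \<Rightarrow> real"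
  defines "p \<equiv> \<Prod>i\<in>UNIV. [:- d i, 1:]"
  shows "(\<Sum>a\<in>{a. P a \<and> poly p a = 0}. a * real (order a p)) = (\<Sum>i | P (d i). d i)"
proof -
  have roots: "{a. P a \<and> poly p a = 0} = d ` {i. P (d i)}"
    by (auto simp: p_def poly_prod)
  have "(\<Sum>i | P (d i). d i) = (\<Sum>a\<in>d ` {i. P (d i)}. \<Sum>i\<in>{i \<in> {i. P (d i)}. d i = a}. d i)"
    using sum.image_gen[of "{i. P (d i)}" d d] by simp
  also have "\<dots> = (\<Sum>a\<in>d ` {i. P (d i)}. a * real (order a p))"
  proof (rule sum.cong)
    fix a assume "a \<in> d ` {i. P (d i)}"
    then have "{i \<in> {i. P (d i)}. d i = a} = {i \<in> UNIV. d i = a}" by auto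
    then show "(\<Sum>i\<in>{i \<in> {i. P (d i)}. d i = a}. d i) = a * real (order a p)"
      by (simp add: p_def order_prod_linear)
  qed simp
  finally show ?thesis by (simp add: roots)
qed

lemma pucci_minus_eq:
  assumes "orthogonal_matrix Q" "A ** Q = Q ** diagonal_matrix d"
  shows "pucci_minus Lam A = (\<Sum>i | d i > 0. d i) + Lam * (\<Sum>i | d i < 0. d i)"
  unfolding pucci_minus_def pos_eig_sum_def neg_eig_sum_def charpoly_eq_prod[OF assms]
  by (simp only: sum_roots_prod_linear)

text \<open>All eigenvalues are at least \<open>- b\<close>. A positive one is at most
  \<open>Lam\<close> times the total negative part, to which at most \<open>n - 1\<close>
  eigenvalues contribute at most \<open>b\<close> each. They cannot all be positive, so one factor
  \<open>d i + b\<close> of the determinant is at most \<open>b\<close> while the others are at most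
  \<open>n Lam b\<close>; this produces the exponent \<open>n - 1\<close>.\<close>

lemma pucci_minus_nonpos_bounds:
  fixes A :: "real^'n^'n"
  assumes sym: "transpose A = A" and Lam: "Lam \<ge> 1" and b: "b > 0"
    and low: "\<And>v. v \<bullet> (A *v v) \<ge> - b * (v \<bullet> v)"
    and pucci: "pucci_minus Lam A \<le> 0"
  shows "v \<bullet> (A *v v) \<le> real (CARD('n) - 1) * Lam * b * (v \<bullet> v)"
    and "0 \<le> det (A + b *\<^sub>R mat 1)"
    and "det (A + b *\<^sub>R mat 1) \<le> b ^ CARD('n) * (real CARD('n) * Lam) ^ (CARD('n) - 1)"
proof -
  obtain Q d where Q: "orthogonal_matrix Q" and AQ: "A ** Q = Q ** diagonal_matrix d"
    using symmetric_matrix_diagonalization[OF sym] by blast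
  define D :: "real^'n^'n" where "D = diagonal_matrix d"
  have QQ: "transpose Q ** Q = mat 1" "Q ** transpose Q = mat 1"
    using Q by (auto simp: orthogonal_matrix_def)
  have Dv: "(D *v w) $ i = d i * w $ i" for w i
    by (simp add: D_def matrix_vector_mult_def if_distrib if_distribR cong: if_cong)
  have "A = (A ** Q) ** transpose Q"
    by (simp add: QQ flip: matrix_mul_assoc)
  then have A_eq: "A = Q ** D ** transpose Q"
    by (simp add: AQ D_def)
  have quad: "v \<bullet> (A *v v) = (\<Sum>i\<in>UNIV. d i * ((transpose Q *v v) $ i)\<^sup>2)" for v
  proof -
    have "v \<bullet> (A *v v) = v \<bullet> (Q *v (D *v (transpose Q *v v)))"
      by (simp add: A_eq matrix_vector_mul_assoc matrix_mul_assoc del: transpose_matrix_vector)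
    also have "\<dots> = (transpose Q *v v) \<bullet> (D *v (transpose Q *v v))"
      by (metis dot_lmul_matrix transpose_matrix_vector)
    finally show ?thesis
      by (simp add: inner_vec_def Dv power2_eq_square algebra_simps)
  qed
  have normQ: "v \<bullet> v = (\<Sum>i\<in>UNIV. ((transpose Q *v v) $ i)\<^sup>2)" for v
  proof -
    have "v \<bullet> v = v \<bullet> (Q *v (transpose Q *v v))"
      by (simp add: matrix_vector_mul_assoc QQ del: transpose_matrix_vector)
    also have "\<dots> = (transpose Q *v v) \<bullet> (transpose Q *v v)"
      by (metis dot_lmul_matrix transpose_matrix_vector)
    finally show ?thesis by (simp add: inner_vec_def power2_eq_square)
  qed
  have dlow: "d i \<ge> - b" for i
  proof -
    define v where "v = Q *v axis i 1"
    have tv: "transpose Q *v v = axis i 1"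
      by (simp add: v_def matrix_vector_mul_assoc QQ del: transpose_matrix_vector)
    have sq: "(axis i (1::real) $ j)\<^sup>2 = (if j = i then 1 else 0)" for j
      by (simp add: axis_def)
    have "v \<bullet> (A *v v) = d i" "v \<bullet> v = 1"
      unfolding quad normQ tv sq by (simp_all add: if_distrib cong: if_cong)
    then show ?thesis using low[of v] by simp
  qed
  have puc: "(\<Sum>i | d i > 0. d i) + Lam * (\<Sum>i | d i < 0. d i) \<le> 0"
    using pucci pucci_minus_eq[OF Q AQ, of Lam] by simp
  have dup: "d j \<le> real (CARD('n) - 1) * Lam * b" for j
  proof (cases "d j > 0")
    case True
    have "d j \<le> (\<Sum>i | d i > 0. d i)"
      using True by (intro member_le_sum) auto
    also have "\<dots> \<le> Lam * (\<Sum>i | d i < 0. - d i)"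
      using puc by (simp add: sum_negf)
    also have "\<dots> \<le> Lam * (real (CARD('n) - 1) * b)"
    proof (intro mult_left_mono)
      have "(\<Sum>i | d i < 0. - d i) \<le> (\<Sum>i | d i < 0. b)"
        using dlow by (intro sum_mono) (simp add: minus_le_iff)
      also have "\<dots> = real (card {i. d i < 0}) * b" by simp
      also have "\<dots> \<le> real (card (UNIV - {j})) * b"
        using True b by (intro mult_right_mono of_nat_mono card_mono) auto
      finally show "(\<Sum>i | d i < 0. - d i) \<le> real (CARD('n) - 1) * b"
        by (simp add: card_Diff_singleton)
    qed (use Lam in simp)
    finally show ?thesis using Lam b by (simp add: mult_ac)
  next
    case False
    have "0 \<le> real (CARD('n) - 1) * Lam * b" using Lam b by simp
    then show ?thesis using False by linarith
  qed
  show "v \<bullet> (A *v v) \<le> real (CARD('n) - 1) * Lam * b * (v \<bullet> v)"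
    unfolding quad normQ sum_distrib_left by (intro sum_mono mult_right_mono dup) auto
  obtain k where k: "d k \<le> 0"
  proof (rule ccontr)
    assume "\<not> thesis"
    then have all: "\<And>i. d i > 0" using that by (meson not_le)
    then have "{i. d i < 0} = {}" by (auto simp: not_less less_imp_le)
    moreover have "(\<Sum>i | d i > 0. d i) > 0"
      using all by (intro sum_pos) auto
    ultimately show False using puc by simp
  qed
  have detA: "det (A + b *\<^sub>R mat 1) = (\<Prod>i\<in>UNIV. d i + b)"
  proof (rule det_eq_prod_if_diagonalized[where Q = Q])
    have 1: "(A ** Q) $ i $ j = Q $ i $ j * d j" for i j
      by (simp add: AQ) (simp add: matrix_matrix_mult_def if_distrib cong: if_cong)
    have "((A + b *\<^sub>R mat 1) ** Q) $ i $ j = (A ** Q) $ i $ j + b * Q $ i $ j" for i j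
    proof -
      have "((A + b *\<^sub>R mat 1) ** Q) $ i $ j = (\<Sum>k\<in>UNIV. A $ i $ k * Q $ k $ j + (if k = i then b * Q $ k $ j else 0))"
        unfolding matrix_matrix_mult_def vec_lambda_beta by (intro sum.cong) (auto simp: mat_def algebra_simps)
      then show ?thesis
        by (simp add: sum.distrib matrix_matrix_mult_def)
    qed
    moreover have "(Q ** diagonal_matrix (\<lambda>i. d i + b)) $ i $ j = Q $ i $ j * (d j + b)" for i j
      by (simp add: matrix_matrix_mult_def if_distrib cong: if_cong)
    ultimately show "(A + b *\<^sub>R mat 1) ** Q = Q ** diagonal_matrix (\<lambda>i. d i + b)"
      by (simp add: vec_eq_iff 1 algebra_simps)
    show "det Q \<noteq> 0" using det_orthogonal_matrix[OF Q] by auto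
  qed
  show "0 \<le> det (A + b *\<^sub>R mat 1)"
    unfolding detA
  proof (intro prod_nonneg)
    fix i show "0 \<le> d i + b" using dlow[of i] by linarith
  qed
  have "(\<Prod>i\<in>UNIV. d i + b) = (d k + b) * (\<Prod>i\<in>UNIV - {k}. d i + b)"
    by (subst prod.remove[of _ k]) auto
  also have "\<dots> \<le> b * (\<Prod>i\<in>UNIV - {k}. b * (real CARD('n) * Lam))"
  proof (intro mult_mono prod_mono conjI)
    fix i
    show "0 \<le> d i + b" using dlow[of i] by linarith
    have "d i + b \<le> (real (CARD('n) - 1) * Lam + 1) * b" using dup[of i] by (simp add: algebra_simps)
    also have "\<dots> \<le> (real CARD('n) * Lam) * b"
    proof (intro mult_right_mono)
      have "real CARD('n) = real (CARD('n) - 1) + 1"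
        using zero_less_card_finite[where 'a='n] by linarith
      then show "real (CARD('n) - 1) * Lam + 1 \<le> real CARD('n) * Lam"
        using Lam by (simp add: algebra_simps)
    qed (use b in simp)
    finally show "d i + b \<le> b * (real CARD('n) * Lam)" by (simp add: mult_ac)
  next
    show "0 \<le> (\<Prod>i\<in>UNIV - {k}. d i + b)"
    proof (intro prod_nonneg)
      fix i show "0 \<le> d i + b" using dlow[of i] by linarith
    qed
  qed (use k b in auto)
  also have "\<dots> = b ^ CARD('n) * (real CARD('n) * Lam) ^ (CARD('n) - 1)"
  proof -
    have "b ^ CARD('n) = b * b ^ (CARD('n) - 1)"
      by (metis power_eq_if card_eq_0_iff finite UNIV_not_empty)
    then show ?thesis by (simp add: card_Diff_singleton power_mult_distrib)
  qed
  finally show "det (A + b *\<^sub>R mat 1) \<le> b ^ CARD('n) * (real CARD('n) * Lam) ^ (CARD('n) - 1)"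
    by (simp only: detA)
qed

section \<open>Touching paraboloids\<close>

text \<open>The common shape of two Hessian terms below: that of \<open>|y - x0|^4\<close> and that
  of the directional barrier in \<open>touches_slope_lipschitz\<close>.\<close>

lemma identity_plus_rank_one_mult:
  fixes z h :: "real^'n"
  shows "(\<chi> i j. \<alpha> * (if i = j then 1 else 0) + \<beta> * (z $ i * z $ j)) *v h = \<alpha> *\<^sub>R h + (\<beta> * (z \<bullet> h)) *\<^sub>R z"
proof -
  have "((\<chi> i j. \<alpha> * (if i = j then 1 else 0) + \<beta> * (z $ i * z $ j)) *v h) $ i = \<alpha> * h $ i + \<beta> * (z \<bullet> h) * z $ i" for i
  proof -
    have "((\<chi> i j. \<alpha> * (if i = j then 1 else 0) + \<beta> * (z $ i * z $ j)) *v h) $ i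
      = (\<Sum>j\<in>UNIV. (if j = i then \<alpha> * h $ j else 0) + (\<beta> * z $ i) * (z $ j * h $ j))"
      unfolding matrix_vector_mult_def vec_lambda_beta by (intro sum.cong) (auto simp: algebra_simps)
    also have "\<dots> = \<alpha> * h $ i + (\<beta> * z $ i) * (\<Sum>j\<in>UNIV. z $ j * h $ j)"
      by (simp add: sum.distrib sum_distrib_left)
    finally show ?thesis by (simp add: inner_vec_def)
  qed
  then show ?thesis by (simp add: vec_eq_iff)
qed

text \<open>Subtracting a large multiple of \<open>|y - x0|\<^sup>4\<close> turns local into global tangency without changing the Hessian at \<open>x0\<close>.\<close>

lemma visc_local_quadratic:
  fixes u :: "real^'n \<Rightarrow> real"
  assumes visc: "visc_pucci_super Lam (ball 0 1) u" and x0: "x0 \<in> ball 0 1"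
    and sym: "transpose H = H" and r: "r > 0"
    and loc: "\<And>y. y \<in> cball 0 1 \<Longrightarrow> dist y x0 < r \<Longrightarrow>
        u x0 + p \<bullet> (y - x0) + (1/2) * ((y - x0) \<bullet> (H *v (y - x0))) \<le> u y"
    and low: "\<And>y. y \<in> cball 0 1 \<Longrightarrow> m \<le> u y"
  shows "pucci_minus Lam H \<le> 0"
proof -
  define Q where "Q y = u x0 + p \<bullet> (y - x0) + (1/2) * ((y - x0) \<bullet> (H *v (y - x0)))" for y
  have contH: "continuous_on S (\<lambda>y. H *v (y - x0))" for S
    by (rule linear_continuous_on_compose[OF _ matrix_vector_mul_linear]) (intro continuous_intros)
  have "continuous_on (cball 0 1) Q"
    unfolding Q_def by (intro continuous_intros contH)
  then have "bounded (Q ` cball 0 1)"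
    by (intro compact_imp_bounded compact_continuous_image) auto
  then obtain K where K: "\<And>y. y \<in> cball 0 1 \<Longrightarrow> \<bar>Q y\<bar> \<le> K"
    unfolding bounded_iff by (metis imageI real_norm_def)
  \<comment> \<open>Chosen so that beyond distance \<open>r\<close> the quartic penalty is at least
    \<open>K + |m|\<close>, which brings \<open>phi\<close> down to \<open>m\<close> or
    below.\<close>
  define C where "C = (K + \<bar>m\<bar>) / r ^ 4"
  have K0: "K \<ge> 0" using K[of 0] by auto
  have C0: "C \<ge> 0" using r K0 by (simp add: C_def)
  define phi where "phi y = Q y - C * ((y - x0) \<bullet> (y - x0))\<^sup>2" for y
  define Dphi where "Dphi y = p + H *v (y - x0) - (4 * C * ((y - x0) \<bullet> (y - x0))) *\<^sub>R (y - x0)" for y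
  \<comment> \<open>For \<open>z = y - x0\<close>, the Hessian of \<open>|z|^4\<close> is
    \<open>4 |z|^2\<close> times the identity plus \<open>8 z z^T\<close>; it vanishes at
    \<open>x0\<close>.\<close>
  define Hphi where "Hphi y = H - (\<chi> i j. 4 * C * ((y - x0) \<bullet> (y - x0)) * (if i = j then 1 else 0)
      + 8 * C * ((y - x0) $ i * (y - x0) $ j))" for y
  have dH: "((\<lambda>y. H *v (y - x0)) has_derivative (\<lambda>h. H *v h)) (at y within S)" for y S
  proof -
    have "((\<lambda>y. y - x0) has_derivative (\<lambda>h. h)) (at y within S)"
      using has_derivative_diff[OF has_derivative_ident has_derivative_const] by simp
    from bounded_linear.has_derivative[OF _ this, of "(*v) H"] show ?thesis
      by (simp add: linear_conv_bounded_linear[symmetric])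
  qed
  have dz: "((\<lambda>y. y - x0) has_derivative (\<lambda>h. h)) (at y within S)" for y S
    using has_derivative_diff[OF has_derivative_ident has_derivative_const] by simp
  have dzz: "((\<lambda>y. (y - x0) \<bullet> (y - x0)) has_derivative (\<lambda>h. 2 * ((y - x0) \<bullet> h))) (at y within S)" for y S
    using has_derivative_inner[OF dz dz] by (rule has_derivative_eq_rhs) (simp add: fun_eq_iff inner_commute)
  have d1: "(phi has_derivative (\<lambda>h. Dphi y \<bullet> h)) (at y within S)" for y S
  proof -
    have dp: "((\<lambda>y. p \<bullet> (y - x0)) has_derivative (\<lambda>h. p \<bullet> h)) (at y within S)"
      using has_derivative_inner_right[OF dz] .
    have "(phi has_derivative (\<lambda>h. 0 + p \<bullet> h + (1/2) * ((y - x0) \<bullet> (H *v h) + h \<bullet> (H *v (y - x0)))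
        - C * (((y - x0) \<bullet> (y - x0)) * (2 * ((y - x0) \<bullet> h)) + (2 * ((y - x0) \<bullet> h)) * ((y - x0) \<bullet> (y - x0))))) (at y within S)"
      unfolding phi_def[abs_def] Q_def power2_eq_square
      by (intro has_derivative_diff has_derivative_add has_derivative_const dp has_derivative_mult_right
          has_derivative_inner dz dH has_derivative_mult dzz)
    moreover have "0 + p \<bullet> h + (1/2) * ((y - x0) \<bullet> (H *v h) + h \<bullet> (H *v (y - x0)))
        - C * (((y - x0) \<bullet> (y - x0)) * (2 * ((y - x0) \<bullet> h)) + (2 * ((y - x0) \<bullet> h)) * ((y - x0) \<bullet> (y - x0))) = Dphi y \<bullet> h" for h
      unfolding Dphi_def symmetric_inner_matrix[OF sym, of "y - x0" h] inner_commute[of h]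
      by (simp add: inner_add_left inner_diff_left)
    ultimately show ?thesis by simp
  qed
  have d2: "(Dphi has_derivative (\<lambda>h. Hphi y *v h)) (at y within S)" for y S
  proof -
    have "(Dphi has_derivative (\<lambda>h. 0 + H *v h - ((4 * C * ((y - x0) \<bullet> (y - x0))) *\<^sub>R h
        + (4 * C * (2 * ((y - x0) \<bullet> h))) *\<^sub>R (y - x0)))) (at y within S)"
      unfolding Dphi_def[abs_def]
      by (intro has_derivative_diff has_derivative_add has_derivative_const has_derivative_scaleR
          has_derivative_mult_right dz dH dzz)
    then have "(Dphi has_derivative (\<lambda>h. H *v h - ((4 * C * ((y - x0) \<bullet> (y - x0))) *\<^sub>R h
        + (8 * C * ((y - x0) \<bullet> h)) *\<^sub>R (y - x0)))) (at y within S)"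
      by (simp add: mult.assoc)
    moreover have "H *v h - ((4 * C * ((y - x0) \<bullet> (y - x0))) *\<^sub>R h + (8 * C * ((y - x0) \<bullet> h)) *\<^sub>R (y - x0))
        = Hphi y *v h" for h
      by (simp only: Hphi_def matrix_vector_mult_diff_rdistrib identity_plus_rank_one_mult)
    ultimately show ?thesis by simp
  qed
  have "continuous_on (cball 0 1) Hphi"
    unfolding Hphi_def[abs_def] by (intro continuous_intros)
  then have C2: "C2_on (closure (ball 0 1)) phi Dphi Hphi"
    using d1 d2 by (simp add: C2_on_def)
  have "tangent_below (ball 0 1) phi u x0"
    unfolding tangent_below_def
  proof (intro conjI ballI)
    show "phi x0 = u x0" by (simp add: phi_def Q_def)
    fix y :: "real^'n" assume "y \<in> closure (ball 0 1)"
    then have y: "y \<in> cball 0 1" by simp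
    show "phi y \<le> u y"
    proof (cases "dist y x0 < r")
      case True
      have "phi y \<le> Q y" using C0 by (simp add: phi_def)
      then show ?thesis using loc[OF y True] by (simp add: Q_def)
    next
      case False
      have "r ^ 4 \<le> norm (y - x0) ^ 4"
        using False r by (intro power_mono) (auto simp: dist_norm)
      also have "norm (y - x0) ^ 4 = ((y - x0) \<bullet> (y - x0))\<^sup>2"
        by (simp flip: power2_norm_eq_inner power_mult)
      finally have "C * r ^ 4 \<le> C * ((y - x0) \<bullet> (y - x0))\<^sup>2"
        using C0 by (rule mult_left_mono)
      then have "K + \<bar>m\<bar> \<le> C * ((y - x0) \<bullet> (y - x0))\<^sup>2"
        using r by (simp add: C_def)
      then have "phi y \<le> - \<bar>m\<bar>" using K[OF y] by (simp add: phi_def)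
      then show ?thesis using low[OF y] by linarith
    qed
  qed
  then have "pucci_minus Lam (Hphi x0) \<le> 0"
    using visc x0 C2 unfolding visc_pucci_super_def by blast
  moreover have "Hphi x0 = H" by (simp add: Hphi_def vec_eq_iff)
  ultimately show ?thesis by simp
qed

text \<open>\<open>P\<close> is the slope of the affine function supporting \<open>u + b|y|\<^sup>2/2\<close> at \<open>x\<close>, so \<open>P / b\<close> is the vertex of the paraboloid.\<close>

definition touches :: "real \<Rightarrow> (real^'n \<Rightarrow> real) \<Rightarrow> real^'n \<Rightarrow> real^'n \<Rightarrow> bool" where
  "touches b u x P \<longleftrightarrow> (\<forall>y\<in>cball 0 1. u x + (b/2) * (x \<bullet> x) + P \<bullet> (y - x) \<le> u y + (b/2) * (y \<bullet> y))"

section \<open>Limits along sequences approaching a point\<close>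

lemma LIMSEQ_eventually_close:
  fixes f :: "nat \<Rightarrow> real"
  assumes "\<And>k. eventually (\<lambda>n. \<bar>f n - L\<bar> \<le> c / real (Suc k)) sequentially"
  shows "f \<longlonglongrightarrow> L"
  unfolding LIMSEQ_def
proof (intro allI impI)
  fix e :: real assume e: "e > 0"
  obtain k where k: "c / e < real k" using reals_Archimedean2 by blast
  then have "c < e * real (Suc k)" using e by (simp add: field_simps)
  then have "c / real (Suc k) < e" by (simp add: field_simps)
  moreover obtain N where "\<And>n. n \<ge> N \<Longrightarrow> \<bar>f n - L\<bar> \<le> c / real (Suc k)"
    using assms[of k] unfolding eventually_sequentially by blast
  ultimately show "\<exists>no. \<forall>n\<ge>no. dist (f n) L < e"
    unfolding dist_real_def by (meson le_less_trans)
qed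

text \<open>The direction may be attained only in the limit. This Hadamard form is needed because
  points of the contact set lie near rays from \<open>x0\<close> but not on them.\<close>

lemma has_derivative_along_sequence:
  fixes f :: "'a::real_normed_vector \<Rightarrow> 'b::real_normed_vector"
  assumes deriv: "(f has_derivative D) (at x0 within S)" and t: "\<And>n. t n > 0" "t \<longlonglongrightarrow> 0"
    and x: "\<And>n. x n \<in> S" "(\<lambda>n. (x n - x0) /\<^sub>R t n) \<longlonglongrightarrow> v"
  shows "(\<lambda>n. (f (x n) - f x0) /\<^sub>R t n) \<longlonglongrightarrow> D v"
proof -
  have D: "bounded_linear D" using deriv by (rule has_derivative_bounded_linear)
  define w where "w n = (x n - x0) /\<^sub>R t n" for n
  have wv: "w \<longlonglongrightarrow> v" using x(2) by (simp add: w_def[abs_def])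
  then have "Bseq w"
    by (intro convergent_imp_Bseq convergentI)
  then obtain K where K: "K > 0" "\<And>n. norm (w n) \<le> K"
    unfolding Bseq_def by blast
  have xw: "x n - x0 = t n *\<^sub>R w n" for n using t(1)[of n] by (simp add: w_def)
  have "(\<lambda>n. (f (x n) - f x0) /\<^sub>R t n - D (w n)) \<longlonglongrightarrow> 0"
    unfolding LIMSEQ_def
  proof (intro allI impI)
    fix e :: real assume e: "e > 0"
    define e' where "e' = e / (2 * K)"
    have e': "e' > 0" using e K by (simp add: e'_def)
    obtain d where d: "d > 0" "\<And>z. z \<in> S \<Longrightarrow> norm (z - x0) < d \<Longrightarrow> norm (f z - f x0 - D (z - x0)) \<le> e' * norm (z - x0)"
      using deriv e' unfolding has_derivative_within_alt by blast
    have "(\<lambda>n. t n * K) \<longlonglongrightarrow> 0"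
      using tendsto_mult_right[OF t(2), of "K"] by simp
    then have "eventually (\<lambda>n. t n * K < d) sequentially"
      using d(1) by (rule order_tendstoD(2))
    then obtain N where N: "\<And>n. n \<ge> N \<Longrightarrow> t n * K < d"
      unfolding eventually_sequentially by blast
    show "\<exists>no. \<forall>n\<ge>no. dist ((f (x n) - f x0) /\<^sub>R t n - D (w n)) 0 < e"
    proof (intro exI allI impI)
      fix n assume n: "n \<ge> N"
      have nx: "norm (x n - x0) \<le> t n * K" using K(2)[of n] t(1)[of n] by (simp add: xw)
      then have "norm (x n - x0) < d" using N[OF n] by linarith
      then have "norm (f (x n) - f x0 - D (x n - x0)) \<le> e' * norm (x n - x0)"
        by (rule d(2)[OF x(1)])
      also have "\<dots> \<le> e' * (t n * K)" using nx e' by simp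
      finally have "norm (f (x n) - f x0 - D (x n - x0)) / t n \<le> e' * K"
        using t(1)[of n] by (simp add: field_simps)
      moreover have "(f (x n) - f x0) /\<^sub>R t n - D (w n) = (f (x n) - f x0 - D (x n - x0)) /\<^sub>R t n"
        using t(1)[of n] by (simp add: xw linear_scale[OF bounded_linear.linear[OF D]] scaleR_diff_right)
      ultimately have "norm ((f (x n) - f x0) /\<^sub>R t n - D (w n)) \<le> e' * K"
        using t(1)[of n] by (simp add: divide_inverse mult.commute)
      also have "\<dots> < e" using e K by (simp add: e'_def)
      finally show "dist ((f (x n) - f x0) /\<^sub>R t n - D (w n)) 0 < e" by simp
    qed
  qed
  moreover have "(\<lambda>n. D (w n)) \<longlonglongrightarrow> D v"
    by (rule bounded_linear.tendsto[OF D wv])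
  ultimately have "(\<lambda>n. ((f (x n) - f x0) /\<^sub>R t n - D (w n)) + D (w n)) \<longlonglongrightarrow> 0 + D v"
    by (rule tendsto_add)
  then show ?thesis by simp
qed

text \<open>\<open>G\<close> has density at \<open>x0\<close> in the sense that the distance to \<open>G\<close> has derivative zero there.\<close>

locale slope_expansion =
  fixes U :: "real^'n \<Rightarrow> real" and P :: "real^'n \<Rightarrow> real^'n" and C G :: "(real^'n) set"
    and x0 :: "real^'n" and M :: "real^'n^'n"
  assumes GC: "G \<subseteq> C" and x0G: "x0 \<in> G"
    and supp: "\<And>x y. x \<in> G \<Longrightarrow> y \<in> C \<Longrightarrow> U x + P x \<bullet> (y - x) \<le> U y"
    and deriv: "(P has_derivative (\<lambda>h. M *v h)) (at x0 within G)"
    and dense: "((\<lambda>y. infdist y G) has_derivative (\<lambda>h. 0)) (at x0)"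
begin

definition "F y = U y - U x0 - P x0 \<bullet> (y - x0)"

lemma F_x0 [simp]: "F x0 = 0"
  by (simp add: F_def)

lemma F_supp:
  assumes "x \<in> G" "y \<in> C"
  shows "F x + (P x - P x0) \<bullet> (y - x) \<le> F y"
  using supp[OF assms] by (simp add: F_def inner_diff_left inner_diff_right)

lemma F_nonneg: "y \<in> C \<Longrightarrow> 0 \<le> F y"
  using F_supp[OF x0G, of y] by simp

text \<open>The distance to \<open>G\<close> has derivative zero at \<open>x0\<close>, so the point
  \<open>x0 + t v\<close> lies within \<open>o(t)\<close> of \<open>G\<close>.\<close>

lemma approx_direction:
  assumes t: "\<And>n. t n > 0" "t \<longlonglongrightarrow> 0"
  obtains x where "\<And>n. x n \<in> G" "(\<lambda>n. (x n - x0) /\<^sub>R t n) \<longlonglongrightarrow> v"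
proof -
  define y where "y n = x0 + t n *\<^sub>R v" for n
  \<comment> \<open>\<open>G\<close> need not be closed, so a nearest point may be missing; the
    slack \<open>(t n)^2\<close> is negligible against \<open>t n\<close>.\<close>
  have "\<exists>x\<in>G. dist (y n) x < infdist (y n) G + (t n)\<^sup>2" for n
  proof -
    have eq: "infdist (y n) G = (INF x\<in>G. dist (y n) x)"
      using x0G by (auto simp: infdist_def)
    have "infdist (y n) G < infdist (y n) G + (t n)\<^sup>2" using t(1)[of n] by simp
    then show ?thesis
      unfolding eq using x0G by (subst (asm) cINF_less_iff) (auto intro: bdd_belowI[of _ 0])
  qed
  then obtain x where xG: "\<And>n. x n \<in> G" and xd: "\<And>n. dist (y n) (x n) < infdist (y n) G + (t n)\<^sup>2"
    by metis
  have "(y n - x0) /\<^sub>R t n = v" for n using t(1)[of n] by (simp add: y_def)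
  then have "(\<lambda>n. (infdist (y n) G - infdist x0 G) /\<^sub>R t n) \<longlonglongrightarrow> 0"
    by (intro has_derivative_along_sequence[OF dense t]) auto
  then have "(\<lambda>n. infdist (y n) G / t n) \<longlonglongrightarrow> 0"
    using x0G by (simp add: divide_inverse mult.commute)
  then have "(\<lambda>n. infdist (y n) G / t n + t n) \<longlonglongrightarrow> 0 + 0" by (intro tendsto_add t)
  then have lim0: "(\<lambda>n. infdist (y n) G / t n + t n) \<longlonglongrightarrow> 0" by simp
  have "norm ((x n - x0) /\<^sub>R t n - v) \<le> infdist (y n) G / t n + t n" for n
  proof -
    have "(x n - x0) /\<^sub>R t n - v = (x n - y n) /\<^sub>R t n"
      using t(1)[of n] by (simp add: y_def algebra_simps)
    then have "norm ((x n - x0) /\<^sub>R t n - v) = dist (y n) (x n) / t n"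
      using t(1)[of n] by (simp add: dist_norm norm_minus_commute divide_inverse mult.commute)
    also have "\<dots> \<le> (infdist (y n) G + (t n)\<^sup>2) / t n"
      using xd[of n] t(1)[of n] by (intro divide_right_mono) auto
    also have "\<dots> = infdist (y n) G / t n + t n"
      using t(1)[of n] by (simp add: field_simps power2_eq_square)
    finally show ?thesis .
  qed
  then have "(\<lambda>n. (x n - x0) /\<^sub>R t n - v) \<longlonglongrightarrow> 0"
    by (intro Lim_null_comparison[OF _ lim0]) auto
  then have "(\<lambda>n. (x n - x0) /\<^sub>R t n) \<longlonglongrightarrow> v"
    by (simp add: LIM_zero_iff)
  then show ?thesis using that xG by blast
qed

lemma slope_direction:
  assumes t: "\<And>n. t n > 0" "t \<longlonglongrightarrow> 0"
    and x: "\<And>n. x n \<in> G" "(\<lambda>n. (x n - x0) /\<^sub>R t n) \<longlonglongrightarrow> v"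
  shows "(\<lambda>n. (P (x n) - P x0) /\<^sub>R t n) \<longlonglongrightarrow> M *v v"
  by (rule has_derivative_along_sequence[OF deriv t x])

text \<open>\<open>F\<close> is recovered from its slopes by Riemann sums along a chain of points of
  \<open>G\<close> near the segment from \<open>x0\<close> to \<open>x0 + t v\<close>. The supports
  at the left and right end of each link bound its increment from below and above. As the slopes are
  asymptotically linear, both sums approach half the quadratic form when the chain is
  refined.\<close>

lemma F_direction:
  assumes t: "\<And>n. t n > 0" "t \<longlonglongrightarrow> 0"
    and x: "\<And>n. x n \<in> G" "(\<lambda>n. (x n - x0) /\<^sub>R t n) \<longlonglongrightarrow> v"
  shows "(\<lambda>n. F (x n) / (t n)\<^sup>2) \<longlonglongrightarrow> (v \<bullet> (M *v v)) / 2"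
proof (rule LIMSEQ_eventually_close)
  fix m :: nat
  define L where "L = v \<bullet> (M *v v)"
  define k where "k = real (Suc m)"
  have k0: "k > 0" by (simp add: k_def)
  have "\<exists>g. (\<forall>n. g n \<in> G) \<and> (\<lambda>n. (g n - x0) /\<^sub>R t n) \<longlonglongrightarrow> (real j / k) *\<^sub>R v" for j
    using approx_direction[OF t] by metis
  then obtain g' where g': "\<And>j n. g' j n \<in> G" "\<And>j. (\<lambda>n. (g' j n - x0) /\<^sub>R t n) \<longlonglongrightarrow> (real j / k) *\<^sub>R v"
    by metis
  \<comment> \<open>The two ends are exact, so the increments telescope to \<open>F (x n)\<close>;
    only the interior points are approximate.\<close>
  define g where "g j n = (if j = 0 then x0 else if j = Suc m then x n else g' j n)" for j n
  have gG: "g j n \<in> G" for j n using g' x x0G by (simp add: g_def)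
  define Q where "Q i j n = ((P (g i n) - P x0) /\<^sub>R t n) \<bullet> ((g (Suc j) n - g j n) /\<^sub>R t n)" for i j n
  have glim: "(\<lambda>n. (g j n - x0) /\<^sub>R t n) \<longlonglongrightarrow> (real j / k) *\<^sub>R v" for j
    using g'(2) x(2) k0 by (cases "j = 0"; cases "j = Suc m") (simp_all add: g_def k_def)
  have gdiff: "(\<lambda>n. (g (Suc j) n - g j n) /\<^sub>R t n) \<longlonglongrightarrow> (1 / k) *\<^sub>R v" for j
  proof -
    have "(\<lambda>n. (g (Suc j) n - x0) /\<^sub>R t n - (g j n - x0) /\<^sub>R t n) \<longlonglongrightarrow> (real (Suc j) / k) *\<^sub>R v - (real j / k) *\<^sub>R v"
      by (intro tendsto_diff glim)
    moreover have "(g (Suc j) n - x0) /\<^sub>R t n - (g j n - x0) /\<^sub>R t n = (g (Suc j) n - g j n) /\<^sub>R t n" for n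
      by (simp add: scaleR_diff_right)
    moreover have "(real (Suc j) / k) *\<^sub>R v - (real j / k) *\<^sub>R v = (1 / k) *\<^sub>R v"
      by (simp add: scaleR_diff_left[symmetric] diff_divide_distrib[symmetric])
    ultimately show ?thesis by simp
  qed
  have qlim: "(\<lambda>n. Q i j n) \<longlonglongrightarrow> (real i / k\<^sup>2) * L" for i j
  proof -
    have "(\<lambda>n. Q i j n) \<longlonglongrightarrow> (M *v ((real i / k) *\<^sub>R v)) \<bullet> ((1 / k) *\<^sub>R v)"
      unfolding Q_def by (intro tendsto_inner gdiff slope_direction[OF t gG glim])
    moreover have "(M *v ((real i / k) *\<^sub>R v)) \<bullet> ((1 / k) *\<^sub>R v) = (real i / k\<^sup>2) * L"
      by (simp add: L_def matrix_vector_mult_scaleR inner_commute power2_eq_square)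
    ultimately show ?thesis by simp
  qed
  have scale: "((P (g i n) - P x0) \<bullet> (g (Suc j) n - g j n)) / (t n)\<^sup>2 = Q i j n" for i j n
    by (simp add: Q_def divide_inverse power2_eq_square)
  have tele: "F (x n) = (\<Sum>j<Suc m. F (g (Suc j) n) - F (g j n))" for n
    by (subst sum_lessThan_telescope) (simp add: g_def)
  have low: "(\<Sum>j<Suc m. Q j j n) \<le> F (x n) / (t n)\<^sup>2" for n
    unfolding tele sum_divide_distrib
  proof (rule sum_mono)
    fix j
    have "(P (g j n) - P x0) \<bullet> (g (Suc j) n - g j n) \<le> F (g (Suc j) n) - F (g j n)"
      using F_supp[OF gG[of j n] subsetD[OF GC gG[of "Suc j" n]]] by linarith
    then show "Q j j n \<le> (F (g (Suc j) n) - F (g j n)) / (t n)\<^sup>2"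
      unfolding scale[symmetric] by (intro divide_right_mono) auto
  qed
  have up: "F (x n) / (t n)\<^sup>2 \<le> (\<Sum>j<Suc m. Q (Suc j) j n)" for n
    unfolding tele sum_divide_distrib
  proof (rule sum_mono)
    fix j
    have "F (g (Suc j) n) - F (g j n) \<le> (P (g (Suc j) n) - P x0) \<bullet> (g (Suc j) n - g j n)"
      using F_supp[OF gG[of "Suc j" n] subsetD[OF GC gG[of j n]]] by (simp add: inner_diff_right)
    then show "(F (g (Suc j) n) - F (g j n)) / (t n)\<^sup>2 \<le> Q (Suc j) j n"
      unfolding scale[symmetric] by (intro divide_right_mono) auto
  qed
  have gauss: "(\<Sum>j<Suc m. real j) = k * (k - 1) / 2"
    unfolding k_def by (induction m) (auto simp: field_simps)
  \<comment> \<open>The left Riemann sum of \<open>s * L\<close> over [0,1] with \<open>k\<close>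
    equal pieces; \<open>s2\<close> is the right one.\<close>
  have s1: "(\<Sum>j<Suc m. (real j / k\<^sup>2) * L) = L / 2 - L / (2 * k)"
  proof -
    have "(\<Sum>j<Suc m. (real j / k\<^sup>2) * L) = (\<Sum>j<Suc m. real j) * (L / k\<^sup>2)"
      unfolding sum_distrib_right by (intro sum.cong) auto
    also have "\<dots> = L / 2 - L / (2 * k)"
      unfolding gauss using k0 by (simp add: field_simps power2_eq_square)
    finally show ?thesis .
  qed
  have s2: "(\<Sum>j<Suc m. (real (Suc j) / k\<^sup>2) * L) = L / 2 + L / (2 * k)"
  proof -
    have "(\<Sum>j<Suc m. (real (Suc j) / k\<^sup>2) * L) = (\<Sum>j<Suc m. real j + 1) * (L / k\<^sup>2)"
      unfolding sum_distrib_right by (intro sum.cong) auto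
    also have "(\<Sum>j<Suc m. real j + 1) = k * (k - 1) / 2 + k"
      unfolding sum.distrib gauss by (simp add: k_def)
    also have "(k * (k - 1) / 2 + k) * (L / k\<^sup>2) = L / 2 + L / (2 * k)"
      using k0 by (simp add: field_simps power2_eq_square)
    finally show ?thesis .
  qed
  have "(\<lambda>n. \<Sum>j<Suc m. Q j j n) \<longlonglongrightarrow> L / 2 - L / (2 * k)"
    unfolding s1[symmetric] by (intro tendsto_sum qlim)
  then have e1: "eventually (\<lambda>n. (\<Sum>j<Suc m. Q j j n) > L / 2 - L / (2 * k) - 1 / k) sequentially"
    by (rule order_tendstoD) (use k0 in simp)
  have "(\<lambda>n. \<Sum>j<Suc m. Q (Suc j) j n) \<longlonglongrightarrow> L / 2 + L / (2 * k)"
    unfolding s2[symmetric] by (intro tendsto_sum qlim)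
  then have e2: "eventually (\<lambda>n. (\<Sum>j<Suc m. Q (Suc j) j n) < L / 2 + L / (2 * k) + 1 / k) sequentially"
    by (rule order_tendstoD) (use k0 in simp)
  have Lk: "\<bar>L / (2 * k)\<bar> + 1 / k = (\<bar>L\<bar> / 2 + 1) / k"
    using k0 by (simp add: field_simps)
  show "eventually (\<lambda>n. \<bar>F (x n) / (t n)\<^sup>2 - v \<bullet> (M *v v) / 2\<bar> \<le> (\<bar>L\<bar> / 2 + 1) / real (Suc m)) sequentially"
    using e1 e2
  proof eventually_elim
    case (elim n)
    then show ?case
      using low[of n] up[of n] Lk unfolding k_def[symmetric] L_def[symmetric] by linarith
  qed
qed

lemma M_nonneg: "0 \<le> v \<bullet> (M *v v)"
proof -
  define t where "t n = inverse (real (Suc n))" for n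
  have t: "\<And>n. t n > 0" "t \<longlonglongrightarrow> 0"
    unfolding t_def[abs_def] by (simp, rule LIMSEQ_inverse_real_of_nat)
  obtain x where x: "\<And>n. x n \<in> G" "(\<lambda>n. (x n - x0) /\<^sub>R t n) \<longlonglongrightarrow> v"
    using approx_direction[OF t] by blast
  have "0 \<le> (v \<bullet> (M *v v)) / 2"
  proof (rule LIMSEQ_le_const[OF F_direction[OF t x]])
    have "0 \<le> F (x n) / (t n)\<^sup>2" for n
      using F_nonneg[OF subsetD[OF GC x(1)[of n]]] by simp
    then show "\<exists>N. \<forall>n\<ge>N. 0 \<le> F (x n) / (t n)\<^sup>2" by blast
  qed
  then show ?thesis by simp
qed

text \<open>Supports at points in direction \<open>v\<close> bound \<open>F\<close> at points in
  direction \<open>w\<close>. With \<open>w = v + s z\<close> the second-order terms form a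
  quadratic in \<open>s\<close> that is nonnegative and vanishes at 0, so its linear coefficient,
  which measures the antisymmetric part of \<open>M\<close>, is zero.\<close>

lemma M_symmetric: "transpose M = M"
proof -
  have two: "0 \<le> (w \<bullet> (M *v w)) / 2 + (v \<bullet> (M *v v)) / 2 - (M *v v) \<bullet> w" for v w
  proof -
    define t where "t n = inverse (real (Suc n))" for n
    have t: "\<And>n. t n > 0" "t \<longlonglongrightarrow> 0"
    unfolding t_def[abs_def] by (simp, rule LIMSEQ_inverse_real_of_nat)
    obtain x where x: "\<And>n. x n \<in> G" "(\<lambda>n. (x n - x0) /\<^sub>R t n) \<longlonglongrightarrow> v"
      using approx_direction[OF t] by blast
    obtain y where y: "\<And>n. y n \<in> G" "(\<lambda>n. (y n - x0) /\<^sub>R t n) \<longlonglongrightarrow> w"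
      using approx_direction[OF t] by blast
    have l1: "(\<lambda>n. F (y n) / (t n)\<^sup>2) \<longlonglongrightarrow> (w \<bullet> (M *v w)) / 2" by (rule F_direction[OF t y])
    have l2: "(\<lambda>n. F (x n) / (t n)\<^sup>2 + ((P (x n) - P x0) /\<^sub>R t n) \<bullet> ((y n - x0) /\<^sub>R t n - (x n - x0) /\<^sub>R t n))
      \<longlonglongrightarrow> (v \<bullet> (M *v v)) / 2 + (M *v v) \<bullet> (w - v)"
      by (intro tendsto_intros F_direction[OF t x] slope_direction[OF t x] x(2) y(2))
    have "F (x n) / (t n)\<^sup>2 + ((P (x n) - P x0) /\<^sub>R t n) \<bullet> ((y n - x0) /\<^sub>R t n - (x n - x0) /\<^sub>R t n) \<le> F (y n) / (t n)\<^sup>2" for n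
    proof -
      have "F (x n) / (t n)\<^sup>2 + ((P (x n) - P x0) \<bullet> (y n - x n)) / (t n)\<^sup>2 \<le> F (y n) / (t n)\<^sup>2"
        using F_supp[OF x(1)[of n] subsetD[OF GC y(1)[of n]]]
        unfolding add_divide_distrib[symmetric] by (intro divide_right_mono) auto
      moreover have "(y n - x0) /\<^sub>R t n - (x n - x0) /\<^sub>R t n = (y n - x n) /\<^sub>R t n"
        by (simp add: scaleR_diff_right)
      ultimately show ?thesis by (simp add: divide_inverse power2_eq_square mult_ac)
    qed
    then have "(v \<bullet> (M *v v)) / 2 + (M *v v) \<bullet> (w - v) \<le> (w \<bullet> (M *v w)) / 2"
      by (intro LIMSEQ_le[OF l2 l1]) auto
    then show ?thesis by (simp add: inner_diff_right inner_commute)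
  qed
  have sym: "v \<bullet> (M *v z) = z \<bullet> (M *v v)" for v z
  proof -
    define a where "a = v \<bullet> (M *v z) - z \<bullet> (M *v v)"
    define c where "c = z \<bullet> (M *v z)"
    have c0: "c \<ge> 0" using M_nonneg by (simp add: c_def)
    have key: "0 \<le> s * a + s\<^sup>2 * c" for s
      using two[of "v + s *\<^sub>R z" v]
      by (simp add: a_def c_def matrix_vector_right_distrib matrix_vector_mult_scaleR inner_add_left inner_add_right
          inner_commute[of "M *v v"] power2_eq_square algebra_simps)
    have "a = 0"
    proof (rule ccontr)
      assume a: "a \<noteq> 0"
      \<comment> \<open>Multiplied by \<open>(c + 1)^2\<close>, the quadratic takes the value
        \<open>- a^2\<close> here.\<close>
      define s where "s = - a / (c + 1)"
      have sc: "s * (c + 1) = - a" using c0 by (simp add: s_def)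
      have "(c + 1)\<^sup>2 * (s * a + s\<^sup>2 * c) = (c + 1) * (s * (c + 1)) * a + (s * (c + 1))\<^sup>2 * c"
        by (simp add: power2_eq_square algebra_simps)
      also have "\<dots> = - a\<^sup>2"
        unfolding sc by (simp add: power2_eq_square algebra_simps)
      finally have "- a\<^sup>2 \<ge> 0" using key[of s] by (metis mult_nonneg_nonneg zero_le_power2)
      then show False using a by simp
    qed
    then show ?thesis by (simp add: a_def)
  qed
  have "transpose M $ i $ j = M $ i $ j" for i j
    using sym[of "axis j 1" "axis i 1"]
    by (simp add: transpose_def inner_axis' matrix_vector_mul_component inner_axis)
  then show ?thesis by (simp add: vec_eq_iff)
qed

text \<open>Unlike \<open>F_direction\<close>, this reaches points outside \<open>G\<close>. A
  sequence of counterexamples has a limit direction \<open>v\<close> by compactness, and the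
  supports at points of \<open>G\<close> with the same limit direction force the rescaled values of
  \<open>F\<close> up to half the quadratic form at \<open>v\<close>.\<close>

lemma F_lower:
  assumes e: "e > 0"
  shows "\<exists>r>0. \<forall>y\<in>C. dist y x0 < r \<longrightarrow> (1/2) * ((y - x0) \<bullet> (M *v (y - x0))) - e * ((y - x0) \<bullet> (y - x0)) \<le> F y"
proof (rule ccontr)
  assume neg: "\<not> ?thesis"
  have "\<exists>y\<in>C. dist y x0 < inverse (real (Suc n)) \<and> F y < (1/2) * ((y - x0) \<bullet> (M *v (y - x0))) - e * ((y - x0) \<bullet> (y - x0))" for n
  proof -
    have "inverse (real (Suc n)) > 0" by simp
    with neg have "\<not> (\<forall>y\<in>C. dist y x0 < inverse (real (Suc n)) \<longrightarrow>
        (1/2) * ((y - x0) \<bullet> (M *v (y - x0))) - e * ((y - x0) \<bullet> (y - x0)) \<le> F y)"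
      by blast
    then show ?thesis unfolding not_le[symmetric] by blast
  qed
  then obtain y where yC: "\<And>n. y n \<in> C" and yd: "\<And>n. dist (y n) x0 < inverse (real (Suc n))"
    and yF: "\<And>n. F (y n) < (1/2) * ((y n - x0) \<bullet> (M *v (y n - x0))) - e * ((y n - x0) \<bullet> (y n - x0))"
    by metis
  have yne: "y n \<noteq> x0" for n
  proof
    assume h: "y n = x0"
    have "F x0 < 0" using yF[of n] unfolding h by simp
    then show False by simp
  qed
  define s where "s n = norm (y n - x0)" for n
  have s0: "s n > 0" for n using yne by (simp add: s_def)
  have slim: "s \<longlonglongrightarrow> 0"
  proof (rule tendsto_sandwich[OF _ _ tendsto_const LIMSEQ_inverse_real_of_nat])
    show "\<forall>\<^sub>F n in sequentially. 0 \<le> s n" by (simp add: s_def)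
    show "\<forall>\<^sub>F n in sequentially. s n \<le> inverse (real (Suc n))"
      using yd unfolding s_def dist_norm by (intro always_eventually allI less_imp_le)
  qed
  define w where "w n = (y n - x0) /\<^sub>R s n" for n
  have "\<forall>n. w n \<in> sphere 0 1"
  proof
    fix n
    have "norm (w n) = inverse (s n) * norm (y n - x0)"
      using s0[of n] by (simp add: w_def)
    then show "w n \<in> sphere 0 1" using s0[of n] by (simp add: s_def)
  qed
  from seq_compactE[OF compact_imp_seq_compact[OF compact_sphere] this]
  obtain v r where r: "strict_mono r" and wr: "(w \<circ> r) \<longlonglongrightarrow> v"
    by metis
  define t where "t n = s (r n)" for n
  have t: "\<And>n. t n > 0" "t \<longlonglongrightarrow> 0"
    using s0 LIMSEQ_subseq_LIMSEQ[OF slim r] by (auto simp: t_def[abs_def] comp_def)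
  define z where "z n = y (r n)" for n
  define W where "W n = (z n - x0) /\<^sub>R t n" for n
  have zlim: "W \<longlonglongrightarrow> v"
    using wr by (simp add: comp_def w_def z_def t_def W_def[abs_def])
  obtain x where x: "\<And>n. x n \<in> G" "(\<lambda>n. (x n - x0) /\<^sub>R t n) \<longlonglongrightarrow> v"
    using approx_direction[OF t] by blast
  have vlim: "(\<lambda>n. M *v W n) \<longlonglongrightarrow> M *v v"
    by (rule bounded_linear.tendsto[OF matrix_vector_mul_bounded_linear zlim])
  let ?R = "\<lambda>n. F (x n) / (t n)\<^sup>2 + ((P (x n) - P x0) /\<^sub>R t n) \<bullet> (W n - (x n - x0) /\<^sub>R t n)"
  have l1: "?R \<longlonglongrightarrow> (v \<bullet> (M *v v)) / 2 + (M *v v) \<bullet> (v - v)"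
    by (intro tendsto_intros F_direction[OF t x] slope_direction[OF t x] x(2) zlim)
  have l2: "(\<lambda>n. (1/2) * (W n \<bullet> (M *v W n)) - e)
      \<longlonglongrightarrow> (1/2) * (v \<bullet> (M *v v)) - e"
    by (intro tendsto_intros zlim vlim)
  have "?R n \<le> (1/2) * (W n \<bullet> (M *v W n)) - e" for n
  proof -
    have a: "F (x n) / (t n)\<^sup>2 + ((P (x n) - P x0) \<bullet> (z n - x n)) / (t n)\<^sup>2 \<le> F (z n) / (t n)\<^sup>2"
      using F_supp[OF x(1)[of n] yC[of "r n"]]
      unfolding z_def add_divide_distrib[symmetric] by (intro divide_right_mono) auto
    have "F (z n) / (t n)\<^sup>2 \<le> ((1/2) * ((z n - x0) \<bullet> (M *v (z n - x0))) - e * ((z n - x0) \<bullet> (z n - x0))) / (t n)\<^sup>2"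
      using yF[of "r n"] by (intro divide_right_mono) (auto simp: z_def)
    also have "(z n - x0) \<bullet> (z n - x0) = (t n)\<^sup>2"
      by (simp add: t_def s_def z_def power2_norm_eq_inner)
    finally have b: "F (z n) / (t n)\<^sup>2 \<le> (1/2) * ((z n - x0) \<bullet> (M *v (z n - x0))) / (t n)\<^sup>2 - e"
      using t(1)[of n] by (simp add: diff_divide_distrib)
    have c: "W n - (x n - x0) /\<^sub>R t n = (z n - x n) /\<^sub>R t n"
      by (simp add: W_def scaleR_diff_right)
    have d: "((P (x n) - P x0) /\<^sub>R t n) \<bullet> ((z n - x n) /\<^sub>R t n) = ((P (x n) - P x0) \<bullet> (z n - x n)) / (t n)\<^sup>2"
      by (simp add: divide_inverse power2_eq_square)
    have f: "W n \<bullet> (M *v W n) = ((z n - x0) \<bullet> (M *v (z n - x0))) / (t n)\<^sup>2"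
      by (simp add: W_def matrix_vector_mult_scaleR divide_inverse power2_eq_square)
    show ?thesis
      using a b unfolding c d f by simp
  qed
  then have "\<exists>N. \<forall>n\<ge>N. ?R n \<le> (1/2) * (W n \<bullet> (M *v W n)) - e"
    by blast
  with l1 l2 have "(v \<bullet> (M *v v)) / 2 + (M *v v) \<bullet> (v - v) \<le> (1/2) * (v \<bullet> (M *v v)) - e"
    by (rule LIMSEQ_le)
  then show False using e by simp
qed

end

section \<open>Contact sets\<close>

text \<open>Vitali's theorem fills \<open>Z\<close> up to a null set with disjoint balls centred in
  \<open>Z\<close>, inside an open set barely larger than \<open>V\<close>. Each is mapped into a
  ball with radius multiplied by \<open>L\<close>, so the constant is exactly \<open>L ^ n\<close>.
  Measure is taken of the image and of \<open>V\<close>, because in the application \<open>Z\<close>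
  arises from a choice of supports and is only known to lie in a measurable set.\<close>

lemma lipschitz_image_measure_le:
  fixes f :: "'a::euclidean_space \<Rightarrow> 'a"
  assumes V: "V \<in> lmeasurable" and ZV: "Z \<subseteq> V" and lip: "L-lipschitz_on Z f" and fZ: "f ` Z \<in> lmeasurable"
  shows "measure lebesgue (f ` Z) \<le> L ^ DIM('a) * measure lebesgue V"
proof -
  have L0: "L \<ge> 0" using lip lipschitz_on_nonneg by blast
  have main: "measure lebesgue (f ` Z) \<le> L ^ DIM('a) * (measure lebesgue V + e)" if e: "e > 0" for e
  proof -
    obtain W where W: "open W" "V \<subseteq> W" "W \<in> lmeasurable" "measure lebesgue W < measure lebesgue V + e"
    proof -
      have Vs: "V \<in> sets lebesgue" using V by auto
      obtain T where T: "open T" "V \<subseteq> T" "T - V \<in> lmeasurable" "emeasure lebesgue (T - V) < ennreal e"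
        using sets_lebesgue_outer_open[OF Vs e] by blast
      have "measure lebesgue (T - V) < e"
        using T(3,4) e by (simp add: emeasure_eq_measure2 ennreal_less_iff del: emeasure_completion)
      moreover have TV: "T = V \<union> (T - V)" using T(2) by blast
      then have "measure lebesgue T \<le> measure lebesgue V + measure lebesgue (T - V)"
        using V T(3) by (metis measure_Un_le fmeasurableD)
      moreover have "T \<in> lmeasurable"
        using fmeasurable.Un[OF V T(3)] TV by simp
      ultimately show thesis using that[of T] T(1,2) by simp
    qed
    define K where "K = {(z, r). z \<in> Z \<and> 0 < r \<and> ball z r \<subseteq> W}"
    obtain C where C: "countable C" "C \<subseteq> K"
      and disj: "pairwise (\<lambda>i j. disjnt (ball (fst i) (snd i)) (ball (fst j) (snd j))) C"
      and neg: "negligible (Z - (\<Union>i\<in>C. ball (fst i) (snd i)))"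
    proof (rule Vitali_covering_theorem_balls[of Z K fst snd])
      fix x and d :: real assume x: "x \<in> Z" and d: "0 < d"
      then have "x \<in> W" using ZV W by blast
      then obtain r where r: "r > 0" "ball x r \<subseteq> W" using W(1) openE by blast
      have "ball x (min r (d/2)) \<subseteq> W" using r by (intro order_trans[OF subset_ball r(2)]) simp
      then have "(x, min r (d/2)) \<in> K" using x r d by (simp add: K_def)
      moreover have "min r (d/2) < d" "min r (d/2) > 0" using d r by auto
      ultimately show "\<exists>i. i \<in> K \<and> x \<in> ball (fst i) (snd i) \<and> snd i < d"
        by (intro exI[of _ "(x, min r (d/2))"]) auto
    qed (rule that; assumption)
    let ?B = "\<lambda>i. ball (fst i) (snd i)"
    define D where "D i = cball (f (fst i)) (L * snd i)" for i
    have CK: "fst i \<in> Z" "snd i > 0" "?B i \<subseteq> W" if "i \<in> C" for i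
      using subsetD[OF C(2) that] unfolding K_def by (simp_all add: case_prod_beta)
    have bound: "measure lebesgue (\<Union>i\<in>I. D i) \<le> L ^ DIM('a) * measure lebesgue W" if I: "I \<subseteq> C" "finite I" for I
    proof -
      have "measure lebesgue (\<Union>i\<in>I. D i) \<le> (\<Sum>i\<in>I. measure lebesgue (D i))"
        using I(2) by (intro measure_UNION_le) (auto simp: D_def)
      also have "\<dots> = (\<Sum>i\<in>I. L ^ DIM('a) * measure lebesgue (?B i))"
      proof (rule sum.cong)
        fix i assume "i \<in> I"
        then have "snd i > 0" using CK I by blast
        then show "measure lebesgue (D i) = L ^ DIM('a) * measure lebesgue (?B i)"
          using L0 content_cball_conv_ball[of "f (fst i)" "L * snd i"]
            content_ball_conv_unit_ball[of "L * snd i" "f (fst i)"] content_ball_conv_unit_ball[of "snd i" "fst i"]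
          by (simp add: D_def power_mult_distrib)
      qed simp
      also have "\<dots> = L ^ DIM('a) * (\<Sum>i\<in>I. measure lebesgue (?B i))"
        by (simp add: sum_distrib_left)
      also have "(\<Sum>i\<in>I. measure lebesgue (?B i)) = measure lebesgue (\<Union>i\<in>I. ?B i)"
      proof (rule measure_UNION'[symmetric])
        show "pairwise (\<lambda>i j. disjnt (?B i) (?B j)) I"
          using disj I(1) pairwise_subset by blast
      qed (use I in auto)
      also have "L ^ DIM('a) * measure lebesgue (\<Union>i\<in>I. ?B i) \<le> L ^ DIM('a) * measure lebesgue W"
      proof (intro mult_left_mono measure_mono_fmeasurable)
        show "(\<Union>i\<in>I. ?B i) \<subseteq> W" using CK I by blast
        show "(\<Union>i\<in>I. ?B i) \<in> sets lebesgue" using I(2) by (intro sets.finite_UN) auto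
      qed (use W L0 in auto)
      finally show ?thesis .
    qed
    have UD: "(\<Union>i\<in>C. D i) \<in> lmeasurable" "measure lebesgue (\<Union>i\<in>C. D i) \<le> L ^ DIM('a) * measure lebesgue W"
      by (rule fmeasurable_UN_bound[OF C(1) _ bound] measure_UN_bound[OF C(1) _ bound]; simp add: D_def)+
    define N where "N = f ` (Z - (\<Union>i\<in>C. ?B i))"
    have "negligible N"
      unfolding N_def
    proof (rule negligible_locally_Lipschitz_image[OF _ neg])
      fix x assume "x \<in> Z - (\<Union>i\<in>C. ?B i)"
      then show "\<exists>T B. open T \<and> x \<in> T \<and> (\<forall>y\<in>(Z - (\<Union>i\<in>C. ?B i)) \<inter> T. norm (f y - f x) \<le> B * norm (y - x))"
        using lipschitz_onD[OF lip] by (intro exI[of _ UNIV] exI[of _ L]) (auto simp: dist_norm)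
    qed simp
    have "f ` Z \<subseteq> (\<Union>i\<in>C. D i) \<union> N"
    proof
      fix y assume "y \<in> f ` Z"
      then obtain z where z: "z \<in> Z" "y = f z" by blast
      show "y \<in> (\<Union>i\<in>C. D i) \<union> N"
      proof (cases "z \<in> (\<Union>i\<in>C. ?B i)")
        case True
        then obtain i where i: "i \<in> C" "z \<in> ?B i" by blast
        have "dist (f (fst i)) (f z) \<le> L * dist (fst i) z" using lipschitz_onD[OF lip] CK i z by blast
        also have "\<dots> \<le> L * snd i" using i L0 by (intro mult_left_mono) auto
        finally show ?thesis using i z by (auto simp: D_def)
      qed (use z in \<open>auto simp: N_def\<close>)
    qed
    then have "measure lebesgue (f ` Z) \<le> measure lebesgue ((\<Union>i\<in>C. D i) \<union> N)"
      using fZ UD(1) \<open>negligible N\<close> by (intro measure_mono_fmeasurable) (auto intro: fmeasurable.Un negligible_imp_measurable)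
    also have "\<dots> = measure lebesgue (\<Union>i\<in>C. D i)"
      using UD(1) \<open>negligible N\<close> by (intro measure_Un_null_set) (auto simp: negligible_iff_null_sets)
    also have "\<dots> \<le> L ^ DIM('a) * measure lebesgue W" by (rule UD(2))
    also have "\<dots> \<le> L ^ DIM('a) * (measure lebesgue V + e)"
      using W L0 by (intro mult_left_mono) auto
    finally show ?thesis .
  qed
  have "(\<lambda>k. L ^ DIM('a) * (measure lebesgue V + inverse (real (Suc k)))) \<longlonglongrightarrow> L ^ DIM('a) * (measure lebesgue V + 0)"
    by (intro tendsto_intros LIMSEQ_inverse_real_of_nat)
  then have "measure lebesgue (f ` Z) \<le> L ^ DIM('a) * (measure lebesgue V + 0)"
  proof (rule LIMSEQ_le_const)
    have "inverse (real (Suc k)) > 0" for k by simp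
    then show "\<exists>N. \<forall>k\<ge>N. measure lebesgue (f ` Z) \<le> L ^ DIM('a) * (measure lebesgue V + inverse (real (Suc k)))"
      using main by blast
  qed
  then show ?thesis by simp
qed

section \<open>Best affine minorants, the convex envelope and contact sets\<close>

definition contact_set :: "real \<Rightarrow> (real^'n \<Rightarrow> real) \<Rightarrow> (real^'n) set" where
  "contact_set b u = {x \<in> ball 0 1. \<exists>P. touches b u x P}"

text \<open>The pair \<open>l\<close> encodes an affine function by slope and constant. Its value at
  \<open>x\<close> is that of the convex envelope of \<open>u + a|y|^2/2\<close>, and
  \<open>fst l\<close> is a subgradient of the envelope there.\<close>

definition best_minorant :: "real \<Rightarrow> (real^'n \<Rightarrow> real) \<Rightarrow> real^'n \<Rightarrow> (real^'n) \<times> real \<Rightarrow> bool" where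
  "best_minorant a u x l \<longleftrightarrow>
     (\<forall>y\<in>cball 0 1. fst l \<bullet> y + snd l \<le> u y + (a/2) * (y \<bullet> y)) \<and>
     (\<forall>m. (\<forall>y\<in>cball 0 1. fst m \<bullet> y + snd m \<le> u y + (a/2) * (y \<bullet> y)) \<longrightarrow> fst m \<bullet> x + snd m \<le> fst l \<bullet> x + snd l)"

text \<open>The minorants with value at least \<open>- K\<close> at \<open>x\<close>, among them the
  constant \<open>- K\<close>, form a compact set. Their slopes are bounded because \<open>x\<close>
  has distance \<open>1 - norm x\<close> from the sphere, and a steep minorant would rise above
  \<open>u + a|y|^2/2\<close> before leaving the ball.\<close>

lemma best_minorant_exists:
  fixes u :: "real^'n \<Rightarrow> real"
  assumes bd: "\<And>y. y \<in> cball 0 1 \<Longrightarrow> \<bar>u y\<bar> \<le> K" and a: "a \<ge> 0" and x: "x \<in> ball 0 1"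
  shows "\<exists>l. best_minorant a u x l"
proof -
  define U where "U y = u y + (a/2) * (y \<bullet> y)" for y
  define D where "D = {l :: (real^'n) \<times> real. (\<forall>y\<in>cball 0 1. fst l \<bullet> y + snd l \<le> U y) \<and> - K \<le> fst l \<bullet> x + snd l}"
  have Ulow: "- K \<le> U y" if "y \<in> cball 0 1" for y
  proof -
    have "0 \<le> (a/2) * (y \<bullet> y)" using a by simp
    then show ?thesis using bd[OF that] unfolding U_def by linarith
  qed
  have Uup: "U y \<le> K + a" if "y \<in> cball 0 1" for y
  proof -
    have "y \<bullet> y \<le> 1" using that by (simp flip: power2_norm_eq_inner add: abs_square_le_1)
    then have "(a/2) * (y \<bullet> y) \<le> (a/2) * 1" using a by (intro mult_left_mono) auto
    then show ?thesis using bd[OF that] a unfolding U_def by linarith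
  qed
  have inD: "(0, - K) \<in> D" using Ulow by (simp add: D_def)
  have closedD: "closed D"
  proof -
    have "D = (\<Inter>y\<in>cball 0 1. {l. fst l \<bullet> y + snd l \<le> U y}) \<inter> {l. - K \<le> fst l \<bullet> x + snd l}"
      by (auto simp: D_def)
    moreover have "closed (\<Inter>y\<in>cball 0 1. {l :: (real^'n) \<times> real. fst l \<bullet> y + snd l \<le> U y})"
      by (intro closed_INT ballI closed_Collect_le continuous_intros)
    moreover have "closed {l :: (real^'n) \<times> real. - K \<le> fst l \<bullet> x + snd l}"
      by (intro closed_Collect_le continuous_intros)
    ultimately show ?thesis by (simp only: closed_Int)
  qed
  define \<delta> where "\<delta> = 1 - norm x"
  have d: "\<delta> > 0" using x by (simp add: \<delta>_def)
  \<comment> \<open>The rise \<open>\<delta> * norm (fst l)\<close> in the direction of the slope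
    must fit between the value at least \<open>- K\<close> at \<open>x\<close> and the upper bound
    \<open>K + a\<close>.\<close>
  define B where "B = (2 * K + a) / \<delta>"
  have slope: "norm (fst l) \<le> B" if l: "l \<in> D" for l
  proof (cases "fst l = 0")
    case True
    have "- K \<le> K + a" using Ulow[of 0] Uup[of 0] by simp
    then show ?thesis using True d by (simp add: B_def)
  next
    case False
    define y where "y = x + (\<delta> / norm (fst l)) *\<^sub>R fst l"
    have "norm y \<le> norm x + \<delta>"
      unfolding y_def using d False by (intro order_trans[OF norm_triangle_ineq]) simp
    then have "y \<in> cball 0 1" by (simp add: \<delta>_def)
    then have "fst l \<bullet> y + snd l \<le> K + a"
      using l Uup[of y] unfolding D_def by (auto dest!: bspec[of _ _ y])
    moreover have "fst l \<bullet> y = fst l \<bullet> x + \<delta> * norm (fst l)"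
      using False by (simp add: y_def inner_add_right power2_norm_eq_inner[symmetric] power2_eq_square)
    moreover have "- K \<le> fst l \<bullet> x + snd l" using l by (simp add: D_def)
    ultimately have "\<delta> * norm (fst l) \<le> 2 * K + a" by linarith
    then show ?thesis using d by (simp add: B_def field_simps)
  qed
  have "bounded D"
    unfolding bounded_iff
  proof (intro exI ballI)
    fix l assume l: "l \<in> D"
    have "snd l \<le> K + a"
      using l Uup[of 0] unfolding D_def by (auto dest!: bspec[of _ _ 0])
    moreover have "fst l \<bullet> x \<le> norm (fst l)"
      using norm_cauchy_schwarz[of "fst l" x] x mult_left_le[of "norm x" "norm (fst l)"] by simp
    then have "- K - B \<le> snd l" using l slope[OF l] by (simp add: D_def)
    ultimately have "\<bar>snd l\<bar> \<le> \<bar>K + a\<bar> + \<bar>K\<bar> + \<bar>B\<bar>" by linarith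
    moreover have "norm l \<le> norm (fst l) + norm (snd l)"
      using norm_Pair_le[of "fst l" "snd l"] by simp
    ultimately show "norm l \<le> B + (\<bar>K + a\<bar> + \<bar>K\<bar> + \<bar>B\<bar>)" using slope[OF l] by simp
  qed
  then have "compact D" using closedD by (simp add: compact_eq_bounded_closed)
  moreover have "continuous_on D (\<lambda>l. fst l \<bullet> x + snd l)" by (intro continuous_intros)
  ultimately obtain l where l: "l \<in> D" and lmax: "\<And>m. m \<in> D \<Longrightarrow> fst m \<bullet> x + snd m \<le> fst l \<bullet> x + snd l"
    using continuous_attains_sup[of D "\<lambda>l. fst l \<bullet> x + snd l"] inD by blast
  have "fst m \<bullet> x + snd m \<le> fst l \<bullet> x + snd l" if m: "\<forall>y\<in>cball 0 1. fst m \<bullet> y + snd m \<le> U y" for m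
  proof (cases "m \<in> D")
    case False
    then have "fst m \<bullet> x + snd m < - K" using m by (simp add: D_def)
    then show ?thesis using l by (simp add: D_def)
  qed (rule lmax)
  then have "best_minorant a u x l"
    using l unfolding best_minorant_def D_def U_def by blast
  then show ?thesis ..
qed

text \<open>Each minorant is optimal at its own point; adding the two comparisons gives the
  monotonicity of the subdifferential of the envelope.\<close>

lemma best_minorant_monotone:
  assumes "best_minorant a u x l" "best_minorant a u y m"
  shows "0 \<le> (fst l - fst m) \<bullet> (x - y)"
proof -
  have "fst m \<bullet> x + snd m \<le> fst l \<bullet> x + snd l" "fst l \<bullet> y + snd l \<le> fst m \<bullet> y + snd m"
    using assms unfolding best_minorant_def by blast+
  then show ?thesis by (simp add: inner_diff_left inner_diff_right)
qed

lemma touches_best_minorant: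
  assumes t: "touches a u x P" and x: "x \<in> ball 0 1"
  shows "best_minorant a u x (P, u x + (a/2) * (x \<bullet> x) - P \<bullet> x)"
proof -
  have "x \<in> cball 0 1" using x by auto
  then show ?thesis
    using t unfolding best_minorant_def touches_def by (auto simp: inner_diff_right algebra_simps)
qed

lemma best_minorant_touches:
  assumes l: "best_minorant a u x l" and eq: "fst l \<bullet> x + snd l = u x + (a/2) * (x \<bullet> x)"
  shows "touches a u x (fst l)"
  using l eq unfolding best_minorant_def touches_def by (auto simp: inner_diff_right algebra_simps)

text \<open>Expanding \<open>(b - a)/2 * |y|^2\<close> around \<open>x\<close> leaves the
  nonnegative square \<open>(b - a)/2 * |y - x|^2\<close>, and the linear part shifts the slope by
  \<open>(b - a) x\<close>.\<close>

lemma touches_mono: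
  fixes u :: "real^'n \<Rightarrow> real"
  assumes t: "touches a u x P" and ab: "a \<le> b"
  shows "touches b u x (P + (b - a) *\<^sub>R x)"
  unfolding touches_def
proof
  fix y :: "real^'n" assume y: "y \<in> cball 0 1"
  have "0 \<le> ((b - a)/2) * ((y - x) \<bullet> (y - x))" using ab by simp
  moreover have "(y - x) \<bullet> (y - x) = y \<bullet> y - x \<bullet> x - 2 * (x \<bullet> (y - x))"
    by (simp add: inner_diff_left inner_diff_right inner_commute)
  moreover have "((b - a)/2) * (Y - X - 2 * c) = ((b - a)/2) * Y - ((b - a)/2) * X - (b - a) * c" for X Y c
    by (simp add: field_simps)
  ultimately have "0 \<le> ((b - a)/2) * (y \<bullet> y) - ((b - a)/2) * (x \<bullet> x) - (b - a) * (x \<bullet> (y - x))"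
    by (simp only:)
  moreover have "b / 2 * s = a / 2 * s + ((b - a)/2) * s" for s
    by (simp add: algebra_simps diff_divide_distrib)
  moreover have "u x + a / 2 * (x \<bullet> x) + P \<bullet> (y - x) \<le> u y + a / 2 * (y \<bullet> y)"
    using t y unfolding touches_def by blast
  moreover have "(P + (b - a) *\<^sub>R x) \<bullet> (y - x) = P \<bullet> (y - x) + (b - a) * (x \<bullet> (y - x))"
    by (simp add: inner_add_left)
  ultimately show "u x + b / 2 * (x \<bullet> x) + (P + (b - a) *\<^sub>R x) \<bullet> (y - x) \<le> u y + b / 2 * (y \<bullet> y)"
    by smt
qed

lemma contact_set_mono: "a \<le> b \<Longrightarrow> contact_set a u \<subseteq> contact_set b u"
  unfolding contact_set_def using touches_mono by blast

text \<open>Contact points are those where the convex envelope \<open>w\<close> meets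
  \<open>u + a|y|^2/2\<close>. A convex function on the open ball is continuous, so they form a
  relatively closed set.\<close>

lemma contact_set_borel:
  fixes u :: "real^'n \<Rightarrow> real"
  assumes cont: "continuous_on (cball 0 1) u" and bd: "\<And>y. y \<in> cball 0 1 \<Longrightarrow> \<bar>u y\<bar> \<le> K" and a: "a \<ge> 0"
  shows "contact_set a u \<in> sets borel"
proof -
  have "\<forall>x\<in>ball 0 1. \<exists>l. best_minorant a u x l" using best_minorant_exists[where u = u and K = K, OF bd a] by blast
  then obtain l where l: "\<And>x. x \<in> ball 0 1 \<Longrightarrow> best_minorant a u x (l x)" by metis
  define w where "w x = fst (l x) \<bullet> x + snd (l x)" for x
  define U where "U y = u y + (a/2) * (y \<bullet> y)" for y
  have w_ge: "fst (l y) \<bullet> x + snd (l y) \<le> w x" if "x \<in> ball 0 1" "y \<in> ball 0 1" for x y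
    using l[OF that(1)] l[OF that(2)] unfolding best_minorant_def w_def by blast
  have "convex_on (ball 0 1) w"
  proof (intro convex_onI)
    fix t :: real and x y :: "real^'n"
    assume t: "0 < t" "t < 1" and xy: "x \<in> ball 0 1" "y \<in> ball 0 1"
    define z where "z = (1 - t) *\<^sub>R x + t *\<^sub>R y"
    have z: "z \<in> ball 0 1"
      using convexD[OF convex_ball xy, of "1 - t" t] t by (simp add: z_def)
    have "w z = (1 - t) * (fst (l z) \<bullet> x + snd (l z)) + t * (fst (l z) \<bullet> y + snd (l z))"
      by (simp add: w_def) (simp add: z_def inner_add_right algebra_simps)
    also have "\<dots> \<le> (1 - t) * w x + t * w y"
      using t xy z w_ge by (intro add_mono mult_left_mono) auto
    finally show "w ((1 - t) *\<^sub>R x + t *\<^sub>R y) \<le> (1 - t) * w x + t * w y" by (simp add: z_def)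
  qed simp
  then have contw: "continuous_on (ball 0 1) w" by (intro convex_on_continuous) auto
  have "continuous_on (ball 0 1) u" using cont by (rule continuous_on_subset) auto
  then have contU: "continuous_on (ball 0 1) U"
    unfolding U_def by (intro continuous_intros)
  have "contact_set a u = {x \<in> ball 0 1. w x = U x}"
  proof (intro Set.equalityI subsetI)
    fix x assume "x \<in> contact_set a u"
    then obtain P where x: "x \<in> ball 0 1" and t: "touches a u x P" by (auto simp: contact_set_def)
    have "U x \<le> w x"
      using touches_best_minorant[OF t x] l[OF x] unfolding best_minorant_def w_def U_def by fastforce
    moreover have "w x \<le> U x" using l[OF x] x unfolding best_minorant_def w_def U_def by auto
    ultimately show "x \<in> {x \<in> ball 0 1. w x = U x}" using x by auto
  next
    fix x assume "x \<in> {x \<in> ball 0 1. w x = U x}"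
    then show "x \<in> contact_set a u"
      using best_minorant_touches[OF l] by (auto simp: contact_set_def w_def U_def)
  qed
  moreover have "closedin (top_of_set (ball 0 1)) {x \<in> ball 0 1. w x - U x \<in> {0}}"
    using contw contU by (intro continuous_closedin_preimage_gen[of "ball 0 1" "\<lambda>x. w x - U x" UNIV "{0}", simplified vimage_def Int_def mem_Collect_eq] continuous_intros) auto
  ultimately obtain T where "closed T" "contact_set a u = ball 0 1 \<inter> T"
    by (auto simp: closedin_closed)
  then show ?thesis by simp
qed

text \<open>The error \<open>s powr (- 1/2)\<close> decays faster than the target because
  \<open>c / 4 \<le> 1/2\<close>, so it can be absorbed. The net factor of a doubling is then
  \<open>1 - 29 c / 32\<close>, below \<open>1 - (c / 4) ln 2\<close> and hence below
  \<open>2 powr (- (c / 4))\<close>.\<close>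

lemma decay_iteration:
  fixes f :: "real \<Rightarrow> real"
  assumes c: "0 < c" "c \<le> 1/2" and f1: "\<And>s. 1 \<le> s \<Longrightarrow> f s \<le> 1"
    and step: "\<And>s. 1 \<le> s \<Longrightarrow> f (2 * s) \<le> (1 - c) * f s + c * (3/32) * s powr (- 1/2)"
    and t: "2 \<le> t"
  shows "f t \<le> t powr (- (c / 4))"
proof -
  have lower: "1 - (c / 4) * ln s \<le> s powr (- (c / 4))" if "s > 0" for s :: real
    using exp_ge_add_one_self[of "- (c / 4) * ln s"] that by (simp add: powr_def)
  have ln2: "ln (2::real) \<le> 1" using ln_le_minus_one[of "2::real"] by simp
  \<comment> \<open>Induction over dyadic ranges. On [2, 4) the trivial bound on \<open>f\<close>
    starts it: one step from \<open>s / 2\<close> gives at most \<open>1 - c / 2\<close>, and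
    \<open>ln s \<le> 2\<close> there.\<close>
  have main: "2 \<le> s \<Longrightarrow> s < 2 ^ (k + 2) \<Longrightarrow> f s \<le> s powr (- (c / 4))" for k s
  proof (induction k arbitrary: s)
    case 0
    have s: "1 \<le> s / 2" using 0 by simp
    have "(s / 2) powr (- 1/2) \<le> (s / 2) powr 0" using s by (intro powr_mono) auto
    then have p: "(s / 2) powr (- 1/2) \<le> 1" using s by simp
    have "f s \<le> (1 - c) * f (s / 2) + c * (3/32) * (s / 2) powr (- 1/2)" using step[OF s] by simp
    also have "\<dots> \<le> (1 - c) * 1 + c * (3/32) * 1"
      using c f1[OF s] p by (intro add_mono mult_left_mono) auto
    also have "\<dots> \<le> 1 - (c / 4) * 2" using c by simp
    also have "\<dots> \<le> 1 - (c / 4) * ln s"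
    proof -
      have "ln s \<le> ln (2 * 2)" using 0 by (intro ln_mono) auto
      also have "\<dots> = ln 2 + ln 2" by (rule ln_mult_pos) auto
      finally have "ln s \<le> 2" using ln2 by simp
      then have "(c / 4) * ln s \<le> (c / 4) * 2" using c by (intro mult_left_mono) auto
      then show ?thesis by simp
    qed
    also have "\<dots> \<le> s powr (- (c / 4))" using 0 by (intro lower) simp
    finally show ?case .
  next
    case (Suc k)
    show ?case
    proof (cases "s < 4")
      case True
      have "(4::real) \<le> 2 ^ (k + 2)" by simp
      then have "s < 2 ^ (k + 2)" using True by linarith
      then show ?thesis using Suc by simp
    next
      case False
      define r where "r = s / 2"
      have r: "2 \<le> r" "r < 2 ^ (k + 2)" "s = 2 * r" using False Suc.prems by (auto simp: r_def)
      have pr: "r powr (- 1/2) \<le> r powr (- (c / 4))" using r c by (intro powr_mono) auto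
      have "f s \<le> (1 - c) * f r + c * (3/32) * r powr (- 1/2)" using step[of r] r by simp
      also have "\<dots> \<le> (1 - c) * r powr (- (c / 4)) + c * (3/32) * r powr (- (c / 4))"
        using c pr Suc.IH[OF r(1,2)] by (intro add_mono mult_left_mono) auto
      also have "\<dots> = (1 - c * (29/32)) * r powr (- (c / 4))" by (simp add: algebra_simps)
      also have "\<dots> \<le> (1 - (c / 4) * ln 2) * r powr (- (c / 4))"
      proof (intro mult_right_mono)
        have "(c / 4) * ln 2 \<le> (c / 4) * 1" using c ln2 by (intro mult_left_mono) auto
        then show "1 - c * (29/32) \<le> 1 - (c / 4) * ln 2" using c by simp
      qed simp
      also have "\<dots> \<le> 2 powr (- (c / 4)) * r powr (- (c / 4))"
        by (intro mult_right_mono lower) auto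
      also have "\<dots> = s powr (- (c / 4))" using r by (simp add: powr_mult)
      finally show ?thesis .
    qed
  qed
  obtain k where "t < 2 ^ k" using real_arch_pow[of 2 t] by auto
  also have "(2::real) ^ k \<le> 2 ^ (k + 2)" by (intro power_increasing) auto
  finally show ?thesis using main t by blast
qed

text \<open>Keeps the boundary layer below a fixed fraction of the ball in every dimension;
  \<open>2 ^ (10 n)\<close> in the threshold is the square of this \<open>2 ^ (5 n)\<close>.\<close>

lemma thirty_two_times_le_power: "1 \<le> n \<Longrightarrow> 32 * real n \<le> 2 ^ (5 * n)"
proof (induction n rule: nat_induct_at_least)
  case (Suc n)
  have "32 * real (Suc n) \<le> 32 * (32 * real n)" using Suc by simp
  also have "\<dots> \<le> 32 * 2 ^ (5 * n)" using Suc by simp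
  finally show ?case by (simp add: power_add)
qed simp

lemma continuous_on_cball_bounded:
  fixes u :: "'a::euclidean_space \<Rightarrow> real"
  assumes "continuous_on (cball a r) u"
  shows "\<exists>K. \<forall>y\<in>cball a r. \<bar>u y\<bar> \<le> K"
  using compact_imp_bounded[OF compact_continuous_image[OF assms compact_cball]]
  by (auto simp: bounded_iff)

section \<open>Growth of the contact sets\<close>

locale pucci_supersolution =
  fixes Lam :: real and u :: "real^'n \<Rightarrow> real"
  assumes visc: "visc_pucci_super Lam (ball 0 1) u" and Lam: "Lam \<ge> 1"
    and cont: "continuous_on (cball 0 1) u"
begin

text \<open>With \<open>q\<close> the difference of the slopes, \<open>u + b|y|\<^sup>2/2\<close> lies above the first support by the positive part
  of \<open>q \<bullet> (y - x2)\<close>. If \<open>q\<close> is large, a quadratic that is steep in direction \<open>q\<close> and slightly concave in the others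
  fits below near \<open>x1\<close>, which contradicts the equation.\<close>

lemma touches_slope_lipschitz:
  assumes b: "b > 0" and d: "\<delta> > 0"
    and t1: "touches b u x1 P1" and t2: "touches b u x2 P2"
    and dist: "norm (x1 - x2) \<le> \<delta>"
    and sub: "cball x1 (sqrt (32 * real CARD('n) * Lam) * \<delta>) \<subseteq> ball 0 1"
  shows "norm (P1 - P2) \<le> 8 * real CARD('n) * Lam * b * \<delta>"
proof (rule ccontr)
  assume neg: "\<not> ?thesis"
  define n where "n = real CARD('n)"
  define R where "R = sqrt (32 * n * Lam)"
  define q where "q = P2 - P1"
  have n1: "n \<ge> 1" using zero_less_card_finite[where 'a='n] by (simp add: n_def Suc_le_eq)
  have nL: "n * Lam \<ge> 1" using n1 Lam by (simp add: mult_ge1_I)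
  have R2: "R\<^sup>2 = 32 * n * Lam" and R1: "R \<ge> 1"
    using nL n1 Lam by (auto simp: R_def mult.assoc)
  have qbig: "norm q > 8 * n * Lam * b * \<delta>"
    using neg by (simp add: q_def n_def norm_minus_commute)
  have q0: "norm q > 0"
  proof -
    have "8 * n * Lam * b * \<delta> \<ge> 0" using n1 Lam b d by simp
    then show ?thesis using qbig by linarith
  qed
  define e where "e = q /\<^sub>R norm q"
  have ee: "e \<bullet> e = 1" using q0 by (simp add: e_def flip: power2_norm_eq_inner)
  have qe: "q = norm q *\<^sub>R e" using q0 by (simp add: e_def)
  \<comment> \<open>\<open>A\<close> makes \<open>A (s + 2 \<delta>)^2\<close> equal to
    \<open>norm q * s\<close> at \<open>s = 2 \<delta>\<close>; \<open>B\<close> makes the penalty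
    at distance \<open>R \<delta>\<close> equal to \<open>16 A \<delta>^2\<close>, the largest value
    of the first term on the slab. With \<open>R^2 = 32 n Lam\<close> this means
    \<open>2 n Lam B = A\<close>, so in the final inequality half of \<open>2 A\<close> is
    absorbed.\<close>
  define A where "A = norm q / (8 * \<delta>)"
  define B where "B = 16 * A / R\<^sup>2"
  have A0: "A > 0" using q0 d by (simp add: A_def)
  have B0: "B \<ge> 0" using A0 by (simp add: B_def)
  define U where "U y = u y + (b/2) * (y \<bullet> y)" for y
  define l where "l y = U x1 + P1 \<bullet> (y - x1)" for y
  define s where "s y = (y - x2) \<bullet> e" for y
  define psi where "psi y = A * (s y + 2 * \<delta>)\<^sup>2 - B * ((y - x1) \<bullet> (y - x1))" for y
  \<comment> \<open>On the boundary of \<open>W\<close> the barrier \<open>psi\<close> is at most 0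
    on the face \<open>s = - 2 \<delta>\<close> and on the sphere, and at most
    \<open>norm q * s\<close> on the face \<open>s = 2 \<delta>\<close>, so a negative minimum of
    \<open>g\<close> is interior.\<close>
  define W where "W = {y. \<bar>s y\<bar> \<le> 2 * \<delta>} \<inter> cball x1 (R * \<delta>)"
  have Wsub: "W \<subseteq> ball 0 1" using sub by (auto simp: W_def R_def n_def)
  have x1b: "x1 \<in> ball 0 1"
  proof (rule subsetD[OF sub])
    show "x1 \<in> cball x1 (sqrt (32 * real CARD('n) * Lam) * \<delta>)"
      using d R1 unfolding R_def[symmetric, unfolded n_def] by simp
  qed
  have x1c: "x1 \<in> cball 0 1" using x1b by auto
  have Ul: "l y \<le> U y" if "y \<in> cball 0 1" for y
    using t1 that by (simp add: touches_def l_def U_def)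
  have U2: "U x2 + P2 \<bullet> (y - x2) \<le> U y" if "y \<in> cball 0 1" for y
    using t2 that by (simp add: touches_def U_def)
  have x2c: "x2 \<in> cball 0 1"
  proof -
    have "\<delta> \<le> R * \<delta>" using R1 d by simp
    then have "x2 \<in> cball x1 (R * \<delta>)" using dist by (simp add: dist_norm)
    then have "x2 \<in> ball 0 1" using sub by (auto simp: R_def n_def)
    then show ?thesis by auto
  qed
  have Uq: "l y + norm q * s y \<le> U y" if y: "y \<in> cball 0 1" for y
  proof -
    have "norm q * s y = q \<bullet> (y - x2)"
      using qe by (metis inner_commute inner_scaleR_left s_def)
    moreover have "l x2 \<le> U x2" using Ul x2c by blast
    moreover have "l y = l x2 + P1 \<bullet> (y - x2)" by (simp add: l_def algebra_simps inner_diff_right)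
    moreover have "q \<bullet> (y - x2) = P2 \<bullet> (y - x2) - P1 \<bullet> (y - x2)" by (simp add: q_def inner_diff_left)
    ultimately show ?thesis using U2[OF y] by linarith
  qed
  \<comment> \<open>These bounds give \<open>s x1 + 2 \<delta> \<ge> \<delta>\<close>, so
    \<open>psi\<close> is positive at \<open>x1\<close> while \<open>U\<close> and \<open>l\<close>
    agree there; hence \<open>g\<close> takes a negative value.\<close>
  have s1: "- \<delta> \<le> s x1" "s x1 \<le> 0"
  proof -
    have "\<bar>s x1\<bar> \<le> norm (x1 - x2) * norm e"
      unfolding s_def by (rule Cauchy_Schwarz_ineq2)
    then show "- \<delta> \<le> s x1" using dist ee by (simp add: norm_eq_1[symmetric])
    have "norm q * s x1 \<le> 0" using Uq[OF x1c] by (simp add: l_def)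
    then show "s x1 \<le> 0" using q0 by (simp add: mult_le_0_iff)
  qed
  define g where "g y = U y - l y - psi y" for y
  have conts: "continuous_on S s" for S unfolding s_def[abs_def] by (intro continuous_intros)
  have "compact W"
  proof -
    have "closed {y. \<bar>s y\<bar> \<le> 2 * \<delta>}"
      using conts[of UNIV] by (intro closed_Collect_le continuous_intros)
    then show ?thesis unfolding W_def by (intro closed_Int_compact compact_cball)
  qed
  moreover have x1W: "x1 \<in> W" using s1 d R1 by (auto simp: W_def)
  moreover have "continuous_on W g"
  proof -
    have "continuous_on W u" using cont by (rule continuous_on_subset) (use Wsub in auto)
    then show ?thesis
      unfolding g_def[abs_def] U_def l_def psi_def by (intro continuous_intros conts)
  qed
  ultimately obtain y0 where y0: "y0 \<in> W" and ymin: "\<And>y. y \<in> W \<Longrightarrow> g y0 \<le> g y"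
    using continuous_attains_inf[of W g] by blast
  have "g x1 < 0"
    using s1 A0 d by (simp add: g_def l_def psi_def)
  then have gy0: "g y0 < 0" using ymin[OF x1W] by simp
  have y0c: "y0 \<in> cball 0 1" "y0 \<in> ball 0 1" using y0 Wsub by auto
  have psi_pos: "psi y0 > 0" and psi_q: "psi y0 > norm q * s y0"
    using gy0 Ul[OF y0c(1)] Uq[OF y0c(1)] by (auto simp: g_def)
  have sq: "(s y0 + 2 * \<delta>)\<^sup>2 \<le> 16 * \<delta>\<^sup>2"
  proof -
    have "\<bar>s y0 + 2 * \<delta>\<bar> \<le> \<bar>4 * \<delta>\<bar>" using y0 d by (auto simp: W_def)
    then have "(s y0 + 2 * \<delta>)\<^sup>2 \<le> (4 * \<delta>)\<^sup>2" by (simp only: abs_le_square_iff)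
    then show ?thesis by (simp add: power_mult_distrib)
  qed
  have in1: "s y0 \<noteq> - 2 * \<delta>"
  proof
    assume "s y0 = - 2 * \<delta>"
    then have "psi y0 \<le> 0" using B0 by (simp add: psi_def)
    then show False using psi_pos by simp
  qed
  have in2: "s y0 \<noteq> 2 * \<delta>"
  proof
    assume s: "s y0 = 2 * \<delta>"
    have "psi y0 \<le> A * (s y0 + 2 * \<delta>)\<^sup>2" using B0 by (simp add: psi_def)
    also have "\<dots> = norm q * s y0" using s d by (simp add: A_def power2_eq_square)
    finally show False using psi_q by simp
  qed
  have in3: "norm (y0 - x1) \<noteq> R * \<delta>"
  proof
    assume e: "norm (y0 - x1) = R * \<delta>"
    have "B * ((y0 - x1) \<bullet> (y0 - x1)) = B * (R * \<delta>)\<^sup>2"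
      using e by (simp flip: power2_norm_eq_inner)
    also have "\<dots> = A * (16 * \<delta>\<^sup>2)" using R1 by (simp add: B_def power_mult_distrib)
    also have "\<dots> \<ge> A * (s y0 + 2 * \<delta>)\<^sup>2" using sq A0 by simp
    finally show False using psi_pos by (simp add: psi_def)
  qed
  define W' where "W' = {y. \<bar>s y\<bar> < 2 * \<delta>} \<inter> ball x1 (R * \<delta>)"
  have "y0 \<in> W'" using y0 in1 in2 in3 by (auto simp: W_def W'_def dist_norm norm_minus_commute)
  moreover have "open W'"
    unfolding W'_def using conts[of UNIV] by (intro open_Int open_ball open_Collect_less continuous_intros)
  ultimately obtain r where r: "r > 0" "ball y0 r \<subseteq> W'"
    using openE by blast
  have W'W: "W' \<subseteq> W" by (auto simp: W_def W'_def)
  \<comment> \<open>The Hessian of \<open>l + psi - b|y|^2/2\<close>, which up to an additive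
    constant touches \<open>u\<close> from below near \<open>y0\<close>.\<close>
  define H :: "real^'n^'n" where "H = (\<chi> i j. - (2 * B + b) * (if i = j then 1 else 0) + 2 * A * (e $ i * e $ j))"
  have Hv: "v \<bullet> (H *v v) = 2 * A * (e \<bullet> v)\<^sup>2 - (2 * B + b) * (v \<bullet> v)" for v
    unfolding H_def identity_plus_rank_one_mult
    by (simp add: inner_diff_right inner_add_right inner_commute[of v e] power2_eq_square algebra_simps)
  have Hsym: "transpose H = H"
    by (simp add: H_def transpose_def vec_eq_iff mult.commute)
  define p where "p = P1 + (2 * A * (s y0 + 2 * \<delta>)) *\<^sub>R e - (2 * B) *\<^sub>R (y0 - x1) - b *\<^sub>R y0"
  obtain K where K: "\<And>y. y \<in> cball 0 1 \<Longrightarrow> \<bar>u y\<bar> \<le> K"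
    using continuous_on_cball_bounded[OF cont] by blast
  have "pucci_minus Lam H \<le> 0"
  proof (rule visc_local_quadratic[OF visc y0c(2) Hsym r(1)])
    show "- K \<le> u y" if "y \<in> cball 0 1" for y using K[OF that] by linarith
    fix y assume y: "y \<in> cball 0 1" "dist y y0 < r"
    define h where "h = y - y0"
    have "y \<in> W" using y r W'W by (auto simp: dist_commute)
    from ymin[OF this] have gg: "g y0 \<le> g y" .
    have sy: "s y = s y0 + e \<bullet> h" by (simp add: s_def h_def inner_diff_left inner_diff_right inner_commute algebra_simps)
    have yy: "y = y0 + h" by (simp add: h_def)
    have "l y + psi y - (b/2) * (y \<bullet> y) = l y0 + psi y0 - (b/2) * (y0 \<bullet> y0) + p \<bullet> h + (1/2) * (h \<bullet> (H *v h))"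
      unfolding Hv psi_def sy unfolding yy l_def p_def
      by (simp add: inner_add_left inner_add_right inner_diff_left inner_diff_right inner_commute power2_eq_square algebra_simps)
    then show "u y0 + p \<bullet> (y - y0) + 1 / 2 * ((y - y0) \<bullet> (H *v (y - y0))) \<le> u y"
      using gg by (simp add: g_def U_def h_def[symmetric])
  qed
  moreover have "- (2 * B + b) * (v \<bullet> v) \<le> v \<bullet> (H *v v)" for v
  proof -
    have "0 \<le> 2 * A * (e \<bullet> v)\<^sup>2" using A0 by simp
    then show ?thesis unfolding Hv by linarith
  qed
  ultimately have "e \<bullet> (H *v e) \<le> real (CARD('n) - 1) * Lam * (2 * B + b) * (e \<bullet> e)"
    using B0 b by (intro pucci_minus_nonpos_bounds(1)[OF Hsym Lam]) auto
  then have "2 * A \<le> (real (CARD('n) - 1) * Lam + 1) * (2 * B + b)"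
    by (simp add: Hv ee algebra_simps)
  also have "\<dots> \<le> (n * Lam) * (2 * B + b)"
  proof (intro mult_right_mono)
    have "n = real (CARD('n) - 1) + 1"
      using zero_less_card_finite[where 'a='n] unfolding n_def by linarith
    then show "real (CARD('n) - 1) * Lam + 1 \<le> n * Lam"
      using Lam by (simp add: algebra_simps)
  qed (use B0 b in simp)
  also have "\<dots> = A + n * Lam * b"
    using n1 Lam by (simp add: B_def R2 field_simps)
  finally have "A \<le> n * Lam * b" by simp
  then have "norm q \<le> 8 * n * Lam * b * \<delta>"
    using d by (simp add: A_def field_simps)
  then show False using qbig by simp
qed

text \<open>In \<open>touches_slope_lipschitz\<close> the scale \<open>\<delta>\<close> only has to
  bound the distance of the points, so it applies with both points equal to \<open>x\<close> and
  \<open>\<delta>\<close> tending to 0.\<close>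

lemma touches_slope_unique:
  assumes b: "b > 0"
    and t1: "touches b u x P1" and t2: "touches b u x P2" and x: "x \<in> ball 0 1"
  shows "P1 = P2"
proof -
  define R where "R = sqrt (32 * real CARD('n) * Lam)"
  have R: "R > 0" using Lam by (simp add: R_def)
  obtain r where r: "r > 0" "cball x r \<subseteq> ball 0 1"
    using open_contains_cball x open_ball by blast
  have "norm (P1 - P2) \<le> 0 + e" if e: "e > 0" for e
  proof -
    define K where "K = 8 * real CARD('n) * Lam * b"
    have K: "K > 0" using Lam b by (simp add: K_def)
    define \<delta> where "\<delta> = min (r / R) (e / K)"
    have d: "\<delta> > 0" "R * \<delta> \<le> r" "K * \<delta> \<le> e"
      using r R e K by (auto simp: \<delta>_def min_def field_simps)
    have "norm (P1 - P2) \<le> K * \<delta>"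
      unfolding K_def
    proof (rule touches_slope_lipschitz[OF b d(1) t1 t2])
      show "cball x (sqrt (32 * real CARD('n) * Lam) * \<delta>) \<subseteq> ball 0 1"
        using r(2) d(2) unfolding R_def[symmetric] by (meson order_trans subset_cball)
    qed (use d in simp)
    then show ?thesis using d by simp
  qed
  then have "norm (P1 - P2) \<le> 0" by (rule field_le_epsilon)
  then show ?thesis by simp
qed

text \<open>\<open>M\<close> acts as the Hessian of \<open>u + b|y|^2/2\<close> at
  \<open>x0\<close>: subtracting \<open>b\<close> and a small error yields a quadratic that touches
  \<open>u\<close> locally from below, to which the equation applies. The error then tends to
  0.\<close>

lemma slope_derivative_det_bound:
  assumes b: "b > 0"
    and G: "G \<subseteq> ball 0 1" "x0 \<in> G" and touch: "\<And>x. x \<in> G \<Longrightarrow> touches b u x (P x)"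
    and deriv: "(P has_derivative (\<lambda>h. M *v h)) (at x0 within G)"
    and dense: "((\<lambda>y. infdist y G) has_derivative (\<lambda>h. 0)) (at x0)"
  shows "\<bar>det M\<bar> \<le> b ^ CARD('n) * (real CARD('n) * Lam) ^ (CARD('n) - 1)"
proof -
  define U where "U y = u y + (b/2) * (y \<bullet> y)" for y
  interpret slope_expansion U P "cball 0 1" G x0 M
  proof
    show "U x + P x \<bullet> (y - x) \<le> U y" if "x \<in> G" "y \<in> cball 0 1" for x y
      using touch[OF that(1)] that(2) by (simp add: touches_def U_def)
  qed (use G deriv dense in auto)
  have x0: "x0 \<in> ball 0 1" using G by blast
  obtain K where K: "\<And>y. y \<in> cball 0 1 \<Longrightarrow> \<bar>u y\<bar> \<le> K"
    using continuous_on_cball_bounded[OF cont] by blast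
  have main: "0 \<le> det M \<and> det M \<le> (b + 2 * e) ^ CARD('n) * (real CARD('n) * Lam) ^ (CARD('n) - 1)" if e: "e > 0" for e
  proof -
    \<comment> \<open>\<open>F_lower\<close> loses \<open>e |h|^2\<close>, whose Hessian is
      \<open>2 e\<close> times the identity.\<close>
    define H where "H = M - (b + 2 * e) *\<^sub>R mat 1"
    have Hv: "H *v v = M *v v - (b + 2 * e) *\<^sub>R v" for v
      by (simp add: H_def matrix_vector_mult_diff_rdistrib scaleR_matrix_vector_assoc[symmetric])
    have "transpose H = transpose M - (b + 2 * e) *\<^sub>R mat 1"
      by (simp add: H_def transpose_def mat_def vec_eq_iff)
    then have Hsym: "transpose H = H" by (simp add: M_symmetric H_def)
    obtain r where r: "r > 0" and lowF: "\<And>y. y \<in> cball 0 1 \<Longrightarrow> dist y x0 < r \<Longrightarrow>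
        (1/2) * ((y - x0) \<bullet> (M *v (y - x0))) - e * ((y - x0) \<bullet> (y - x0)) \<le> F y"
      using F_lower[OF e] by blast
    have "pucci_minus Lam H \<le> 0"
    proof (rule visc_local_quadratic[OF visc x0 Hsym r])
      show "- K \<le> u y" if "y \<in> cball 0 1" for y using K[OF that] by linarith
      fix y assume y: "y \<in> cball 0 1" "dist y x0 < r"
      define h where "h = y - x0"
      have yh: "y = x0 + h" by (simp add: h_def)
      have yy: "y \<bullet> y = x0 \<bullet> x0 + 2 * (x0 \<bullet> h) + h \<bullet> h"
        unfolding yh by (simp add: inner_add_left inner_add_right inner_commute)
      have "F y = u y - u x0 - (P x0 - b *\<^sub>R x0) \<bullet> h + (b/2) * (h \<bullet> h)"
        unfolding F_def U_def yy h_def[symmetric] by (simp add: inner_diff_left algebra_simps)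
      moreover have "(1/2) * (h \<bullet> (H *v h)) = (1/2) * (h \<bullet> (M *v h)) - e * (h \<bullet> h) - (b/2) * (h \<bullet> h)"
        unfolding Hv by (simp add: inner_diff_right algebra_simps)
      ultimately show "u x0 + (P x0 - b *\<^sub>R x0) \<bullet> (y - x0) + 1 / 2 * ((y - x0) \<bullet> (H *v (y - x0))) \<le> u y"
        using lowF[OF y] unfolding h_def[symmetric] by linarith
    qed
    moreover have "- (b + 2 * e) * (v \<bullet> v) \<le> v \<bullet> (H *v v)" for v
      using M_nonneg[of v] unfolding Hv by (simp add: inner_diff_right algebra_simps)
    moreover have "H + (b + 2 * e) *\<^sub>R mat 1 = M" by (simp add: H_def)
    ultimately show ?thesis
      using pucci_minus_nonpos_bounds(2,3)[OF Hsym Lam, of "b + 2 * e"] b e by simp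
  qed
  have "(\<lambda>k. (b + 2 * inverse (real (Suc k))) ^ CARD('n) * (real CARD('n) * Lam) ^ (CARD('n) - 1))
      \<longlonglongrightarrow> (b + 2 * 0) ^ CARD('n) * (real CARD('n) * Lam) ^ (CARD('n) - 1)"
    by (intro tendsto_intros LIMSEQ_inverse_real_of_nat)
  then have "det M \<le> (b + 2 * 0) ^ CARD('n) * (real CARD('n) * Lam) ^ (CARD('n) - 1)"
  proof (rule LIMSEQ_le_const)
    show "\<exists>N. \<forall>k\<ge>N. det M \<le> (b + 2 * inverse (real (Suc k))) ^ CARD('n) * (real CARD('n) * Lam) ^ (CARD('n) - 1)"
      using main by (metis inverse_positive_iff_positive of_nat_0_less_iff zero_less_Suc)
  qed
  then show ?thesis using main[of 1] by simp
qed

lemma touches_slope_locally_lipschitz: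
  assumes b: "b > 0"
    and touch: "\<And>x. x \<in> G \<Longrightarrow> touches b u x (P x)" and x: "x \<in> ball 0 1"
  shows "\<exists>r>0. (8 * real CARD('n) * Lam * b)-lipschitz_on (G \<inter> ball x r) P"
proof -
  define R where "R = sqrt (32 * real CARD('n) * Lam)"
  have R: "R > 0" using Lam by (simp add: R_def)
  \<comment> \<open>The ball of radius \<open>R * dist y z\<close> around \<open>y\<close> that the
    barrier needs must stay in the unit ball. Since \<open>dist y z < 2 r\<close>, this follows from
    \<open>r + 2 R r = 1 - norm x\<close>.\<close>
  define r where "r = (1 - norm x) / (1 + 2 * R)"
  have r: "r > 0" using x R by (simp add: r_def)
  have rR: "r + 2 * R * r = 1 - norm x"
  proof -
    have "r * (1 + 2 * R) = 1 - norm x" using R by (simp add: r_def)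
    then show ?thesis by (simp add: algebra_simps)
  qed
  have "(8 * real CARD('n) * Lam * b)-lipschitz_on (G \<inter> ball x r) P"
  proof (rule lipschitz_onI)
    fix y z assume y: "y \<in> G \<inter> ball x r" and z: "z \<in> G \<inter> ball x r"
    show "dist (P y) (P z) \<le> 8 * real CARD('n) * Lam * b * dist y z"
    proof (cases "y = z")
      case False
      have dyz: "dist y z < 2 * r"
        using y z dist_triangle3[of y z x] by simp
      have "cball y (R * dist y z) \<subseteq> ball 0 1"
      proof
        fix w assume "w \<in> cball y (R * dist y z)"
        then have "dist y w \<le> R * (2 * r)"
          using dyz R by (smt (verit) mem_cball mult_left_mono)
        moreover have "norm w \<le> norm x + dist x y + dist y w"
          using norm_triangle_sub[of w y] norm_triangle_sub[of y x] by (simp add: dist_norm norm_minus_commute)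
        ultimately show "w \<in> ball 0 1" using y rR by simp
      qed
      then have "norm (P y - P z) \<le> 8 * real CARD('n) * Lam * b * dist y z"
        using False y z touch by (intro touches_slope_lipschitz[OF b]) (auto simp: R_def dist_norm)
      then show ?thesis by (simp add: dist_norm)
    qed simp
  qed (use Lam b in simp)
  then show ?thesis using r by blast
qed

text \<open>The points where \<open>P\<close> or the distance to \<open>G\<close> is not
  differentiable form a null set, which the locally Lipschitz \<open>P\<close> maps to a null set.
  At the others \<open>slope_derivative_det_bound\<close> controls the Jacobian.\<close>

lemma slope_image_measure:
  assumes b: "b > 0"
    and G: "G \<subseteq> ball 0 1" "G \<in> sets lebesgue" and touch: "\<And>x. x \<in> G \<Longrightarrow> touches b u x (P x)"
  shows "P ` G \<in> lmeasurable"
    and "measure lebesgue (P ` G) \<le> b ^ CARD('n) * (real CARD('n) * Lam) ^ (CARD('n) - 1) * measure lebesgue G"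
proof -
  define B where "B = b ^ CARD('n) * (real CARD('n) * Lam) ^ (CARD('n) - 1)"
  have Gl: "G \<in> lmeasurable"
    using G by (intro bounded_set_imp_lmeasurable) (auto intro: bounded_subset)
  have loclip: "\<exists>r>0. (8 * real CARD('n) * Lam * b)-lipschitz_on (G \<inter> ball x r) P" if "x \<in> G" for x
    using touches_slope_locally_lipschitz[where G = G and P = P, OF b touch] G(1) that by blast
  define N1 where "N1 = {x \<in> G. \<not> P differentiable (at x within G)}"
  \<comment> \<open>Rademacher for the distance function takes the place of Lebesgue's density
    theorem: at a point of \<open>G\<close> the distance is minimal, so its derivative is zero once
    it exists.\<close>
  define N2 where "N2 = {x \<in> G. \<not> (\<lambda>y. infdist y G) differentiable (at x)}"
  have "negligible N1"
  proof (subst locally_negligible_alt, intro ballI)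
    fix x assume x: "x \<in> N1"
    then obtain r where r: "r > 0" and lip: "(8 * real CARD('n) * Lam * b)-lipschitz_on (G \<inter> ball x r) P"
      using loclip by (auto simp: N1_def)
    have "N1 \<inter> ball x r \<subseteq> {y \<in> G \<inter> ball x r. \<not> P differentiable (at y within G \<inter> ball x r)}"
    proof
      fix y assume y: "y \<in> N1 \<inter> ball x r"
      then have "at y within G \<inter> ball x r = at y within G"
        by (intro at_within_nhd[of y "ball x r"]) auto
      then show "y \<in> {y \<in> G \<inter> ball x r. \<not> P differentiable (at y within G \<inter> ball x r)}"
        using y by (simp add: N1_def differentiable_def)
    qed
    then have "negligible (N1 \<inter> ball x r)"
      using rademacher_within[OF lip] negligible_subset by blast
    moreover have "openin (top_of_set N1) (N1 \<inter> ball x r)" by (simp add: openin_open_Int)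
    ultimately show "\<exists>U. openin (top_of_set N1) U \<and> x \<in> U \<and> negligible U"
      using x r by (intro exI[of _ "N1 \<inter> ball x r"]) auto
  qed
  moreover have "negligible N2"
  proof -
    have "1-lipschitz_on UNIV (\<lambda>y. infdist y G)"
      by (rule lipschitz_onI) (auto simp: dist_real_def infdist_triangle_abs)
    from rademacher_within[OF this] show ?thesis
      by (rule negligible_subset) (auto simp: N2_def)
  qed
  ultimately have N: "negligible (N1 \<union> N2)" by simp
  have "negligible (P ` (N1 \<union> N2))"
  proof (rule negligible_locally_Lipschitz_image[OF _ N])
    fix x assume "x \<in> N1 \<union> N2"
    then have xG: "x \<in> G" by (auto simp: N1_def N2_def)
    then obtain r where r: "r > 0" and lip: "(8 * real CARD('n) * Lam * b)-lipschitz_on (G \<inter> ball x r) P"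
      using loclip by blast
    show "\<exists>T B. open T \<and> x \<in> T \<and> (\<forall>y\<in>(N1 \<union> N2) \<inter> T. norm (P y - P x) \<le> B * norm (y - x))"
    proof (intro exI conjI ballI)
      fix y assume "y \<in> (N1 \<union> N2) \<inter> ball x r"
      then have "y \<in> G \<inter> ball x r" by (auto simp: N1_def N2_def)
      then show "norm (P y - P x) \<le> (8 * real CARD('n) * Lam * b) * norm (y - x)"
        using lipschitz_onD[OF lip, of y x] xG r by (simp add: dist_norm)
    qed (use r in auto)
  qed simp
  then have PN: "P ` (N1 \<union> N2) \<in> null_sets lebesgue" by (simp add: negligible_iff_null_sets)
  define G' where "G' = G - (N1 \<union> N2)"
  have G'l: "G' \<in> lmeasurable"
    unfolding G'_def using Gl N by (intro fmeasurable.Diff) (auto simp: negligible_imp_measurable)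
  define P' where "P' x = (SOME D. (P has_derivative D) (at x within G))" for x
  have P': "(P has_derivative P' x) (at x within G)" if "x \<in> G'" for x
  proof -
    have "P differentiable (at x within G)" using that by (auto simp: G'_def N1_def)
    then show ?thesis unfolding P'_def differentiable_def by (rule someI_ex)
  qed
  have det: "\<bar>det (matrix (P' x))\<bar> \<le> B" if x: "x \<in> G'" for x
  proof -
    have xG: "x \<in> G" using x by (simp add: G'_def)
    have "linear (P' x)" using P'[OF x] has_derivative_linear by blast
    then have "P' x = (\<lambda>h. matrix (P' x) *v h)" by (simp add: fun_eq_iff)
    then have d1: "(P has_derivative (\<lambda>h. matrix (P' x) *v h)) (at x within G)" using P'[OF x] by simp
    obtain D where D: "((\<lambda>y. infdist y G) has_derivative D) (at x)"
      using x by (auto simp: G'_def N2_def differentiable_def)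
    have "D = (\<lambda>h. 0)"
      by (rule has_derivative_local_min[OF D]) (use xG in \<open>simp add: infdist_nonneg\<close>)
    then have d2: "((\<lambda>y. infdist y G) has_derivative (\<lambda>h. 0)) (at x)" using D by simp
    show ?thesis
      unfolding B_def by (rule slope_derivative_det_bound[where G = G and P = P, OF b G(1) xG touch d1 d2])
  qed
  have sub: "(P has_derivative P' x) (at x within G')" if "x \<in> G'" for x
    by (rule has_derivative_subset[OF P'[OF that]]) (auto simp: G'_def)
  note * = measure_differentiable_image_le[OF G'l sub det]
  have PG: "P ` G = P ` G' \<union> P ` (N1 \<union> N2)" by (auto simp: G'_def N1_def N2_def)
  have "P ` (N1 \<union> N2) \<in> lmeasurable"
    using PN by (intro negligible_imp_measurable) (simp only: negligible_iff_null_sets)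
  then show "P ` G \<in> lmeasurable"
    unfolding PG by (intro fmeasurable.Un *(1))
  have "measure lebesgue (P ` G) = measure lebesgue (P ` G')"
    unfolding PG using *(1) PN by (intro measure_Un_null_set) auto
  also have "\<dots> \<le> B * measure lebesgue G'" by (rule *(2))
  also have "\<dots> \<le> B * measure lebesgue G"
    using Gl G'l b Lam by (intro mult_left_mono measure_mono_fmeasurable) (auto simp: G'_def B_def)
  finally show "measure lebesgue (P ` G) \<le> b ^ CARD('n) * (real CARD('n) * Lam) ^ (CARD('n) - 1) * measure lebesgue G"
    by (simp add: B_def)
qed

text \<open>The vertex of the opening \<open>2a\<close> paraboloid attached to \<open>x\<close> is \<open>(a x + p) / (2a)\<close>, where \<open>p\<close> is the
  slope of the best affine minorant of \<open>u + a|y|\<^sup>2/2\<close> at \<open>x\<close>. Its contact point avoids the contact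
  set of opening \<open>a\<close>: otherwise uniqueness of slopes and strict monotonicity would identify it with \<open>x\<close>.\<close>

lemma vertex_slope_reached:
  assumes bd: "\<And>y. y \<in> cball 0 1 \<Longrightarrow> \<bar>u y\<bar> \<le> K"
    and K: "K > 0" and a: "a > 0"
    and x: "norm x < 1 - 3 * sqrt (K / a)" "x \<notin> contact_set a u" and l: "best_minorant a u x l"
  obtains x' where "x' \<in> contact_set (2 * a) u - contact_set a u" "touches (2 * a) u x' (a *\<^sub>R x + fst l)"
proof -
  define \<sigma> where "\<sigma> = sqrt (K / a)"
  define \<zeta> where "\<zeta> = a *\<^sub>R x + fst l"
  define z where "z = \<zeta> /\<^sub>R (2 * a)"
  define g where "g = fst l - a *\<^sub>R x"
  have s0: "\<sigma> > 0" and s2: "a * \<sigma>\<^sup>2 = K" using K a by (auto simp: \<sigma>_def)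
  have xs: "norm x < 1 - 3 * \<sigma>" using x by (simp add: \<sigma>_def)
  have lle: "fst l \<bullet> y + snd l \<le> u y + (a/2) * (y \<bullet> y)" if "y \<in> cball 0 1" for y
    using l that unfolding best_minorant_def by blast
  \<comment> \<open>The competitor is the tangent of \<open>a|y|^2/2\<close> at \<open>x\<close>
    lowered by \<open>K\<close>; it is a minorant since \<open>u \<ge> - K\<close>.\<close>
  have lx: "fst l \<bullet> x + snd l \<ge> - K + (a/2) * (x \<bullet> x)"
  proof -
    have "fst (a *\<^sub>R x, - K - (a/2) * (x \<bullet> x)) \<bullet> x + snd (a *\<^sub>R x, - K - (a/2) * (x \<bullet> x)) \<le> fst l \<bullet> x + snd l"
    proof (rule l[unfolded best_minorant_def, THEN conjunct2, rule_format])
      fix y :: "real^'n" assume y: "y \<in> cball 0 1"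
      have "0 \<le> (a/2) * ((y - x) \<bullet> (y - x))" using a by simp
      also have "\<dots> = (a/2) * (y \<bullet> y) + (a/2) * (x \<bullet> x) - a * (x \<bullet> y)"
        by (simp add: inner_diff_left inner_diff_right inner_commute algebra_simps)
      finally show "fst (a *\<^sub>R x, - K - (a/2) * (x \<bullet> x)) \<bullet> y + snd (a *\<^sub>R x, - K - (a/2) * (x \<bullet> x)) \<le> u y + a / 2 * (y \<bullet> y)"
        using bd[OF y] by simp
    qed
    then show ?thesis by (simp add: algebra_simps)
  qed
  \<comment> \<open>At distance \<open>2 \<sigma>\<close> from \<open>x\<close> the minorant can
    gain at most \<open>2 K\<close> from the oscillation of \<open>u\<close> and
    \<open>(a/2) (2 \<sigma>)^2 = 2 K\<close> from the quadratic term. So the vertex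
    \<open>z\<close> is within \<open>\<sigma>\<close> of \<open>x\<close>, and below the contact
    point is within \<open>2 \<sigma>\<close> of \<open>z\<close>; this adds up to the layer
    \<open>3 \<sigma>\<close>.\<close>
  have gb: "norm g \<le> 2 * a * \<sigma>"
  proof (cases "g = 0")
    case False
    define y where "y = x + (2 * \<sigma> / norm g) *\<^sub>R g"
    have yx: "norm (y - x) = 2 * \<sigma>" using False s0 by (simp add: y_def)
    have "norm y \<le> norm x + 2 * \<sigma>" using norm_triangle_sub[of y x] yx by simp
    then have y: "y \<in> cball 0 1" using xs s0 by simp
    have gy: "g \<bullet> (y - x) = 2 * \<sigma> * norm g"
      using False by (simp add: y_def power2_norm_eq_inner[symmetric] power2_eq_square)
    have "fst l \<bullet> (y - x) \<le> 2 * K + (a/2) * (y \<bullet> y) - (a/2) * (x \<bullet> x)"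
      using lle[OF y] lx bd[OF y] by (simp add: inner_diff_right)
    moreover have yy: "y \<bullet> y = x \<bullet> x + 2 * (x \<bullet> (y - x)) + (norm (y - x))\<^sup>2"
      by (simp add: power2_norm_eq_inner inner_diff_left inner_diff_right inner_commute)
    have "(a/2) * (y \<bullet> y) - (a/2) * (x \<bullet> x) = a * (x \<bullet> (y - x)) + 2 * (a * \<sigma>\<^sup>2)"
      unfolding yy yx by (simp add: algebra_simps power2_eq_square)
    moreover have "g \<bullet> (y - x) = fst l \<bullet> (y - x) - a * (x \<bullet> (y - x))" by (simp add: g_def inner_diff_left)
    ultimately have "2 * \<sigma> * norm g \<le> 4 * (a * \<sigma>\<^sup>2)" using gy s2 by linarith
    then have "2 * \<sigma> * norm g \<le> 2 * \<sigma> * (2 * a * \<sigma>)" by (simp add: power2_eq_square mult_ac)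
    then show ?thesis by (rule mult_left_le_imp_le) (use s0 in simp)
  qed (use s0 a in simp)
  have zx: "z = x + g /\<^sub>R (2 * a)"
  proof -
    have "x = (2 * a) *\<^sub>R x /\<^sub>R (2 * a)" using a by simp
    then have "x + g /\<^sub>R (2 * a) = ((2 * a) *\<^sub>R x + g) /\<^sub>R (2 * a)" by (metis scaleR_add_right)
    also have "(2 * a) *\<^sub>R x + g = \<zeta>" by (simp add: g_def \<zeta>_def scaleR_left_distrib[symmetric] algebra_simps flip: scaleR_2)
    finally show ?thesis by (simp add: z_def)
  qed
  have "norm (g /\<^sub>R (2 * a)) \<le> \<sigma>" using gb a by (simp add: field_simps)
  then have zn: "norm z < 1 - 2 * \<sigma>"
    using zx norm_triangle_ineq[of x "g /\<^sub>R (2 * a)"] xs by simp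
  then have zc: "z \<in> cball 0 1" using s0 by simp
  \<comment> \<open>Up to a constant \<open>h y\<close> is \<open>u y + a |y - z|^2\<close>, so
    minimising it slides the paraboloid of opening \<open>- 2 a\<close> with vertex \<open>z\<close>
    up to contact.\<close>
  define h where "h y = u y + a * (y \<bullet> y) - \<zeta> \<bullet> y" for y
  have "continuous_on (cball 0 1) h" unfolding h_def by (intro continuous_intros cont)
  then obtain x' where x': "x' \<in> cball 0 1" and xmin: "\<And>y. y \<in> cball 0 1 \<Longrightarrow> h x' \<le> h y"
    using continuous_attains_inf[of "cball (0::real^'n) 1" h] by auto
  have \<zeta>z: "\<zeta> = (2 * a) *\<^sub>R z" using a by (simp add: z_def)
  have "a * (norm (x' - z))\<^sup>2 \<le> 2 * K"
  proof -
    have "h x' \<le> h z" by (rule xmin[OF zc])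
    moreover have "a * (norm (x' - z))\<^sup>2 = (h x' - u x') - (h z - u z)"
      unfolding h_def \<zeta>z power2_norm_eq_inner
      by (simp add: inner_diff_left inner_diff_right inner_commute algebra_simps)
    ultimately show ?thesis using bd[OF zc] bd[OF x'] by linarith
  qed
  also have "2 * K = a * (2 * \<sigma>\<^sup>2)" using s2 by simp
  finally have "(norm (x' - z))\<^sup>2 \<le> 2 * \<sigma>\<^sup>2" using a by simp
  also have "\<dots> < (2 * \<sigma>)\<^sup>2" using s0 by (simp add: power_mult_distrib)
  finally have "norm (x' - z) < 2 * \<sigma>" by (rule power_less_imp_less_base) (use s0 in simp)
  then have "norm x' < 1" using norm_triangle_sub[of x' z] zn by simp
  then have x'b: "x' \<in> ball 0 1" by simp
  have t: "touches (2 * a) u x' \<zeta>"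
    unfolding touches_def
  proof
    fix y :: "real^'n" assume "y \<in> cball 0 1"
    from xmin[OF this] show "u x' + 2 * a / 2 * (x' \<bullet> x') + \<zeta> \<bullet> (y - x') \<le> u y + 2 * a / 2 * (y \<bullet> y)"
      by (simp add: h_def inner_diff_right)
  qed
  have "x' \<notin> contact_set a u"
  proof
    assume "x' \<in> contact_set a u"
    then obtain p' where p': "touches a u x' p'" by (auto simp: contact_set_def)
    have t': "touches (2 * a) u x' (p' + (2 * a - a) *\<^sub>R x')"
      by (rule touches_mono[OF p']) (use a in simp)
    have "\<zeta> = p' + (2 * a - a) *\<^sub>R x'"
      by (rule touches_slope_unique[OF _ t t' x'b]) (use a in simp)
    then have e: "fst l - p' = - a *\<^sub>R (x - x')"
      by (simp add: \<zeta>_def algebra_simps)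
    have "0 \<le> (fst l - fst (p', u x' + (a/2) * (x' \<bullet> x') - p' \<bullet> x')) \<bullet> (x - x')"
      by (rule best_minorant_monotone[OF l touches_best_minorant[OF p' x'b]])
    then have "0 \<le> - a * ((x - x') \<bullet> (x - x'))" using e by simp
    then have "(x - x') \<bullet> (x - x') \<le> 0" using a by (simp add: mult_le_0_iff)
    then have "(x - x') \<bullet> (x - x') = 0" by (intro antisym inner_ge_zero)
    then have "x = x'" by simp
    then show False using x \<open>x' \<in> contact_set a u\<close> by simp
  qed
  moreover have "x' \<in> contact_set (2 * a) u" using t x'b by (auto simp: contact_set_def)
  ultimately show ?thesis using that t by (simp add: \<zeta>_def)
qed

text \<open>With the slope \<open>a x + p\<close> in place of the vertex, the inverse map has
  Lipschitz constant \<open>1 / a\<close>, and the slopes fill at most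
  \<open>(2 a) ^ n (n Lam) ^ (n - 1)\<close> times the measure of the new contact points. The powers
  of \<open>a\<close> cancel, so the constant is the same at every scale.\<close>

lemma contact_set_growth:
  assumes bd: "\<And>y. y \<in> cball 0 1 \<Longrightarrow> \<bar>u y\<bar> \<le> K"
    and K: "K > 0" and a: "a > 0"
  shows "measure lebesgue (ball 0 (1 - 3 * sqrt (K / a)) - contact_set a u)
     \<le> 2 ^ CARD('n) * (real CARD('n) * Lam) ^ (CARD('n) - 1) * measure lebesgue (contact_set (2 * a) u - contact_set a u)"
proof -
  define E where "E = ball 0 (1 - 3 * sqrt (K / a)) - contact_set a u"
  define G where "G = contact_set (2 * a) u - contact_set a u"
  have s0: "sqrt (K / a) > 0" using K a by simp
  have Ein: "x \<in> ball 0 1" "norm x < 1 - 3 * sqrt (K / a)" "x \<notin> contact_set a u" if "x \<in> E" for x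
  proof -
    show "norm x < 1 - 3 * sqrt (K / a)" "x \<notin> contact_set a u" using that by (simp_all add: E_def)
    then have "norm x < 1" using s0 by linarith
    then show "x \<in> ball 0 1" by simp
  qed
  have borel: "contact_set c u \<in> sets borel" if "c \<ge> 0" for c
    by (rule contact_set_borel[OF cont bd that])
  have Gs: "G \<in> sets lebesgue" "G \<subseteq> ball 0 1"
    using borel[of a] borel[of "2 * a"] a by (auto simp: G_def contact_set_def[of "2 * a"] intro!: sets_completionI_sets)
  have "E \<in> sets lebesgue" using borel[of a] a by (auto simp: E_def intro!: sets_completionI_sets)
  then have El: "E \<in> lmeasurable"
    by (rule bounded_set_imp_lmeasurable[rotated]) (auto simp: E_def intro: bounded_subset[OF bounded_ball])
  \<comment> \<open>An arbitrary choice of slope; by \<open>touches_slope_unique\<close> it agrees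
    with the slope \<open>z x\<close> produced by sliding.\<close>
  define P where "P x = (SOME Q. touches (2 * a) u x Q)" for x
  have P: "touches (2 * a) u x (P x)" if "x \<in> G" for x
    using that someI_ex[of "\<lambda>Q. touches (2 * a) u x Q"] by (auto simp: G_def contact_set_def P_def)
  have "\<forall>x\<in>E. \<exists>l. best_minorant a u x l"
    using best_minorant_exists[where u = u and K = K, OF bd less_imp_le[OF a]] Ein(1) by blast
  then obtain l where l: "\<And>x. x \<in> E \<Longrightarrow> best_minorant a u x (l x)" by metis
  define z where "z x = a *\<^sub>R x + fst (l x)" for x
  have zP: "z x \<in> P ` G" if x: "x \<in> E" for x
  proof -
    obtain x' where x': "x' \<in> contact_set (2 * a) u - contact_set a u" "touches (2 * a) u x' (z x)"
      using vertex_slope_reached[OF bd K a Ein(2,3)[OF x] l[OF x]] unfolding z_def by metis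
    have x'G: "x' \<in> G" using x' by (simp add: G_def)
    have "z x = P x'"
      using touches_slope_unique[OF _ x'(2) P[OF x'G]] x'G Gs(2) a by auto
    then show ?thesis using x'G by blast
  qed
  \<comment> \<open>The summand \<open>a x\<close> makes \<open>z\<close> strongly monotone, since
    the slopes of best minorants are monotone.\<close>
  have expand: "a * norm (x - y) \<le> norm (z x - z y)" if x: "x \<in> E" and y: "y \<in> E" for x y
  proof (cases "x = y")
    case False
    have "a * (norm (x - y))\<^sup>2 \<le> (z x - z y) \<bullet> (x - y)"
      using best_minorant_monotone[OF l[OF x] l[OF y]]
      by (simp add: z_def power2_norm_eq_inner inner_diff_left inner_add_left inner_diff_right algebra_simps)
    also have "\<dots> \<le> norm (z x - z y) * norm (x - y)" by (rule norm_cauchy_schwarz)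
    finally have "a * norm (x - y) * norm (x - y) \<le> norm (z x - z y) * norm (x - y)"
      by (simp add: power2_eq_square mult.assoc)
    then show ?thesis using False by simp
  qed simp
  have "inj_on z E"
  proof (rule inj_onI)
    fix x y assume "x \<in> E" "y \<in> E" "z x = z y"
    then have "a * norm (x - y) \<le> 0" using expand[of x y] by simp
    then show "x = y" using a by (simp add: mult_le_0_iff)
  qed
  define f where "f = inv_into E z"
  have fz: "f (z x) = x" if "x \<in> E" for x
    using \<open>inj_on z E\<close> that by (simp add: f_def)
  have lip: "(1 / a)-lipschitz_on (z ` E) f"
  proof (rule lipschitz_onI)
    fix v w assume "v \<in> z ` E" "w \<in> z ` E"
    then obtain x y where "x \<in> E" "y \<in> E" "v = z x" "w = z y" by blast
    then show "dist (f v) (f w) \<le> 1 / a * dist v w"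
      using expand[of x y] fz a by (simp add: dist_norm field_simps)
  qed (use a in simp)
  have fE: "f ` (z ` E) = E" using fz by (force simp: image_image)
  have a2: "2 * a > 0" using a by simp
  note PG = slope_image_measure[where P = P, OF a2 Gs(2,1) P]
  have "measure lebesgue (f ` (z ` E)) \<le> (1 / a) ^ DIM(real^'n) * measure lebesgue (P ` G)"
    by (rule lipschitz_image_measure_le[OF PG(1) _ lip]) (use zP El fE in auto)
  then have "measure lebesgue E \<le> (1 / a) ^ CARD('n) * measure lebesgue (P ` G)"
    by (simp add: fE)
  also have "\<dots> \<le> (1 / a) ^ CARD('n) * ((2 * a) ^ CARD('n) * (real CARD('n) * Lam) ^ (CARD('n) - 1) * measure lebesgue G)"
    using PG(2) a by (intro mult_left_mono) auto
  also have "\<dots> = 2 ^ CARD('n) * (real CARD('n) * Lam) ^ (CARD('n) - 1) * measure lebesgue G"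
    using a by (simp add: power_mult_distrib power_divide)
  finally show ?thesis by (simp add: E_def G_def)
qed

text \<open>Each doubling step is \<open>contact_set_growth\<close> for the normalised measure of
  the complement, plus the loss in the boundary layer; \<open>decay_iteration\<close> then
  applies.\<close>

lemma contact_set_complement_decay:
  assumes bd: "\<And>y. y \<in> cball 0 1 \<Longrightarrow> \<bar>u y\<bar> \<le> K"
    and K: "K > 0" and t: "t \<ge> 2"
  shows "measure lebesgue (ball 0 1 - contact_set (2 ^ (10 * CARD('n)) * K * t) u)
     \<le> measure lebesgue (ball (0::real^'n) 1) * t powr (- ((1/8) * (2 * real CARD('n) * Lam) powr (1 - real CARD('n))))"
proof -
  define n where "n = CARD('n)"
  define \<beta> where "\<beta> = measure lebesgue (ball (0::real^'n) 1)"
  have n1: "1 \<le> n" using zero_less_card_finite[where 'a='n] by (simp add: n_def Suc_le_eq)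
  have b0: "\<beta> > 0" unfolding \<beta>_def using content_ball_pos[of 1 "0::real^'n"] by simp
  define q where "q = 2 * real n * Lam"
  have q1: "q \<ge> 1" using n1 Lam mult_mono[of 1 "real n" 1 Lam] by (simp add: q_def)
  \<comment> \<open>The reciprocal of the growth constant \<open>2 ^ n (n Lam) ^ (n - 1)\<close>,
    written with \<open>q = 2 n Lam\<close>; a quarter of it is the final exponent.\<close>
  define c where "c = (1/2) * q powr (1 - real n)"
  have c_eq: "c * (2 ^ n * (real n * Lam) ^ (n - 1)) = 1"
  proof -
    have "(2::real) ^ n = 2 * 2 ^ (n - 1)" using n1 by (simp add: power_eq_if)
    then have "2 ^ n * (real n * Lam) ^ (n - 1) = 2 * q ^ (n - 1)"
      by (simp add: q_def power_mult_distrib mult_ac)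
    moreover have "q powr (1 - real n) * q ^ (n - 1) = 1"
      using q1 n1 by (simp add: powr_realpow[symmetric] powr_add[symmetric] of_nat_diff)
    ultimately show ?thesis by (simp add: c_def)
  qed
  have c0: "0 < c" using q1 by (simp add: c_def)
  have chalf: "c \<le> 1/2"
  proof -
    have "q powr (1 - real n) \<le> q powr 0" using q1 n1 by (intro powr_mono) auto
    then show ?thesis using q1 by (simp add: c_def)
  qed
  define A where "A s = contact_set (2 ^ (10 * n) * K * s) u" for s
  define F where "F s = measure lebesgue (ball 0 1 - A s)" for s
  have As: "A s \<in> sets lebesgue" "A s \<subseteq> ball 0 1" if "s \<ge> 0" for s
    using contact_set_borel[OF cont bd, of "2 ^ (10 * n) * K * s"] that K
    by (auto simp: A_def contact_set_def[of "2 ^ (10 * n) * K * s"] intro!: sets_completionI_sets)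
  have lm: "X \<in> lmeasurable" if "X \<in> sets lebesgue" "X \<subseteq> ball 0 1" for X :: "(real^'n) set"
    using that bounded_subset[OF bounded_ball] by (intro bounded_set_imp_lmeasurable) auto
  have F1: "F s / \<beta> \<le> 1" if "1 \<le> s" for s
  proof -
    have "F s \<le> \<beta>" unfolding F_def \<beta>_def using As[of s] that
      by (intro measure_mono_fmeasurable) auto
    then show ?thesis using b0 by simp
  qed
  have step: "F (2 * s) / \<beta> \<le> (1 - c) * (F s / \<beta>) + c * (3/32) * s powr (- 1/2)" if s: "1 \<le> s" for s
  proof -
    define a where "a = 2 ^ (10 * n) * K * s"
    have a0: "a > 0" using K s by (simp add: a_def)
    define \<sigma> where "\<sigma> = sqrt (K / a)"
    \<comment> \<open>The factor \<open>K\<close> in the threshold cancels, so the layer width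
      depends only on \<open>n\<close> and \<open>s\<close>.\<close>
    have "K / a = 1 / ((2 ^ (5 * n))\<^sup>2 * s)"
      using K by (simp add: a_def flip: power_mult)
    then have \<sigma>_eq: "\<sigma> = 1 / (2 ^ (5 * n)) * s powr (- 1/2)"
      using s by (simp add: \<sigma>_def real_sqrt_divide real_sqrt_mult powr_minus_divide powr_half_sqrt)
    have s12: "0 < s powr (- 1/2)" "s powr (- 1/2) \<le> 1"
    proof -
      have "s powr (- 1/2) \<le> s powr 0" using s by (intro powr_mono) auto
      then show "s powr (- 1/2) \<le> 1" using s by simp
    qed (use s in simp)
    have n\<sigma>: "real n * \<sigma> \<le> (1/32) * s powr (- 1/2)"
    proof -
      have "real n / 2 ^ (5 * n) \<le> 1/32" using thirty_two_times_le_power[OF n1] by (simp add: field_simps)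
      then have "real n / 2 ^ (5 * n) * s powr (- 1/2) \<le> 1/32 * s powr (- 1/2)"
        using s12 by (intro mult_right_mono) auto
      then show ?thesis by (simp add: \<sigma>_eq)
    qed
    have \<sigma>0: "\<sigma> \<ge> 0" using K a0 by (simp add: \<sigma>_def)
    have "\<sigma> \<le> real n * \<sigma>" using n1 \<sigma>0 by (simp add: mult_le_cancel_right1)
    then have \<sigma>1: "3 * \<sigma> \<le> 1" using n\<sigma> s12 by linarith
    define r where "r = 1 - 3 * \<sigma>"
    have r: "0 \<le> r" "r \<le> 1" using \<sigma>0 \<sigma>1 by (auto simp: r_def)
    have A2: "A (2 * s) = contact_set (2 * a) u" "A s = contact_set a u"
      by (simp_all add: A_def a_def mult_ac)
    have mono: "A s \<subseteq> A (2 * s)" unfolding A2 using a0 by (intro contact_set_mono) simp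
    note Al = As[of s] As[of "2 * s"]
    have s0: "0 \<le> s" "0 \<le> 2 * s" using s by auto
    define E where "E = ball 0 r - A s"
    have "measure lebesgue E \<le> 2 ^ n * (real n * Lam) ^ (n - 1) * measure lebesgue (A (2 * s) - A s)"
      using contact_set_growth[OF bd K a0] by (simp add: E_def r_def \<sigma>_def A2 n_def)
    then have "c * measure lebesgue E \<le> c * (2 ^ n * (real n * Lam) ^ (n - 1)) * measure lebesgue (A (2 * s) - A s)"
      using c0 by (simp add: mult.assoc)
    then have cE: "c * measure lebesgue E \<le> measure lebesgue (A (2 * s) - A s)"
      by (simp only: c_eq mult_1)
    have F2: "F (2 * s) = F s - measure lebesgue (A (2 * s) - A s)"
    proof -
      have "ball 0 1 - A (2 * s) = (ball 0 1 - A s) - (A (2 * s) - A s)" using mono by blast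
      moreover have "measure lebesgue ((ball 0 1 - A s) - (A (2 * s) - A s)) = measure lebesgue (ball 0 1 - A s) - measure lebesgue (A (2 * s) - A s)"
        using Al s0 by (intro measurable_measure_Diff lm) auto
      ultimately show ?thesis by (simp add: F_def)
    qed
    have "ball (0::real^'n) r \<subseteq> ball 0 1" using r by (intro subset_ball) simp
    then have ballr: "measure lebesgue (ball 0 1 - ball (0::real^'n) r) = \<beta> - r ^ n * \<beta>"
      using content_ball_conv_unit_ball[OF r(1), of "0::real^'n"]
      by (subst measurable_measure_Diff) (auto simp: \<beta>_def n_def)
    \<comment> \<open>Bernoulli bounds the relative volume of the layer by
      \<open>3 n \<sigma>\<close>, which is at most \<open>(3/32) s powr (- 1/2)\<close>.\<close>
    have "1 - real n * (3 * \<sigma>) \<le> r ^ n"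
      using Bernoulli_inequality[of "- (3 * \<sigma>)" n] \<sigma>1 by (simp add: r_def)
    then have "\<beta> * (1 - real n * (3 * \<sigma>)) \<le> \<beta> * r ^ n" using b0 by (intro mult_left_mono) auto
    then have layer: "\<beta> - r ^ n * \<beta> \<le> \<beta> * (3 * (real n * \<sigma>))" by (simp add: algebra_simps)
    have Es: "E \<in> sets lebesgue" unfolding E_def using Al s0 by (intro sets.Diff) auto
    have "F s \<le> measure lebesgue (E \<union> (ball 0 1 - ball 0 r))"
      unfolding F_def
    proof (intro measure_mono_fmeasurable lm)
      show "ball 0 1 - A s \<subseteq> E \<union> (ball 0 1 - ball 0 r)" by (auto simp: E_def)
      show "ball 0 1 - A s \<in> sets lebesgue" using Al s0 by (intro sets.Diff) auto
      show "E \<union> (ball 0 1 - ball 0 r) \<in> sets lebesgue" using Es by (intro sets.Un sets.Diff) auto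
      show "E \<union> (ball 0 1 - ball 0 r) \<subseteq> ball 0 1" using \<open>ball 0 r \<subseteq> ball 0 1\<close> by (auto simp: E_def)
    qed
    also have "\<dots> \<le> measure lebesgue E + measure lebesgue (ball 0 1 - ball (0::real^'n) r)"
      using Es by (intro measure_Un_le sets.Diff) auto
    also have "\<dots> \<le> measure lebesgue E + \<beta> * (3 * ((1/32) * s powr (- 1/2)))"
    proof -
      have "\<beta> * (3 * (real n * \<sigma>)) \<le> \<beta> * (3 * ((1/32) * s powr (- 1/2)))"
        using n\<sigma> b0 by (intro mult_left_mono) auto
      then show ?thesis using ballr layer by linarith
    qed
    finally have "c * F s \<le> c * (measure lebesgue E + \<beta> * (3 * ((1/32) * s powr (- 1/2))))"
      using c0 by (intro mult_left_mono) auto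
    then have "F (2 * s) \<le> (1 - c) * F s + c * (3/32) * s powr (- 1/2) * \<beta>"
      using cE F2 by (simp add: algebra_simps)
    then have "F (2 * s) / \<beta> \<le> ((1 - c) * F s + c * (3/32) * s powr (- 1/2) * \<beta>) / \<beta>"
      using b0 by (intro divide_right_mono) auto
    then show ?thesis using b0 by (simp add: add_divide_distrib)
  qed
  have "F t / \<beta> \<le> t powr (- (c / 4))"
    by (rule decay_iteration[where f = "\<lambda>s. F s / \<beta>", OF c0 chalf F1 step t])
  then have "F t \<le> \<beta> * t powr (- (c / 4))" using b0 by (simp add: field_simps)
  moreover have "c / 4 = (1/8) * (2 * real CARD('n) * Lam) powr (1 - real CARD('n))"
    by (simp add: c_def q_def n_def)
  ultimately show ?thesis by (simp only: F_def A_def \<beta>_def n_def)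
qed

end

section \<open>The opening function\<close>

lemma tangent_paraboloid_iff_contact_set:
  fixes u :: "real^'n \<Rightarrow> real"
  assumes x: "x \<in> ball 0 1"
  shows "(\<exists>p c. tangent_below (ball 0 1) (paraboloid a p c) u x) \<longleftrightarrow> x \<in> contact_set a u"
proof
  assume "\<exists>p c. tangent_below (ball 0 1) (paraboloid a p c) u x"
  then obtain p c where tb: "tangent_below (ball 0 1) (paraboloid a p c) u x" by blast
  have le: "- (a / 2) * (y \<bullet> y) + p \<bullet> y + c \<le> u y" if "y \<in> cball 0 1" for y
    using tb that by (simp add: tangent_below_def paraboloid_def)
  have eq: "- (a / 2) * (x \<bullet> x) + p \<bullet> x + c = u x"
    using tb by (simp add: tangent_below_def paraboloid_def)
  have "touches a u x p"
    unfolding touches_def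
  proof
    fix y :: "real^'n" assume "y \<in> cball 0 1"
    from le[OF this] eq show "u x + a / 2 * (x \<bullet> x) + p \<bullet> (y - x) \<le> u y + a / 2 * (y \<bullet> y)"
      by (simp add: inner_diff_right)
  qed
  then show "x \<in> contact_set a u" using x by (auto simp: contact_set_def)
next
  assume "x \<in> contact_set a u"
  then obtain p where t: "\<And>y. y \<in> cball 0 1 \<Longrightarrow> u x + (a/2) * (x \<bullet> x) + p \<bullet> (y - x) \<le> u y + (a/2) * (y \<bullet> y)"
    unfolding contact_set_def touches_def by blast
  have "tangent_below (ball 0 1) (paraboloid a p (u x + (a/2) * (x \<bullet> x) - p \<bullet> x)) u x"
    unfolding tangent_below_def
  proof (intro conjI ballI)
    fix y :: "real^'n" assume "y \<in> closure (ball 0 1)"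
    then have "y \<in> cball 0 1" by simp
    from t[OF this] show "paraboloid a p (u x + (a/2) * (x \<bullet> x) - p \<bullet> x) y \<le> u y"
      by (simp add: paraboloid_def inner_diff_right)
  qed (simp add: paraboloid_def)
  then show "\<exists>p c. tangent_below (ball 0 1) (paraboloid a p c) u x" by blast
qed

lemma Theta_low_eq:
  fixes u :: "real^'n \<Rightarrow> real"
  assumes "x \<in> ball 0 1"
  shows "Theta_low (ball 0 1) u x = Inf {ereal a | a. a \<ge> 0 \<and> x \<in> contact_set a u}"
  unfolding Theta_low_def tangent_paraboloid_iff_contact_set[OF assms] ..

text \<open>Contact sets increase with the opening, so openings larger than \<open>a\<close> reduce
  to a sequence decreasing to \<open>a\<close>. This sidesteps whether the infimum is attained, and
  the countable intersection yields measurability.\<close>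

lemma Theta_low_gt_eq:
  assumes a: "a \<ge> 0"
  shows "{x \<in> ball 0 1. Theta_low (ball 0 1) u x > ereal a}
    = ball 0 1 - (\<Inter>k. contact_set (a + inverse (real (Suc k))) u)"
proof (intro Set.equalityI subsetI)
  fix x assume "x \<in> {x \<in> ball 0 1. Theta_low (ball 0 1) u x > ereal a}"
  then have x: "x \<in> ball 0 1" and gt: "ereal a < Theta_low (ball 0 1) u x" by auto
  have "x \<notin> (\<Inter>k. contact_set (a + inverse (real (Suc k))) u)"
  proof
    assume all: "x \<in> (\<Inter>k. contact_set (a + inverse (real (Suc k))) u)"
    have le: "Theta_low (ball 0 1) u x \<le> ereal (a + inverse (real (Suc k)))" for k
    proof -
      have "0 \<le> a + inverse (real (Suc k))" using a by simp
      moreover have "x \<in> contact_set (a + inverse (real (Suc k))) u" using all by blast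
      ultimately show ?thesis
        unfolding Theta_low_eq[OF x] by (intro Inf_lower) blast
    qed
    have "(\<lambda>k. ereal (a + inverse (real (Suc k)))) \<longlonglongrightarrow> ereal (a + 0)"
      by (intro tendsto_intros LIMSEQ_inverse_real_of_nat)
    then have "Theta_low (ball 0 1) u x \<le> ereal (a + 0)"
      by (rule LIMSEQ_le_const) (use le in blast)
    then show False using gt by simp
  qed
  then show "x \<in> ball 0 1 - (\<Inter>k. contact_set (a + inverse (real (Suc k))) u)" using x by simp
next
  fix x assume "x \<in> ball 0 1 - (\<Inter>k. contact_set (a + inverse (real (Suc k))) u)"
  then obtain k where x: "x \<in> ball 0 1" and k: "x \<notin> contact_set (a + inverse (real (Suc k))) u" by blast
  have "ereal (a + inverse (real (Suc k))) \<le> Theta_low (ball 0 1) u x"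
    unfolding Theta_low_eq[OF x]
  proof (rule Inf_greatest)
    fix e assume "e \<in> {ereal a |a. 0 \<le> a \<and> x \<in> contact_set a u}"
    then obtain a' where a': "e = ereal a'" "x \<in> contact_set a' u" by blast
    have "\<not> a' \<le> a + inverse (real (Suc k))"
      using contact_set_mono[of a' "a + inverse (real (Suc k))" u] a' k by blast
    then show "ereal (a + inverse (real (Suc k))) \<le> e" using a' by simp
  qed
  moreover have "ereal a < ereal (a + inverse (real (Suc k)))" by simp
  ultimately have "ereal a < Theta_low (ball 0 1) u x" by (rule less_le_trans[rotated])
  then show "x \<in> {x \<in> ball 0 1. Theta_low (ball 0 1) u x > ereal a}" using x by simp
qed

lemma Theta_low_gt_subset:
  "a \<ge> 0 \<Longrightarrow> {x \<in> ball 0 1. Theta_low (ball 0 1) u x > ereal a} \<subseteq> ball 0 1 - contact_set a u"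
  unfolding Theta_low_gt_eq using contact_set_mono[of a "a + inverse (real (Suc _))" u] by fastforce

theorem theorem2p4:
  fixes u :: "real^'n \<Rightarrow> real" and Lam t :: real
  assumes "Lam \<ge> 1"
    and "continuous_on (cball 0 1) u"
    and "visc_pucci_super Lam (ball 0 1) u"
    and "t \<ge> 2"
  shows "{x \<in> ball 0 1. Theta_low (ball 0 1) u x
            > ereal (2 ^ (10 * CARD('n)) * (SUP y\<in>ball 0 1. \<bar>u y\<bar>) * t)} \<in> sets lebesgue
    \<and> emeasure lebesgue {x \<in> ball 0 1. Theta_low (ball 0 1) u x
            > ereal (2 ^ (10 * CARD('n)) * (SUP y\<in>ball 0 1. \<bar>u y\<bar>) * t)}
        \<le> emeasure lebesgue (ball (0::real^'n) 1)
           * ennreal (t powr (- ((1/8) * (2 * real CARD('n) * Lam) powr (1 - real CARD('n)))))"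
proof -
  define K where "K = (SUP y\<in>ball 0 1. \<bar>u y\<bar>)"
  define \<tau> where "\<tau> = 2 ^ (10 * CARD('n)) * K * t"
  define \<Theta> where "\<Theta> = {x \<in> ball 0 1. Theta_low (ball 0 1) u x > ereal \<tau>}"
  interpret pucci_supersolution Lam u
    using assms by unfold_locales
  obtain C where C: "\<And>y. y \<in> cball 0 1 \<Longrightarrow> \<bar>u y\<bar> \<le> C"
    using continuous_on_cball_bounded[OF cont] by blast
  have bdd: "bdd_above ((\<lambda>y. \<bar>u y\<bar>) ` ball 0 1)"
    using C by (intro bdd_aboveI[of _ C]) auto
  have KB: "\<bar>u y\<bar> \<le> K" if "y \<in> ball 0 1" for y
    unfolding K_def using bdd that by (intro cSUP_upper)
  \<comment> \<open>The supremum is over the open ball; continuity carries the bound to the closed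
    ball, on which \<open>touches\<close> tests.\<close>
  have Kbd: "\<bar>u y\<bar> \<le> K" if y: "y \<in> cball 0 1" for y
  proof -
    have "continuous_on (closure (ball 0 1)) (\<lambda>y. \<bar>u y\<bar>)"
      using assms(2) by (simp add: continuous_on_rabs)
    then show ?thesis
      using continuous_le_on_closure[of "ball 0 1" "\<lambda>y. \<bar>u y\<bar>" y K] KB y by simp
  qed
  have K0: "K \<ge> 0" using KB[of 0] by simp
  have \<tau>0: "\<tau> \<ge> 0" using K0 assms(4) by (simp add: \<tau>_def)
  have \<Theta>s: "\<Theta> \<in> sets lebesgue"
  proof -
    have "contact_set (\<tau> + inverse (real (Suc k))) u \<in> sets borel" for k
      using \<tau>0 by (intro contact_set_borel[OF assms(2) Kbd]) auto
    then have "ball 0 1 - (\<Inter>k. contact_set (\<tau> + inverse (real (Suc k))) u) \<in> sets borel"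
      by (intro sets.Diff sets.countable_INT'') auto
    then show ?thesis
      unfolding \<Theta>_def Theta_low_gt_eq[OF \<tau>0] by (intro sets_completionI_sets) simp
  qed
  define e where "e = t powr (- ((1/8) * (2 * real CARD('n) * Lam) powr (1 - real CARD('n))))"
  have e0: "e \<ge> 0" by (simp add: e_def)
  have le: "emeasure lebesgue \<Theta> \<le> emeasure lebesgue (ball (0::real^'n) 1) * ennreal e"
  proof (cases "K = 0")
    case True
    \<comment> \<open>Here the threshold is 0 and the layer width loses its meaning; but
      \<open>u\<close> vanishes, so the zero paraboloid touches it at every point.\<close>
    have "touches 0 u x 0" if "x \<in> ball 0 1" for x
      using Kbd that unfolding touches_def True by auto
    then have "ball 0 1 \<subseteq> contact_set 0 u" unfolding contact_set_def by blast
    then have "\<Theta> = {}"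
      using Theta_low_gt_subset[of 0 u] True by (auto simp: \<Theta>_def \<tau>_def)
    then show ?thesis by simp
  next
    case False
    then have Kp: "K > 0" using K0 by simp
    define D where "D = ball 0 1 - contact_set \<tau> u"
    have "contact_set \<tau> u \<in> sets borel" by (rule contact_set_borel[OF assms(2) Kbd \<tau>0])
    then have "D \<in> sets lebesgue" unfolding D_def by (intro sets_completionI_sets) simp
    then have Dl: "D \<in> lmeasurable"
      by (rule bounded_set_imp_lmeasurable[rotated]) (auto simp: D_def intro: bounded_subset[OF bounded_ball])
    have "emeasure lebesgue \<Theta> \<le> emeasure lebesgue D"
      using Theta_low_gt_subset[OF \<tau>0, of u] Dl by (intro emeasure_mono) (auto simp: \<Theta>_def D_def)
    also have "\<dots> = ennreal (measure lebesgue D)"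
      using Dl by (rule emeasure_eq_measure2)
    also have "\<dots> \<le> ennreal (measure lebesgue (ball (0::real^'n) 1) * e)"
      using contact_set_complement_decay[OF Kbd Kp assms(4)]
      by (intro ennreal_leI) (simp only: D_def \<tau>_def e_def)
    also have "\<dots> = ennreal (measure lebesgue (ball (0::real^'n) 1)) * ennreal e"
      using e0 by (simp add: ennreal_mult)
    also have "ennreal (measure lebesgue (ball (0::real^'n) 1)) = emeasure lebesgue (ball (0::real^'n) 1)"
      by (rule emeasure_eq_measure2[symmetric]) simp
    finally show ?thesis .
  qed
  from \<Theta>s le show ?thesis
    unfolding \<Theta>_def \<tau>_def K_def e_def by (rule conjI)
qed

end
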